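(* Let $S$ be a countable strongly $0$-$E$-unitary inverse semigroup with universal group $G=\mathscr U(S)$ and idempotent set $E=E(S)$. Then there is a partial action of $G$ on $\widehat E_{tight}$ such that $\mathscr G_{tight}(S)\cong G\ltimes\widehat E_{tight}$ as topological groupoids; in particular, $\mathscr G_{tight}(S)$ is Hausdorff. Consequently, $C^*(\mathscr G_{tight}(S))\cong C_0(\widehat E_{tight})\rtimes G$ (full partial crossed product).
   Context: An inverse semigroup is a semigroup $S$ in which each $s$ has a unique $s^*$ with $s=ss^*s$ and $s^*=s^*ss^*$. $E(S)$ is its commutative subsemigroup of idempotents; the natural partial order is $s\le t$ iff $s=te$ for some $e\in E(S)$. Let $S$ have a zero. A partial homomorphism from $S$ to a group $G$ is a map $\varphi\colon S\setminus\{0\}\to G$ with $\varphi(st)=\varphi(s)\varphi(t)$ whenever $st\ne 0$; it is idempotent pure if $\varphi^{-1}(1)=E(S)\setminus\{0\}$. $S$ is strongly $0$-$E$-unitary if it admits an idempotent pure partial homomorphism to a group. The universal group $\mathscr U(S)$ is the group generated by the set $S$ subject to the relations $s\cdot t=st$ whenever $st\neq 0$ in $S$. $\widehat E$ is the space of non-zero homomorphisms $\varphi\colon E\to\{0,1\}$ with $\varphi(0)=0$, a subspace of $\{0,1\}^E$; $D(e)=\{\varphi\in\widehat E\mid\varphi(e)=1\}$. $S$ acts on $\widehat E$: for $\varphi\in D(s^*s)$, $s\varphi\in D(ss^* )$ is $(s\varphi)(e)=\varphi(s^*es)$. A filter on $E$ is a non-empty upward closed subset closed under products; it is identified with its characteristic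 function. An ultrafilter is a maximal proper filter. The tight spectrum $\widehat E_{tight}$ is the closure in $\widehat E$ of the set of ultrafilters; it is invariant under the action of $S$. $\mathscr G_{tight}(S)$ is the groupoid of germs of the action of $S$ on $\widehat E_{tight}$: classes $[s,\varphi]$ of pairs with $s\in S$, $\varphi\in D(s^*s)\cap\widehat E_{tight}$, where $(s,\varphi)\sim(t,\psi)$ iff $\varphi=\psi$ and there is $u\le s,t$ with $\varphi\in D(u^*u)$; $d[s,\varphi]=\varphi$, $r[s,\varphi]=s\varphi$, $[s,t\psi][t,\psi]=[st,\psi]$, $[s,\varphi]^{-1}=[s^*,s\varphi]$; a basis of the topology is given by the sets $\{[s,\varphi]\mid\varphi\in U\}$, $U\subseteq D(s^*s)\cap\widehat E_{tight}$ open in $\widehat E_{tight}$. It is étale, and $C^*(\mathscr G_{tight}(S))$ is its full groupoid $C^*$-algebra. A partial action of a discrete group $G$ on a locally compact Hausdorff space $X$ is a map $\theta$ from $G$ to the homeomorphisms between open subsets of $X$ with $\theta(1)=1_X$, $\theta(g^{-1})=\theta(g)^{-1}$, and $\theta(g)\theta(h)$ a restriction of $\theta(gh)$; the domain of $\theta(g)$ is written $X_{g^{-1}}$ and $\theta(g)(x)$ is written $gx$. The partial transformation groupoid is $G\ltimes X=\{(g,x)\mid x\in X_{g^{-1}}\}\subseteq G\times X$ with the subspace topology, $d(g,x)=x$, $r(g,x)=gx$, $(g,hy)(h,y)=(gh,y)$, $(g,x)^{-1}=(g^{-1},gx)$. Full partial crossed product $C_0(X)\rtimes G$: let $\alpha_g\colon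 C_0(X_{g^{-1}})\to C_0(X_g)$, $\alpha_g(f)(x)=f(g^{-1}x)$. On finite sums $\sum_g a_g\delta_g$ with $a_g\in C_0(X_g)$ put $(a\delta_g)(b\delta_h)=\alpha_g(\alpha_{g^{-1}}(a)b)\delta_{gh}$ and $(a\delta_g)^*=\alpha_{g^{-1}}(a^* )\delta_{g^{-1}}$; $C_0(X)\rtimes G$ is the enveloping $C^*$-algebra of this $*$-algebra. *)

theory Defs
  imports "HOL-Analysis.Analysis" "HOL-Algebra.Group"
begin

section \<open>Inverse semigroups with zero\<close>

class inverse_semigroup_zero = semigroup_mult + mult_zero +
  assumes ex1_star: "\<exists>!t. s = s * t * s \<and> t = t * s * t"

definition star :: "'s::inverse_semigroup_zero \<Rightarrow> 's" where
  "star s = (THE t. s = s * t * s \<and> t = t * s * t)"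

definition idempotents :: "'s::inverse_semigroup_zero set" where
  "idempotents = {e. e * e = e}"

definition natural_le :: "'s::inverse_semigroup_zero \<Rightarrow> 's \<Rightarrow> bool" where
  "natural_le s t \<longleftrightarrow> (\<exists>e\<in>idempotents. s = t * e)"

text \<open>A partial homomorphism is a map on the non-zero elements; the value at zero is ignored.\<close>

definition partial_hom ::
    "('h, 'm) monoid_scheme \<Rightarrow> ('s::inverse_semigroup_zero \<Rightarrow> 'h) \<Rightarrow> bool" where
  "partial_hom H \<phi> \<longleftrightarrow>
     (\<forall>s. s \<noteq> 0 \<longrightarrow> \<phi> s \<in> carrier H) \<and>
     (\<forall>s t. s * t \<noteq> 0 \<longrightarrow> \<phi> (s * t) = \<phi> s \<otimes>\<^bsub>H\<^esub> \<phi> t)"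

definition idempotent_pure ::
    "('h, 'm) monoid_scheme \<Rightarrow> ('s::inverse_semigroup_zero \<Rightarrow> 'h) \<Rightarrow> bool" where
  "idempotent_pure H \<phi> \<longleftrightarrow> {s. s \<noteq> 0 \<and> \<phi> s = \<one>\<^bsub>H\<^esub>} = idempotents - {0}"


section \<open>Group presentations and the universal group\<close>

text \<open>A letter \<open>(x, True)\<close> stands for the generator \<open>x\<close>, and \<open>(x, False)\<close> for its formal
  inverse. The set \<open>R\<close> contains the pairs of words that are declared equal.\<close>

inductive presentation_eq ::
    "(('x \<times> bool) list \<times> ('x \<times> bool) list) set \<Rightarrow>
     ('x \<times> bool) list \<Rightarrow> ('x \<times> bool) list \<Rightarrow> bool"
  for R where
  refl: "presentation_eq R u u"
| sym: "presentation_eq R u v \<Longrightarrow> presentation_eq R v u"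
| trans: "presentation_eq R u v \<Longrightarrow> presentation_eq R v w \<Longrightarrow> presentation_eq R u w"
| cancel: "presentation_eq R (u @ [(x, b), (x, \<not> b)] @ v) (u @ v)"
| relator: "(l, r) \<in> R \<Longrightarrow> presentation_eq R (u @ l @ v) (u @ r @ v)"

definition word_class ::
    "(('x \<times> bool) list \<times> ('x \<times> bool) list) set \<Rightarrow> ('x \<times> bool) list \<Rightarrow> ('x \<times> bool) list set" where
  "word_class R u = {v. presentation_eq R u v}"

definition presented_group ::
    "(('x \<times> bool) list \<times> ('x \<times> bool) list) set \<Rightarrow> ('x \<times> bool) list set monoid" where
  "presented_group R =
     \<lparr>carrier = range (word_class R),
      mult = (\<lambda>A B. \<Union>u\<in>A. \<Union>v\<in>B. word_class R (u @ v)),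
      one = word_class R []\<rparr>"

text \<open>All elements of the semigroup are generators; the generator \<open>0\<close> occurs in no relation.\<close>

definition universal_group :: "('s::inverse_semigroup_zero \<times> bool) list set monoid" where
  "universal_group =
     presented_group {([(s, True), (t, True)], [(s * t, True)]) | s t. s * t \<noteq> 0}"


section \<open>The tight spectrum\<close>

text \<open>The space \<open>{0,1}\<^sup>E\<close> is rendered as the product of discrete two-point spaces \<open>bool\<close> over the
  index set \<open>E\<close>; as usual for \<^const>\<open>product_topology\<close>, its points are the functions that are
  \<^const>\<open>undefined\<close> outside \<open>E\<close>. Multiplication in \<open>{0,1}\<close> is conjunction.\<close>

definition spectrum :: "('s::inverse_semigroup_zero \<Rightarrow> bool) set" where
  "spectrum = {\<phi> \<in> extensional idempotents.
     (\<forall>e\<in>idempotents. \<forall>f\<in>idempotents. \<phi> (e * f) \<longleftrightarrow> \<phi> e \<and> \<phi> f) \<and>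
     (\<exists>e\<in>idempotents. \<phi> e) \<and> \<not> \<phi> 0}"

definition spectrum_top :: "('s::inverse_semigroup_zero \<Rightarrow> bool) topology" where
  "spectrum_top =
     subtopology (product_topology (\<lambda>_. discrete_topology UNIV) idempotents) spectrum"

definition idem_filter :: "'s::inverse_semigroup_zero set \<Rightarrow> bool" where
  "idem_filter F \<longleftrightarrow> F \<subseteq> idempotents \<and> F \<noteq> {} \<and>
     (\<forall>e\<in>F. \<forall>f\<in>idempotents. natural_le e f \<longrightarrow> f \<in> F) \<and>
     (\<forall>e\<in>F. \<forall>f\<in>F. e * f \<in> F)"

definition idem_ultrafilter :: "'s::inverse_semigroup_zero set \<Rightarrow> bool" where
  "idem_ultrafilter F \<longleftrightarrow> idem_filter F \<and> F \<noteq> idempotents \<and>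
     (\<forall>F'. idem_filter F' \<and> F' \<noteq> idempotents \<and> F \<subseteq> F' \<longrightarrow> F' = F)"

definition char_fun :: "'s::inverse_semigroup_zero set \<Rightarrow> 's \<Rightarrow> bool" where
  "char_fun F = (\<lambda>e\<in>idempotents. e \<in> F)"

definition tight_spectrum :: "('s::inverse_semigroup_zero \<Rightarrow> bool) set" where
  "tight_spectrum = spectrum_top closure_of {char_fun F | F. idem_ultrafilter F}"

definition tight_top :: "('s::inverse_semigroup_zero \<Rightarrow> bool) topology" where
  "tight_top = subtopology spectrum_top tight_spectrum"

definition spec_act ::
    "'s::inverse_semigroup_zero \<Rightarrow> ('s \<Rightarrow> bool) \<Rightarrow> 's \<Rightarrow> bool" where
  "spec_act s \<phi> = (\<lambda>e\<in>idempotents. \<phi> (star s * e * s))"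


section \<open>Topological groupoids\<close>

text \<open>The arrows and the objects are the points of the two spaces. The product \<open>\<alpha>\<beta>\<close> is
  meaningful when \<open>d \<alpha> = r \<beta>\<close>.\<close>

record ('a, 'x) top_groupoid =
  arrow_top :: "'a topology"
  object_top :: "'x topology"
  gdom :: "'a \<Rightarrow> 'x"
  gran :: "'a \<Rightarrow> 'x"
  gmul :: "'a \<Rightarrow> 'a \<Rightarrow> 'a"
  ginv :: "'a \<Rightarrow> 'a"

definition top_groupoid_iso ::
    "('a, 'x) top_groupoid \<Rightarrow> ('b, 'y) top_groupoid \<Rightarrow> bool" where
  "top_groupoid_iso P Q \<longleftrightarrow>
     (\<exists>\<Phi> \<Phi>0. homeomorphic_map (arrow_top P) (arrow_top Q) \<Phi> \<and>
        homeomorphic_map (object_top P) (object_top Q) \<Phi>0 \<and>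
        (\<forall>\<alpha>\<in>topspace (arrow_top P).
           gdom Q (\<Phi> \<alpha>) = \<Phi>0 (gdom P \<alpha>) \<and> gran Q (\<Phi> \<alpha>) = \<Phi>0 (gran P \<alpha>) \<and>
           \<Phi> (ginv P \<alpha>) = ginv Q (\<Phi> \<alpha>)) \<and>
        (\<forall>\<alpha>\<in>topspace (arrow_top P). \<forall>\<beta>\<in>topspace (arrow_top P).
           gdom P \<alpha> = gran P \<beta> \<longrightarrow> \<Phi> (gmul P \<alpha> \<beta>) = gmul Q (\<Phi> \<alpha>) (\<Phi> \<beta>)))"


section \<open>The tight groupoid of germs\<close>

definition germ_rel ::
    "(('s::inverse_semigroup_zero \<times> ('s \<Rightarrow> bool)) \<times> ('s \<times> ('s \<Rightarrow> bool))) set" where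
  "germ_rel = {((s, \<phi>), (t, \<psi>)).
     \<phi> \<in> tight_spectrum \<and> \<phi> (star s * s) \<and> \<psi> \<in> tight_spectrum \<and> \<psi> (star t * t) \<and>
     \<phi> = \<psi> \<and> (\<exists>u. natural_le u s \<and> natural_le u t \<and> \<phi> (star u * u))}"

definition germ ::
    "'s::inverse_semigroup_zero \<Rightarrow> ('s \<Rightarrow> bool) \<Rightarrow> ('s \<times> ('s \<Rightarrow> bool)) set" where
  "germ s \<phi> = germ_rel `` {(s, \<phi>)}"

text \<open>The structure maps are defined through representatives, on which they do not depend.\<close>

definition tight_groupoid ::
    "(('s::inverse_semigroup_zero \<times> ('s \<Rightarrow> bool)) set, 's \<Rightarrow> bool) top_groupoid" where
  "tight_groupoid =
     \<lparr>arrow_top = topology_generated_by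
        {{germ s \<phi> | \<phi>. \<phi> \<in> U} | s U. openin tight_top U \<and> (\<forall>\<phi>\<in>U. \<phi> (star s * s))},
      object_top = tight_top,
      gdom = (\<lambda>A. THE \<phi>. \<exists>s. (s, \<phi>) \<in> A),
      gran = (\<lambda>A. THE \<psi>. \<exists>s \<phi>. (s, \<phi>) \<in> A \<and> \<psi> = spec_act s \<phi>),
      gmul = (\<lambda>A B. THE C. \<exists>s t \<psi>. (s, spec_act t \<psi>) \<in> A \<and> (t, \<psi>) \<in> B \<and>
        C = germ (s * t) \<psi>),
      ginv = (\<lambda>A. THE B. \<exists>s \<phi>. (s, \<phi>) \<in> A \<and> B = germ (star s) (spec_act s \<phi>))\<rparr>"


section \<open>Partial actions and their transformation groupoids\<close>

text \<open>A homeomorphism between open subsets is a partial function \<open>\<theta> g\<close>. In the usual notation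
  \<open>dom (\<theta> g)\<close> is \<open>X\<close> indexed by the inverse of \<open>g\<close>, and \<open>ran (\<theta> g)\<close> is \<open>X\<close> indexed by \<open>g\<close>.\<close>

definition partial_action ::
    "('g, 'm) monoid_scheme \<Rightarrow> 'x topology \<Rightarrow> ('g \<Rightarrow> 'x \<rightharpoonup> 'x) \<Rightarrow> bool" where
  "partial_action G X \<theta> \<longleftrightarrow>
     group G \<and> locally_compact_space X \<and> Hausdorff_space X \<and>
     (\<forall>g\<in>carrier G. openin X (dom (\<theta> g)) \<and> openin X (ran (\<theta> g)) \<and>
        homeomorphic_map (subtopology X (dom (\<theta> g))) (subtopology X (ran (\<theta> g)))
          (\<lambda>x. the (\<theta> g x))) \<and>
     \<theta> \<one>\<^bsub>G\<^esub> = Some |` topspace X \<and>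
     (\<forall>g\<in>carrier G. \<forall>x y. \<theta> (inv\<^bsub>G\<^esub> g) y = Some x \<longleftrightarrow> \<theta> g x = Some y) \<and>
     (\<forall>g\<in>carrier G. \<forall>h\<in>carrier G. \<theta> g \<circ>\<^sub>m \<theta> h \<subseteq>\<^sub>m \<theta> (g \<otimes>\<^bsub>G\<^esub> h))"

definition transformation_groupoid ::
    "('g, 'm) monoid_scheme \<Rightarrow> 'x topology \<Rightarrow> ('g \<Rightarrow> 'x \<rightharpoonup> 'x) \<Rightarrow> ('g \<times> 'x, 'x) top_groupoid" where
  "transformation_groupoid G X \<theta> =
     \<lparr>arrow_top = subtopology (prod_topology (discrete_topology (carrier G)) X)
        {(g, x). g \<in> carrier G \<and> x \<in> dom (\<theta> g)},
      object_top = X,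
      gdom = snd,
      gran = (\<lambda>(g, x). the (\<theta> g x)),
      gmul = (\<lambda>(g, y) (h, x). (g \<otimes>\<^bsub>G\<^esub> h, x)),
      ginv = (\<lambda>(g, x). (inv\<^bsub>G\<^esub> g, the (\<theta> g x)))\<rparr>"


section \<open>Enveloping C*-algebras\<close>

record 'a star_algebra =
  acarrier :: "'a set"
  aadd :: "'a \<Rightarrow> 'a \<Rightarrow> 'a"
  ascale :: "complex \<Rightarrow> 'a \<Rightarrow> 'a"
  amult :: "'a \<Rightarrow> 'a \<Rightarrow> 'a"
  astar :: "'a \<Rightarrow> 'a"

record 'a normed_star_algebra = "'a star_algebra" +
  anorm :: "'a \<Rightarrow> real"

definition cstar_seminorm :: "('a, 'm) star_algebra_scheme \<Rightarrow> ('a \<Rightarrow> real) \<Rightarrow> bool" where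
  "cstar_seminorm A p \<longleftrightarrow>
     (\<forall>a\<in>acarrier A. 0 \<le> p a \<and> p (astar A a) = p a \<and> p (amult A (astar A a) a) = (p a)\<^sup>2) \<and>
     (\<forall>c. \<forall>a\<in>acarrier A. p (ascale A c a) = cmod c * p a) \<and>
     (\<forall>a\<in>acarrier A. \<forall>b\<in>acarrier A.
        p (aadd A a b) \<le> p a + p b \<and> p (amult A a b) \<le> p a * p b)"

text \<open>The C*-seminorms on a *-algebra are exactly the functions \<open>a \<mapsto> \<parallel>\<pi> a\<parallel>\<close> for
  *-homomorphisms \<open>\<pi>\<close> into C*-algebras, equivalently for *-representations \<open>\<pi>\<close> on Hilbert
  spaces. Their supremum is meant for *-algebras on which it is finite at each element, as for
  the two algebras below.\<close>

definition max_cstar_seminorm :: "('a, 'm) star_algebra_scheme \<Rightarrow> 'a \<Rightarrow> real" where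
  "max_cstar_seminorm A a = (SUP p\<in>Collect (cstar_seminorm A). p a)"

definition pdist :: "('a, 'm) star_algebra_scheme \<Rightarrow> ('a \<Rightarrow> real) \<Rightarrow> 'a \<Rightarrow> 'a \<Rightarrow> real" where
  "pdist A p a b = p (aadd A a (ascale A (-1) b))"

definition cauchy_seqs ::
    "('a, 'm) star_algebra_scheme \<Rightarrow> ('a \<Rightarrow> real) \<Rightarrow> (nat \<Rightarrow> 'a) set" where
  "cauchy_seqs A p = {u. range u \<subseteq> acarrier A \<and>
     (\<forall>\<epsilon>>0. \<exists>N. \<forall>m\<ge>N. \<forall>n\<ge>N. pdist A p (u m) (u n) < \<epsilon>)}"

definition cauchy_rel ::
    "('a, 'm) star_algebra_scheme \<Rightarrow> ('a \<Rightarrow> real) \<Rightarrow> ((nat \<Rightarrow> 'a) \<times> (nat \<Rightarrow> 'a)) set" where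
  "cauchy_rel A p = {(u, v). u \<in> cauchy_seqs A p \<and> v \<in> cauchy_seqs A p \<and>
     (\<lambda>n. pdist A p (u n) (v n)) \<longlonglongrightarrow> 0}"

text \<open>The Hausdorff completion with respect to a seminorm: elements of seminorm zero are
  identified with zero.\<close>

definition completion ::
    "('a, 'm) star_algebra_scheme \<Rightarrow> ('a \<Rightarrow> real) \<Rightarrow> (nat \<Rightarrow> 'a) set normed_star_algebra" where
  "completion A p =
     \<lparr>acarrier = cauchy_seqs A p // cauchy_rel A p,
      aadd = (\<lambda>U V. \<Union>u\<in>U. \<Union>v\<in>V. cauchy_rel A p `` {\<lambda>n. aadd A (u n) (v n)}),
      ascale = (\<lambda>c U. \<Union>u\<in>U. cauchy_rel A p `` {\<lambda>n. ascale A c (u n)}),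
      amult = (\<lambda>U V. \<Union>u\<in>U. \<Union>v\<in>V. cauchy_rel A p `` {\<lambda>n. amult A (u n) (v n)}),
      astar = (\<lambda>U. \<Union>u\<in>U. cauchy_rel A p `` {\<lambda>n. astar A (u n)}),
      anorm = (\<lambda>U. THE r. \<exists>u\<in>U. (\<lambda>n. p (u n)) \<longlonglongrightarrow> r)\<rparr>"

definition enveloping_cstar ::
    "('a, 'm) star_algebra_scheme \<Rightarrow> (nat \<Rightarrow> 'a) set normed_star_algebra" where
  "enveloping_cstar A = completion A (max_cstar_seminorm A)"

definition cstar_iso :: "'a normed_star_algebra \<Rightarrow> 'b normed_star_algebra \<Rightarrow> bool" where
  "cstar_iso A B \<longleftrightarrow>
     (\<exists>\<Phi>. bij_betw \<Phi> (acarrier A) (acarrier B) \<and>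
        (\<forall>a\<in>acarrier A. \<forall>b\<in>acarrier A.
           \<Phi> (aadd A a b) = aadd B (\<Phi> a) (\<Phi> b) \<and> \<Phi> (amult A a b) = amult B (\<Phi> a) (\<Phi> b)) \<and>
        (\<forall>c. \<forall>a\<in>acarrier A. \<Phi> (ascale A c a) = ascale B c (\<Phi> a)) \<and>
        (\<forall>a\<in>acarrier A. \<Phi> (astar A a) = astar B (\<Phi> a) \<and> anorm B (\<Phi> a) = anorm A a))"


section \<open>The full C*-algebra of an etale groupoid\<close>

definition Cc_on :: "'x topology \<Rightarrow> 'x set \<Rightarrow> ('x \<Rightarrow> complex) set" where
  "Cc_on X U = {f. continuous_map (subtopology X U) euclidean f \<and>
     (\<exists>K. compactin X K \<and> K \<subseteq> U \<and> (\<forall>x. x \<notin> K \<longrightarrow> f x = 0))}"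

text \<open>For a possibly non-Hausdorff groupoid the convolution algebra is the linear span of the
  spaces of compactly supported continuous functions on open Hausdorff subsets, extended by zero
  (Connes). Each of these spaces is closed under scalars, so finite sums suffice. For a Hausdorff
  groupoid this is the usual space of compactly supported continuous functions.\<close>

definition Cc_span :: "'x topology \<Rightarrow> ('x \<Rightarrow> complex) set" where
  "Cc_span X = {(\<lambda>x. \<Sum>i<n. F i x) | (n::nat) F.
     \<forall>i<n. \<exists>U. openin X U \<and> Hausdorff_space (subtopology X U) \<and> F i \<in> Cc_on X U}"

text \<open>The sum defining the convolution has finitely many non-zero terms when the groupoid is
  etale.\<close>

definition convolution_algebra ::
    "('a, 'x) top_groupoid \<Rightarrow> ('a \<Rightarrow> complex) star_algebra" where
  "convolution_algebra P =
     \<lparr>acarrier = Cc_span (arrow_top P),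
      aadd = (\<lambda>f1 f2 \<gamma>. f1 \<gamma> + f2 \<gamma>),
      ascale = (\<lambda>c f \<gamma>. c * f \<gamma>),
      amult = (\<lambda>f1 f2 \<gamma>. \<Sum>(\<alpha>, \<beta>) \<in> {(\<alpha>, \<beta>).
        \<alpha> \<in> topspace (arrow_top P) \<and> \<beta> \<in> topspace (arrow_top P) \<and>
        gdom P \<alpha> = gran P \<beta> \<and> gmul P \<alpha> \<beta> = \<gamma> \<and> f1 \<alpha> \<noteq> 0 \<and> f2 \<beta> \<noteq> 0}. f1 \<alpha> * f2 \<beta>),
      astar = (\<lambda>f \<gamma>. if \<gamma> \<in> topspace (arrow_top P) then cnj (f (ginv P \<gamma>)) else 0)\<rparr>"

definition groupoid_cstar ::
    "('a, 'x) top_groupoid \<Rightarrow> (nat \<Rightarrow> 'a \<Rightarrow> complex) set normed_star_algebra" where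
  "groupoid_cstar P = enveloping_cstar (convolution_algebra P)"


section \<open>The full partial crossed product\<close>

text \<open>Functions in \<open>C\<^sub>0(U)\<close>, for \<open>U\<close> an open subset of \<open>X\<close>, are extended by zero outside \<open>U\<close>.\<close>

definition C0_on :: "'x topology \<Rightarrow> 'x set \<Rightarrow> ('x \<Rightarrow> complex) set" where
  "C0_on X U = {f. continuous_map (subtopology X U) euclidean f \<and> (\<forall>x. x \<notin> U \<longrightarrow> f x = 0) \<and>
     (\<forall>\<epsilon>>0. \<exists>K. compactin X K \<and> K \<subseteq> U \<and> (\<forall>x\<in>U - K. cmod (f x) < \<epsilon>))}"

definition act_fun ::
    "('g, 'm) monoid_scheme \<Rightarrow> ('g \<Rightarrow> 'x \<rightharpoonup> 'x) \<Rightarrow> 'g \<Rightarrow> ('x \<Rightarrow> complex) \<Rightarrow> 'x \<Rightarrow> complex" where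
  "act_fun G \<theta> g f x = (case \<theta> (inv\<^bsub>G\<^esub> g) x of Some y \<Rightarrow> f y | None \<Rightarrow> 0)"

text \<open>A finite sum of terms \<open>a\<^sub>g \<delta>\<^sub>g\<close> is the finitely supported function \<open>g \<mapsto> a\<^sub>g\<close>.\<close>

definition crossed_product_algebra ::
    "('g, 'm) monoid_scheme \<Rightarrow> 'x topology \<Rightarrow> ('g \<Rightarrow> 'x \<rightharpoonup> 'x) \<Rightarrow>
     ('g \<Rightarrow> 'x \<Rightarrow> complex) star_algebra" where
  "crossed_product_algebra G X \<theta> =
     \<lparr>acarrier = {a. finite {g. a g \<noteq> (\<lambda>_. 0)} \<and> {g. a g \<noteq> (\<lambda>_. 0)} \<subseteq> carrier G \<and>
        (\<forall>g\<in>carrier G. a g \<in> C0_on X (ran (\<theta> g)))},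
      aadd = (\<lambda>a b g x. a g x + b g x),
      ascale = (\<lambda>c a g x. c * a g x),
      amult = (\<lambda>a b k x.
        \<Sum>(g, h) \<in> {(g, h). a g \<noteq> (\<lambda>_. 0) \<and> b h \<noteq> (\<lambda>_. 0) \<and> g \<otimes>\<^bsub>G\<^esub> h = k}.
          act_fun G \<theta> g (\<lambda>y. act_fun G \<theta> (inv\<^bsub>G\<^esub> g) (a g) y * b h y) x),
      astar = (\<lambda>a k. if k \<in> carrier G
        then act_fun G \<theta> k (\<lambda>y. cnj (a (inv\<^bsub>G\<^esub> k) y)) else (\<lambda>_. 0))\<rparr>"

definition partial_crossed_product ::
    "('g, 'm) monoid_scheme \<Rightarrow> 'x topology \<Rightarrow> ('g \<Rightarrow> 'x \<rightharpoonup> 'x) \<Rightarrow>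
     (nat \<Rightarrow> 'g \<Rightarrow> 'x \<Rightarrow> complex) set normed_star_algebra" where
  "partial_crossed_product G X \<theta> = enveloping_cstar (crossed_product_algebra G X \<theta>)"

end

theory Submission
  imports Defs
begin

text \<open>The canonical map \<open>\<iota>\<close> from the non-zero elements of \<open>S\<close> to the universal group \<open>G\<close> is idempotent
  pure, because an idempotent pure partial homomorphism factors through it. If \<open>\<iota>(s) = \<iota>(t)\<close> and a
  character \<open>\<phi>\<close> lies in both domains, then \<open>st\<^sup>*\<close> is idempotent, so \<open>s\<close> and \<open>t\<close> have the common
  restriction \<open>st\<^sup>*t\<close> and the same germ at \<open>\<phi>\<close>. Therefore \<open>\<iota>(s)\<phi> = s\<phi>\<close> defines a partial action, and
  \<open>[s, \<phi>] \<mapsto> (\<iota>(s), \<phi>)\<close> is an isomorphism onto its transformation groupoid.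

  The convolution algebra of the latter is the subalgebra of the algebraic crossed product whose
  components have compact support. It is dense in the norm \<open>\<Sum>\<^sub>g \<parallel>a\<^sub>g\<parallel>\<close>, and this norm dominates
  every C*-seminorm on either algebra. Hence every C*-seminorm of the subalgebra extends, the maximal
  C*-seminorms agree, and so do the completions.\<close>


section \<open>Inverse semigroups\<close>

text \<open>The two algebras differ before completion: convolution only meets compactly supported
  coefficients, the crossed product all of \<open>C0_on\<close>. What compares them is a norm that
  dominates C*-seminorms about which nothing but the algebraic axioms is known. The C*-identity
  reduces this to the identity of G: the square of the seminorm of f\<delta>_g is the seminorm of
  the translate of |f|^2 over the identity. There remains a commutative algebra of functions,
  possibly without unit and not complete, so spectral theory is not at hand; the bound by the
  supremum comes from multiplying with unimodular functions.

  An arrow (g, y) of the transformation groupoid carries its source y, but the coefficient a_g is a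
  function on the range of g. Hence the passage from functions on arrows to coefficients evaluates
  at the arrow whose range is the given point. The algebra laws of convolution are pulled back along
  this injective map instead of being computed with sums over factorizations of arrows.\<close>

abbreviation dom_idem :: "'s::inverse_semigroup_zero \<Rightarrow> 's" where
  "dom_idem s \<equiv> star s * s"

lemma star_props: "s * star s * s = s" "star s * s * star s = star s"
proof -
  have "s = s * star s * s \<and> star s = star s * s * star s"
    unfolding star_def by (rule theI'[OF ex1_star])
  then show "s * star s * s = s" "star s * s * star s = star s" by auto
qed

lemma star_props':
  "s * (star s * s) = s" "star s * (s * star s) = star s"
  "s * (star s * (s * x)) = s * x" "star s * (s * (star s * x)) = star s * x"
  by (metis star_props mult.assoc)+

lemma star_unique: "s = s * t * s \<Longrightarrow> t = t * s * t \<Longrightarrow> star s = t"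
  using ex1_star[of s] star_props[of s] by metis

lemma star_star [simp]: "star (star s) = s"
  by (rule star_unique) (simp_all add: star_props)

lemma idempotentsD: "e \<in> idempotents \<Longrightarrow> e * e = e"
  and idempotentsD': "e \<in> idempotents \<Longrightarrow> e * (e * x) = e * x"
  unfolding idempotents_def by (auto simp flip: mult.assoc)

lemma idempotentsI: "e * e = e \<Longrightarrow> e \<in> idempotents"
  by (simp add: idempotents_def)

lemma star_idem [simp]: "e \<in> idempotents \<Longrightarrow> star e = e"
  by (rule star_unique) (simp_all add: idempotentsD)

lemma zero_idem [simp]: "0 \<in> idempotents"
  by (simp add: idempotents_def)

lemma dom_ran_idem [simp]: "star s * s \<in> idempotents" "s * star s \<in> idempotents"
  by (rule idempotentsI; simp add: mult.assoc star_props')+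

text \<open>With x the inverse of e f, the element f x e is another inverse of e f, so x = f x e by
  uniqueness. This form yields x x = x. An idempotent is its own inverse, and the inverse of x is e
  f, so e f = x.\<close>

lemma idem_mult_closed [simp]:
  assumes "e \<in> idempotents" "f \<in> idempotents"
  shows "e * f \<in> idempotents"
proof -
  define x where "x = star (e * f)"
  have 1: "e * (f * (x * (e * f))) = e * f" and 2: "x * (e * (f * x)) = x"
    using star_props'(1,2)[of "e * f"] by (simp_all add: x_def mult.assoc)
  have e: "e * e = e" "\<And>y. e * (e * y) = e * y" and f: "f * f = f" "\<And>y. f * (f * y) = f * y"
    using assms by (simp_all add: idempotentsD idempotentsD')
  have h3: "x * (e * (f * (x * y))) = x * y" for y
    using 2 by (metis mult.assoc)
  have "x = f * x * e"
    unfolding x_def by (rule star_unique) (simp_all add: mult.assoc e f 1 h3 flip: x_def)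
  then have h4: "f * (x * e) = x"
    by (simp add: mult.assoc)
  then have "x * x = f * (x * (e * (f * (x * e))))"
    by (metis mult.assoc)
  also have "\<dots> = x"
    by (subst h3) (rule h4)
  finally have "x \<in> idempotents"
    by (rule idempotentsI)
  moreover from this have "e * f = x"
    by (metis star_star star_idem x_def)
  ultimately show ?thesis by simp
qed

text \<open>The product f e is an inverse of e f, and so is e f itself because it is idempotent;
  inverses are unique.\<close>

lemma idem_commute:
  assumes "e \<in> idempotents" "f \<in> idempotents"
  shows "e * f = f * e"
proof -
  have "e * f \<in> idempotents" "f * e \<in> idempotents"
    using assms by auto
  then have 1: "e * (f * (e * f)) = e * f" and 2: "f * (e * (f * e)) = f * e"
    by (metis idempotentsD mult.assoc)+
  have e: "e * e = e" "\<And>y. e * (e * y) = e * y" and f: "f * f = f" "\<And>y. f * (f * y) = f * y"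
    using assms by (simp_all add: idempotentsD idempotentsD')
  have "star (e * f) = f * e"
    by (rule star_unique) (simp_all add: mult.assoc e f 1 2)
  then show ?thesis
    using assms by simp
qed

lemma idem_left_commute:
  "e \<in> idempotents \<Longrightarrow> f \<in> idempotents \<Longrightarrow> e * (f * x) = f * (e * x)"
  by (metis idem_commute mult.assoc)

text \<open>The idempotents \<open>t * star t\<close> and \<open>star s * s\<close> meet in the
  middle; once they are exchanged, each is absorbed by its new neighbour.\<close>

lemma star_mult: "star (s * t) = star t * star s"
proof (rule star_unique)
  have "s * (t * (star t * (star s * (s * t)))) = s * ((t * star t) * (star s * s)) * t"
    by (simp add: mult.assoc)
  also have "\<dots> = s * t"
    by (subst idem_commute) (simp_all add: mult.assoc star_props')
  finally show "s * t = s * t * (star t * star s) * (s * t)"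
    by (simp add: mult.assoc)
  have "star t * (star s * (s * (t * (star t * star s)))) =
      star t * ((star s * s) * (t * star t)) * star s"
    by (simp add: mult.assoc)
  also have "\<dots> = star t * star s"
    by (subst idem_commute) (simp_all add: mult.assoc star_props')
  finally show "star t * star s = star t * star s * (s * t) * (star t * star s)"
    by (simp add: mult.assoc)
qed

text \<open>An idempotent commutes past \<open>t * star t\<close>, so conjugation preserves
  idempotents. Both bracketings are listed so that simp recognises the terms with and without
  \<open>mult.assoc\<close>.\<close>

lemma conj_idem [simp]:
  assumes "e \<in> idempotents"
  shows "star s * e * s \<in> idempotents" "star s * (e * s) \<in> idempotents"
    and "s * e * star s \<in> idempotents" "s * (e * star s) \<in> idempotents"
proof -
  have *: "star t * (e * t) \<in> idempotents" for t
  proof (rule idempotentsI)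
    have "star t * (e * t) * (star t * (e * t)) = star t * (e * ((t * star t) * (e * t)))"
      by (simp add: mult.assoc)
    also have "\<dots> = star t * (e * t)"
      by (subst idem_left_commute) (simp_all add: assms idempotentsD' mult.assoc star_props')
    finally show "star t * (e * t) * (star t * (e * t)) = star t * (e * t)" .
  qed
  show "star s * e * s \<in> idempotents" "star s * (e * s) \<in> idempotents"
    and "s * e * star s \<in> idempotents" "s * (e * star s) \<in> idempotents"
    using *[of s] *[of "star s"] by (simp_all add: mult.assoc)
qed

text \<open>The inner \<open>s * star s\<close> commutes with idempotents and is absorbed. This is
  why a character composed with a conjugation is again multiplicative.\<close>

lemma conj_idem_mult:
  assumes "e \<in> idempotents" "f \<in> idempotents"
  shows "star s * (e * f) * s = (star s * e * s) * (star s * f * s)"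
proof -
  have "(star s * e * s) * (star s * f * s) = star s * (e * ((s * star s) * (f * s)))"
    by (simp add: mult.assoc)
  also have "\<dots> = star s * (e * f) * s"
    by (subst idem_left_commute) (simp_all add: assms mult.assoc star_props')
  finally show ?thesis by simp
qed

lemma natural_leI: "e \<in> idempotents \<Longrightarrow> s = t * e \<Longrightarrow> natural_le s t"
  by (auto simp: natural_le_def)

text \<open>A restriction on the left is also one on the right: e t = t f for the conjugated
  idempotent f = \<open>star t * e * t\<close>.\<close>

lemma natural_leI_left:
  assumes "e \<in> idempotents" "s = e * t"
  shows "natural_le s t"
proof (rule natural_leI)
  show "star t * e * t \<in> idempotents" using assms by simp
  have "t * (star t * e * t) = (t * star t) * (e * t)"
    by (simp add: mult.assoc)
  also have "\<dots> = e * ((t * star t) * t)"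
    by (subst idem_left_commute) (simp_all add: assms)
  finally show "s = t * (star t * e * t)"
    by (simp add: assms mult.assoc star_props')
qed

lemma natural_le_idem:
  assumes ef: "e \<in> idempotents" "f \<in> idempotents"
  shows "natural_le e f \<longleftrightarrow> e * f = e"
proof
  assume "natural_le e f"
  then obtain g where g: "e = f * g" "g \<in> idempotents" by (auto simp: natural_le_def)
  have "e * f = f * e" using ef by (rule idem_commute)
  also have "\<dots> = e" using g ef by (simp add: idempotentsD')
  finally show "e * f = e" .
next
  assume "e * f = e"
  then show "natural_le e f"
    using ef idem_commute[OF ef] by (intro natural_leI[of e]) simp_all
qed


section \<open>Presented groups\<close>

lemma presentation_eq_append_right:
  "presentation_eq R u v \<Longrightarrow> presentation_eq R (u @ w) (v @ w)"
proof (induction rule: presentation_eq.induct)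
  case (cancel u x b v)
  then show ?case using presentation_eq.cancel[of R u x b "v @ w"] by simp
next
  case (relator l r u v)
  then show ?case using presentation_eq.relator[of l r R u "v @ w"] by simp
qed (auto intro: presentation_eq.intros)

lemma presentation_eq_append_left:
  "presentation_eq R u v \<Longrightarrow> presentation_eq R (w @ u) (w @ v)"
proof (induction rule: presentation_eq.induct)
  case (cancel u x b v)
  then show ?case using presentation_eq.cancel[of R "w @ u" x b v] by simp
next
  case (relator l r u v)
  then show ?case using presentation_eq.relator[of l r R "w @ u" v] by simp
qed (auto intro: presentation_eq.intros)

lemma presentation_eq_append:
  "presentation_eq R u u' \<Longrightarrow> presentation_eq R v v' \<Longrightarrow> presentation_eq R (u @ v) (u' @ v')"
  by (meson presentation_eq.trans presentation_eq_append_left presentation_eq_append_right)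

lemma word_class_eq_iff: "word_class R u = word_class R v \<longleftrightarrow> presentation_eq R u v"
proof
  assume "word_class R u = word_class R v"
  then have "v \<in> word_class R u"
    by (auto simp: word_class_def intro: presentation_eq.refl)
  then show "presentation_eq R u v" by (simp add: word_class_def)
next
  assume "presentation_eq R u v"
  then show "word_class R u = word_class R v"
    using presentation_eq.trans presentation_eq.sym unfolding word_class_def by blast
qed

text \<open>The product is defined as a union over all representatives. They all give one and the
  same class, so the union collapses to it.\<close>

lemma presented_group_mult:
  "word_class R u \<otimes>\<^bsub>presented_group R\<^esub> word_class R v = word_class R (u @ v)"
proof -
  have "word_class R (u' @ v') = word_class R (u @ v)"
    if "u' \<in> word_class R u" "v' \<in> word_class R v" for u' v'
    using that unfolding word_class_eq_iff
    by (auto simp: word_class_def intro: presentation_eq_append presentation_eq.sym)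
  moreover have "u \<in> word_class R u" "v \<in> word_class R v"
    by (auto simp: word_class_def intro: presentation_eq.refl)
  ultimately have "(\<Union>u'\<in>word_class R u. \<Union>v'\<in>word_class R v. word_class R (u' @ v')) =
      word_class R (u @ v)"
    by blast
  then show ?thesis
    by (simp add: presented_group_def)
qed

lemma presented_group_carrier: "carrier (presented_group R) = range (word_class R)"
  and presented_group_one: "\<one>\<^bsub>presented_group R\<^esub> = word_class R []"
  by (simp_all add: presented_group_def)

lemma presentation_eq_inverse:
  "presentation_eq R (rev (map (\<lambda>(x, b). (x, \<not> b)) u) @ u) []"
proof (induction u)
  case (Cons a u)
  obtain x b where a: "a = (x, b)" by force
  let ?v = "rev (map (\<lambda>(x, b). (x, \<not> b)) u)"
  \<comment> \<open>The reversed word ends with the flipped letter of \<open>a\<close>, which meets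
    \<open>a\<close> itself. The rule \<open>cancel\<close> is used with the flag
    \<open>\<not> b\<close>, so the second letter appears with a double negation.\<close>
  have "presentation_eq R (?v @ [(x, \<not> b), (x, \<not> \<not> b)] @ u) (?v @ u)"
    by (rule presentation_eq.cancel)
  then show ?case
    using Cons.IH a by (auto intro: presentation_eq.trans)
qed (auto intro: presentation_eq.refl)

lemma group_presented_group: "group (presented_group R)"
proof (rule groupI)
  fix x assume "x \<in> carrier (presented_group R)"
  then obtain u where "x = word_class R u" by (auto simp: presented_group_carrier)
  then show "\<exists>y\<in>carrier (presented_group R).
      y \<otimes>\<^bsub>presented_group R\<^esub> x = \<one>\<^bsub>presented_group R\<^esub>"
    using presentation_eq_inverse[of R u]
    by (auto simp: presented_group_carrier presented_group_one presented_group_mult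
        word_class_eq_iff)
qed (auto simp: presented_group_carrier presented_group_one presented_group_mult)

fun word_value :: "('h, 'm) monoid_scheme \<Rightarrow> ('x \<Rightarrow> 'h) \<Rightarrow> ('x \<times> bool) list \<Rightarrow> 'h" where
  "word_value H f [] = \<one>\<^bsub>H\<^esub>"
| "word_value H f ((x, b) # w) = (if b then f x else inv\<^bsub>H\<^esub> f x) \<otimes>\<^bsub>H\<^esub> word_value H f w"

lemma (in group) word_value_closed: "range f \<subseteq> carrier G \<Longrightarrow> word_value G f w \<in> carrier G"
  by (induction w) (auto simp: image_subset_iff)

lemma (in group) word_value_append:
  "range f \<subseteq> carrier G \<Longrightarrow> word_value G f (u @ v) = word_value G f u \<otimes> word_value G f v"
proof (induction u)
  case (Cons a u)
  then have "f (fst a) \<in> carrier G" by auto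
  then show ?case
    using Cons by (cases a) (auto simp: word_value_closed m_assoc)
qed (simp add: word_value_closed)

text \<open>Von Dyck's theorem: a map of the generators into a group that respects the relators is
  constant on classes of words, hence induces a map on the presented group.\<close>

lemma (in group) word_value_cong:
  assumes "presentation_eq R u v" and f: "range f \<subseteq> carrier G"
    and "\<And>l r. (l, r) \<in> R \<Longrightarrow> word_value G f l = word_value G f r"
  shows "word_value G f u = word_value G f v"
  using assms(1)
proof induction
  case (cancel u x b v)
  have fx: "f x \<in> carrier G" using f by auto
  then have "f x \<otimes> (inv f x \<otimes> y) = y" "inv f x \<otimes> (f x \<otimes> y) = y" if "y \<in> carrier G" for y
    using that by (simp_all flip: m_assoc)
  then show ?case
    using fx by (simp add: word_value_append f word_value_closed)
qed (auto simp: word_value_append f assms(3))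

section \<open>The universal group\<close>

definition univ_gen :: "'s::inverse_semigroup_zero \<Rightarrow> ('s \<times> bool) list set" where
  "univ_gen s = word_class {([(s, True), (t, True)], [(s * t, True)]) | s t. s * t \<noteq> 0} [(s, True)]"

lemma group_universal_group: "group universal_group"
  unfolding universal_group_def by (rule group_presented_group)

lemma univ_gen_carrier [simp]: "univ_gen s \<in> carrier universal_group"
  by (auto simp: univ_gen_def universal_group_def presented_group_carrier)

lemma univ_gen_mult:
  "s * t \<noteq> 0 \<Longrightarrow> univ_gen (s * t) = univ_gen s \<otimes>\<^bsub>universal_group\<^esub> univ_gen t"
  unfolding univ_gen_def universal_group_def presented_group_mult word_class_eq_iff
  by (rule presentation_eq.sym, rule presentation_eq.relator[where u = "[]" and v = "[]", simplified])
     auto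

text \<open>The image of e satisfies g g = g, and the only idempotent of a group is its
  identity.\<close>

lemma univ_gen_idem:
  assumes "e \<in> idempotents" "e \<noteq> 0"
  shows "univ_gen e = \<one>\<^bsub>universal_group\<^esub>"
proof -
  interpret group "universal_group :: ('a \<times> bool) list set monoid"
    by (rule group_universal_group)
  have "univ_gen e \<otimes>\<^bsub>universal_group\<^esub> univ_gen e = univ_gen e"
    using univ_gen_mult[of e e] assms by (simp add: idempotentsD)
  then show ?thesis by simp
qed

lemma star_nonzero: "s \<noteq> 0 \<Longrightarrow> star s \<noteq> 0" "s \<noteq> 0 \<Longrightarrow> star s * s \<noteq> 0" "s \<noteq> 0 \<Longrightarrow> s * star s \<noteq> 0"
  by (metis star_props mult_zero_left mult_zero_right mult.assoc)+

lemma univ_gen_star: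
  assumes "s \<noteq> 0"
  shows "univ_gen (star s) = inv\<^bsub>universal_group\<^esub> univ_gen s"
proof -
  interpret group "universal_group :: ('a \<times> bool) list set monoid"
    by (rule group_universal_group)
  have "univ_gen (star s) \<otimes>\<^bsub>universal_group\<^esub> univ_gen s = \<one>\<^bsub>universal_group\<^esub>"
    using univ_gen_mult[of "star s" s] star_nonzero[OF assms] by (simp add: univ_gen_idem)
  then show ?thesis
    by (simp add: inv_equality)
qed

lemma univ_gen_idempotent_pure:
  fixes \<phi> :: "'s::inverse_semigroup_zero \<Rightarrow> 'h"
  assumes "group H" "partial_hom H \<phi>" "idempotent_pure H \<phi>"
    and "univ_gen (s::'s) = \<one>\<^bsub>universal_group\<^esub>" "s \<noteq> 0"
  shows "s \<in> idempotents"
proof -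
  interpret H: group H by fact
  let ?R = "{([(s, True), (t, True)], [(s * t, True)]) | s t::'s. s * t \<noteq> 0}"
  \<comment> \<open>The generator \<open>0\<close> also needs a value in \<open>H\<close>, and
    \<open>\<phi> 0\<close> may lie outside the carrier. Since \<open>0\<close> occurs in no
    relator, the identity can be chosen.\<close>
  define f where "f s = (if s = 0 then \<one>\<^bsub>H\<^esub> else \<phi> s)" for s
  have f: "range f \<subseteq> carrier H" "f s \<in> carrier H" for s
    using assms(2) by (auto simp: f_def partial_hom_def)
  have "presentation_eq ?R [(s, True)] []"
    using assms(4) unfolding univ_gen_def universal_group_def presented_group_one word_class_eq_iff .
  then have "word_value H f [(s, True)] = word_value H f []"
  proof (rule H.word_value_cong[OF _ f(1)])
    fix l r assume "(l, r) \<in> ?R"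
    then obtain s t where st: "l = [(s, True), (t, True)]" "r = [(s * t, True)]" "s * t \<noteq> 0"
      by blast
    then have "s \<noteq> 0" "t \<noteq> 0" by auto
    then have "f (s * t) = f s \<otimes>\<^bsub>H\<^esub> f t"
      using st assms(2) by (simp add: f_def partial_hom_def)
    then show "word_value H f l = word_value H f r"
      using st f(2) by simp
  qed
  then have "\<phi> s = \<one>\<^bsub>H\<^esub>"
    using f(2)[of s] \<open>s \<noteq> 0\<close> by (simp add: f_def)
  then show ?thesis
    using assms(3,5) by (auto simp: idempotent_pure_def)
qed

section \<open>The action on the tight spectrum\<close>

lemma spectrum_mult:
  "\<phi> \<in> spectrum \<Longrightarrow> e \<in> idempotents \<Longrightarrow> f \<in> idempotents \<Longrightarrow> \<phi> (e * f) \<longleftrightarrow> \<phi> e \<and> \<phi> f"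
  unfolding spectrum_def by blast

lemma spectrum_zero [simp]: "\<phi> \<in> spectrum \<Longrightarrow> \<not> \<phi> 0"
  by (simp add: spectrum_def)

lemma spectrum_ex: "\<phi> \<in> spectrum \<Longrightarrow> \<exists>e\<in>idempotents. \<phi> e"
  unfolding spectrum_def by blast

lemma spectrum_extensional: "\<phi> \<in> spectrum \<Longrightarrow> \<phi> \<in> extensional idempotents"
  unfolding spectrum_def by blast

lemma spectrumI:
  assumes "\<phi> \<in> extensional idempotents"
    and "\<And>e f. e \<in> idempotents \<Longrightarrow> f \<in> idempotents \<Longrightarrow> \<phi> (e * f) \<longleftrightarrow> \<phi> e \<and> \<phi> f"
    and "e \<in> idempotents" "\<phi> e" "\<not> \<phi> 0"
  shows "\<phi> \<in> spectrum"
  unfolding spectrum_def using assms by blast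

lemma spectrum_eqI:
  "\<phi> \<in> spectrum \<Longrightarrow> \<psi> \<in> spectrum \<Longrightarrow> (\<And>e. e \<in> idempotents \<Longrightarrow> \<phi> e \<longleftrightarrow> \<psi> e) \<Longrightarrow> \<phi> = \<psi>"
  by (rule extensionalityI[of _ idempotents]) (auto dest: spectrum_extensional)

lemma spec_act_apply: "e \<in> idempotents \<Longrightarrow> spec_act s \<phi> e = \<phi> (star s * e * s)"
  by (simp add: spec_act_def)

lemma spec_act_mult: "spec_act (s * t) \<phi> = spec_act s (spec_act t \<phi>)"
  unfolding spec_act_def by (rule restrict_ext) (simp add: star_mult mult.assoc)

text \<open>Multiplicativity is that of conjugation. The hypothesis that \<phi> lies in the domain
  of s supplies an idempotent with value 1, namely \<open>s * star s\<close>, whose conjugate is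
  \<open>dom_idem s\<close>.\<close>

lemma spec_act_spectrum:
  assumes "\<phi> \<in> spectrum" "\<phi> (dom_idem s)"
  shows "spec_act s \<phi> \<in> spectrum"
proof -
  have "spec_act s \<phi> (e * f) \<longleftrightarrow> spec_act s \<phi> e \<and> spec_act s \<phi> f"
    if "e \<in> idempotents" "f \<in> idempotents" for e f
    unfolding spec_act_apply[OF idem_mult_closed[OF that]] spec_act_apply[OF that(1)]
      spec_act_apply[OF that(2)] conj_idem_mult[OF that]
    using that assms by (intro spectrum_mult) simp_all
  moreover have "spec_act s \<phi> (s * star s)"
    using assms by (simp add: spec_act_apply mult.assoc star_props')
  moreover have "\<not> spec_act s \<phi> 0"
    using assms(1) by (simp add: spec_act_apply)
  ultimately show ?thesis
    by (intro spectrumI[of _ "s * star s"]) (auto simp: spec_act_def)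
qed

lemma spec_act_idem:
  assumes "\<phi> \<in> spectrum" "e \<in> idempotents" "\<phi> e"
  shows "spec_act e \<phi> = \<phi>"
proof (rule spectrum_eqI)
  show "spec_act e \<phi> \<in> spectrum"
    using assms by (intro spec_act_spectrum) (simp_all add: idempotentsD)
  fix f :: 'a assume "f \<in> idempotents"
  then show "spec_act e \<phi> f \<longleftrightarrow> \<phi> f"
    using assms by (simp add: spec_act_apply spectrum_mult)
qed fact

lemma spec_act_star:
  "\<phi> \<in> spectrum \<Longrightarrow> \<phi> (dom_idem s) \<Longrightarrow> spec_act (star s) (spec_act s \<phi>) = \<phi>"
  by (simp add: spec_act_idem flip: spec_act_mult)

lemma spec_act_ran [simp]: "spec_act s \<phi> (s * star s) = \<phi> (dom_idem s)"
  by (simp add: spec_act_apply mult.assoc star_props')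

text \<open>Conjugating the domain idempotent of s by t gives that of s t. So the condition that
  t\<phi> lies in the domain of s becomes a single condition on \<phi>, which is how composability
  is expressed from here on.\<close>

lemma spec_act_dom: "spec_act t \<phi> (dom_idem s) = \<phi> (dom_idem (s * t))"
  by (simp add: spec_act_apply star_mult mult.assoc)

lemma spectrum_dom_mult:
  assumes "\<phi> \<in> spectrum" "\<phi> (dom_idem (s * t))"
  shows "\<phi> (dom_idem t)"
proof -
  have "dom_idem (s * t) = dom_idem (s * t) * dom_idem t"
    by (simp add: star_mult mult.assoc star_props')
  then have "\<phi> (dom_idem (s * t) * dom_idem t)" using assms(2) by metis
  then show ?thesis using assms(1) by (simp add: spectrum_mult)
qed

section \<open>Filters and ultrafilters as characters\<close>

lemma char_fun_spectrum_iff: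
  assumes "F \<subseteq> idempotents"
  shows "char_fun F \<in> spectrum \<longleftrightarrow> idem_filter F \<and> F \<noteq> idempotents"
proof
  assume *: "char_fun F \<in> spectrum"
  have F: "e \<in> F \<longleftrightarrow> e \<in> idempotents \<and> char_fun F e" for e
    using assms by (auto simp: char_fun_def)
  have "0 \<notin> F" using F[of 0] * by simp
  then have "F \<noteq> idempotents" using zero_idem by metis
  moreover have "idem_filter F"
    unfolding idem_filter_def
  proof (intro conjI ballI impI)
    show "F \<noteq> {}" using spectrum_ex[OF *] F by auto
    fix e assume e: "e \<in> F"
    {
      fix f :: 'a assume f: "f \<in> idempotents" "natural_le e f"
      then have "e * f = e" using e F natural_le_idem by metis
      then show "f \<in> F" using spectrum_mult[OF *, of e f] e f F by metis
    }
    fix f assume "f \<in> F"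
    then show "e * f \<in> F" using spectrum_mult[OF *, of e f] e F by auto
  qed fact
  ultimately show "idem_filter F \<and> F \<noteq> idempotents" by simp
next
  assume *: "idem_filter F \<and> F \<noteq> idempotents"
  then have up: "e \<in> F \<Longrightarrow> f \<in> idempotents \<Longrightarrow> natural_le e f \<Longrightarrow> f \<in> F" for e f
    by (auto simp: idem_filter_def)
  \<comment> \<open>Zero lies below every idempotent, so a filter that contains it is all of E.
    Properness of the filter is therefore the condition on the character at zero.\<close>
  have "0 \<notin> F"
    using * up[of 0] by (auto simp: idem_filter_def natural_le_idem)
  moreover have "e * f \<in> F \<longleftrightarrow> e \<in> F \<and> f \<in> F"
    if ef: "e \<in> idempotents" "f \<in> idempotents" for e f
  proof -
    have "natural_le (e * f) e" "natural_le (e * f) f"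
      using ef natural_leI[of f "e * f" e] natural_leI_left[of e "e * f" f] by auto
    then show ?thesis using up ef * by (auto simp: idem_filter_def)
  qed
  moreover obtain e where "e \<in> F" "e \<in> idempotents"
    using * by (auto simp: idem_filter_def)
  ultimately show "char_fun F \<in> spectrum"
    by (intro spectrumI[of _ e]) (auto simp: char_fun_def)
qed

lemma spectrum_eq_char_fun:
  "\<phi> \<in> spectrum \<Longrightarrow> \<phi> = char_fun {e \<in> idempotents. \<phi> e}"
  by (rule extensionalityI[of _ idempotents]) (auto simp: char_fun_def spectrum_extensional)

text \<open>Inclusion of filters is pointwise implication of characters. Maximality in this form can
  be carried along the action without returning to sets.\<close>

lemma ultrafilters_eq_maximal:
  "{char_fun F | F. idem_ultrafilter F} =
    {\<phi> \<in> spectrum. \<forall>\<psi>\<in>spectrum. (\<forall>e\<in>idempotents. \<phi> e \<longrightarrow> \<psi> e) \<longrightarrow> \<psi> = \<phi>}" (is "?L = ?R")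
proof (intro equalityI subsetI)
  fix \<phi> assume "\<phi> \<in> ?L"
  then obtain F where F: "\<phi> = char_fun F" "idem_ultrafilter F" by auto
  then have sub: "F \<subseteq> idempotents" and "\<phi> \<in> spectrum"
    using char_fun_spectrum_iff by (auto simp: idem_ultrafilter_def idem_filter_def)
  moreover have "\<psi> = \<phi>" if \<psi>: "\<psi> \<in> spectrum" "\<forall>e\<in>idempotents. \<phi> e \<longrightarrow> \<psi> e" for \<psi>
  proof -
    let ?F = "{e \<in> idempotents. \<psi> e}"
    have "\<psi> = char_fun ?F" using \<psi>(1) by (rule spectrum_eq_char_fun)
    moreover have "idem_filter ?F \<and> ?F \<noteq> idempotents"
      using char_fun_spectrum_iff[of ?F] \<psi>(1) calculation by simp
    moreover have "F \<subseteq> ?F" using sub \<psi>(2) F(1) by (auto simp: char_fun_def)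
    ultimately have "?F = F" using F(2) by (simp add: idem_ultrafilter_def)
    then show ?thesis using \<open>\<psi> = char_fun ?F\<close> F(1) by metis
  qed
  ultimately show "\<phi> \<in> ?R" by simp
next
  fix \<phi> assume \<phi>: "\<phi> \<in> ?R"
  let ?F = "{e \<in> idempotents. \<phi> e}"
  have eq: "\<phi> = char_fun ?F" using \<phi> by (auto intro!: spectrum_eq_char_fun)
  then have "idem_filter ?F \<and> ?F \<noteq> idempotents"
    using char_fun_spectrum_iff[of ?F] \<phi> by simp
  moreover have "F' = ?F" if "idem_filter F' \<and> F' \<noteq> idempotents \<and> ?F \<subseteq> F'" for F'
  proof -
    have sub: "F' \<subseteq> idempotents" and "char_fun F' \<in> spectrum"
      using that char_fun_spectrum_iff[of F'] by (auto simp: idem_filter_def)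
    moreover have "\<forall>e\<in>idempotents. \<phi> e \<longrightarrow> char_fun F' e"
      using that by (auto simp: char_fun_def)
    ultimately have "char_fun F' = \<phi>" using \<phi> by auto
    then have "e \<in> idempotents \<Longrightarrow> e \<in> F' \<longleftrightarrow> \<phi> e" for e
      by (auto simp: char_fun_def)
    then show ?thesis using sub by auto
  qed
  ultimately have "idem_ultrafilter ?F" by (simp add: idem_ultrafilter_def)
  then show "\<phi> \<in> ?L" using eq by blast
qed

text \<open>A character \<psi> above s\<phi> is pulled back by \<open>star s\<close> to a character
  above \<phi>. Maximality of \<phi> identifies the two, and applying s again gives \<psi> =
  s\<phi>.\<close>

lemma spec_act_ultrafilter:
  assumes "\<phi> \<in> {char_fun F | F. idem_ultrafilter F}" "\<phi> (dom_idem s)"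
  shows "spec_act s \<phi> \<in> {char_fun F | F. idem_ultrafilter F}"
  unfolding ultrafilters_eq_maximal
proof (intro CollectI conjI ballI impI)
  have \<phi>: "\<phi> \<in> spectrum"
    and max: "\<And>\<psi>. \<psi> \<in> spectrum \<Longrightarrow> (\<forall>e\<in>idempotents. \<phi> e \<longrightarrow> \<psi> e) \<Longrightarrow> \<psi> = \<phi>"
    using assms(1) unfolding ultrafilters_eq_maximal by auto
  show "spec_act s \<phi> \<in> spectrum" using \<phi> assms(2) by (rule spec_act_spectrum)
  fix \<psi> assume \<psi>: "\<psi> \<in> spectrum" and le: "\<forall>e\<in>idempotents. spec_act s \<phi> e \<longrightarrow> \<psi> e"
  \<comment> \<open>The character s\<phi> has value 1 at \<open>s * star s\<close>, hence so has
    \<psi>; this puts \<psi> into the domain of \<open>star s\<close>.\<close>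
  have \<psi>s: "\<psi> (s * star s)" using le assms(2) spec_act_ran[of s \<phi>] by (metis dom_ran_idem(2))
  have "spec_act (star s) \<psi> = \<phi>"
  proof (rule max)
    show "spec_act (star s) \<psi> \<in> spectrum" using \<psi> \<psi>s by (simp add: spec_act_spectrum)
    show "\<forall>e\<in>idempotents. \<phi> e \<longrightarrow> spec_act (star s) \<psi> e"
    proof (intro ballI impI)
      fix e :: 'a assume e: "e \<in> idempotents" "\<phi> e"
      have "\<phi> (star s * (s * e * star s) * s) = \<phi> (dom_idem s * e * dom_idem s)"
        by (simp add: mult.assoc)
      then have "spec_act s \<phi> (s * e * star s)"
        using e \<phi> assms(2) by (simp add: spec_act_apply spectrum_mult)
      then show "spec_act (star s) \<psi> e" using le e by (simp add: spec_act_apply)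
    qed
  qed
  then show "\<psi> = spec_act s \<phi>"
    using spec_act_star[of \<psi> "star s"] \<psi> \<psi>s by simp
qed

section \<open>Topology of the spectrum and of its tight part\<close>

lemma topspace_spectrum_top [simp]: "topspace spectrum_top = spectrum"
  unfolding spectrum_top_def by (auto simp: PiE_def spectrum_extensional)

lemma continuous_map_spectrum_eval:
  assumes "e \<in> idempotents"
  shows "continuous_map spectrum_top (discrete_topology UNIV) (\<lambda>\<phi>. \<phi> e)"
  unfolding spectrum_top_def
  by (rule continuous_map_from_subtopology)
     (use continuous_map_product_projection[OF assms, of "\<lambda>_. discrete_topology UNIV"] in simp)

lemma openin_spectrum_eval:
  assumes "e \<in> idempotents"
  shows "openin spectrum_top {\<phi> \<in> spectrum. \<phi> e}"
  using openin_continuous_map_preimage[OF continuous_map_spectrum_eval[OF assms], of "{True}"] by simp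

text \<open>Being a non-zero function is not a closed condition, but it follows from the closed
  condition \<phi> e = 1. So D(e) is cut out of the compact product \<open>{0,1}\<close> to the
  power E by closed conditions alone.\<close>

lemma compactin_spectrum_eval:
  fixes e :: "'s::inverse_semigroup_zero"
  assumes "e \<in> idempotents"
  shows "compactin spectrum_top {\<phi> \<in> spectrum. \<phi> e}"
proof -
  let ?P = "product_topology (\<lambda>_. discrete_topology UNIV) idempotents :: ('s \<Rightarrow> bool) topology"
  define C where "C e = {\<phi> \<in> topspace ?P. \<phi> e}" for e
  define C' where "C' e = {\<phi> \<in> topspace ?P. \<not> \<phi> e}" for e
  have C: "closedin ?P (C e)" "closedin ?P (C' e)" if "e \<in> idempotents" for e
    unfolding C_def C'_def
    using closedin_continuous_map_preimage[OF continuous_map_product_projection[OF that,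
          of "\<lambda>_. discrete_topology (UNIV :: bool set)"], of "{True}"]
      closedin_continuous_map_preimage[OF continuous_map_product_projection[OF that,
          of "\<lambda>_. discrete_topology (UNIV :: bool set)"], of "{False}"] by simp_all
  \<comment> \<open>The equivalence of \<phi>(e f) with the conjunction of \<phi> e and \<phi> f is
    split by the value of \<phi>(e f), which writes it as a union of two closed sets.\<close>
  let ?Q = "\<lambda>e f. (C (e * f) \<inter> (C e \<inter> C f)) \<union> (C' (e * f) \<inter> (C' e \<union> C' f))"
  have "closedin ?P (\<Inter>(e, f)\<in>idempotents \<times> idempotents. ?Q e f)"
  proof (rule closedin_Inter)
    show "(\<lambda>(e, f). ?Q e f) ` (idempotents \<times> idempotents) \<noteq> {}"
      using zero_idem by blast
  qed (auto intro!: closedin_Un closedin_Int C)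
  then have "closedin ?P ((\<Inter>(e, f)\<in>idempotents \<times> idempotents. ?Q e f) \<inter> (C e \<inter> C' 0))"
    by (intro closedin_Int C assms) auto
  moreover have "(\<Inter>(e, f)\<in>idempotents \<times> idempotents. ?Q e f) \<inter> (C e \<inter> C' 0) = {\<phi> \<in> spectrum. \<phi> e}"
  proof (intro equalityI subsetI)
    fix \<phi> assume *: "\<phi> \<in> (\<Inter>(e, f)\<in>idempotents \<times> idempotents. ?Q e f) \<inter> (C e \<inter> C' 0)"
    then have "\<phi> (f * g) \<longleftrightarrow> \<phi> f \<and> \<phi> g" if "f \<in> idempotents" "g \<in> idempotents" for f g
      using that unfolding C_def C'_def by blast
    then show "\<phi> \<in> {\<phi> \<in> spectrum. \<phi> e}"
      using * assms by (auto intro!: spectrumI[of \<phi> e] simp: C_def C'_def PiE_def)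
  next
    fix \<phi> assume "\<phi> \<in> {\<phi> \<in> spectrum. \<phi> e}"
    then show "\<phi> \<in> (\<Inter>(e, f)\<in>idempotents \<times> idempotents. ?Q e f) \<inter> (C e \<inter> C' 0)"
      by (auto simp: C_def C'_def PiE_def spectrum_mult spectrum_extensional)
  qed
  ultimately have "compactin ?P {\<phi> \<in> spectrum. \<phi> e}"
    using closedin_compact_space[of ?P] by (simp add: compact_space_product_topology
        compact_space_discrete_topology)
  then show ?thesis
    unfolding spectrum_top_def by (simp add: compactin_subtopology)
qed

lemma Hausdorff_spectrum_top: "Hausdorff_space spectrum_top"
  unfolding spectrum_top_def
  by (intro Hausdorff_space_subtopology) (simp add: Hausdorff_space_product_topology)

lemma tight_subset_spectrum: "tight_spectrum \<subseteq> spectrum"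
  unfolding tight_spectrum_def using closure_of_subset_topspace by fastforce

lemma tight_spectrumD [simp, dest]: "\<phi> \<in> tight_spectrum \<Longrightarrow> \<phi> \<in> spectrum"
  using tight_subset_spectrum by auto

lemma topspace_tight_top [simp]: "topspace tight_top = tight_spectrum"
  unfolding tight_top_def using tight_subset_spectrum by auto

lemma closedin_tight_spectrum: "closedin spectrum_top tight_spectrum"
  unfolding tight_spectrum_def by simp

lemma openin_tight_eval:
  assumes "e \<in> idempotents"
  shows "openin tight_top {\<phi> \<in> tight_spectrum. \<phi> e}"
proof -
  have "{\<phi> \<in> tight_spectrum. \<phi> e} = {\<phi> \<in> spectrum. \<phi> e} \<inter> tight_spectrum" by auto
  then show ?thesis
    unfolding tight_top_def openin_subtopology
    using openin_spectrum_eval[OF assms] by blast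
qed

lemma Hausdorff_tight_top: "Hausdorff_space tight_top"
  unfolding tight_top_def by (intro Hausdorff_space_subtopology Hausdorff_spectrum_top)

lemma locally_compact_tight_top:
  "locally_compact_space (tight_top :: ('s::inverse_semigroup_zero \<Rightarrow> bool) topology)"
  unfolding locally_compact_space_def
proof
  fix \<phi> :: "'s \<Rightarrow> bool" assume "\<phi> \<in> topspace tight_top"
  then have \<phi>: "\<phi> \<in> tight_spectrum" by simp
  then obtain e where e: "e \<in> idempotents" "\<phi> e" using spectrum_ex[of \<phi>] by auto
  let ?U = "{\<phi> \<in> tight_spectrum. \<phi> e}"
  have "?U = {\<phi> \<in> spectrum. \<phi> e} \<inter> tight_spectrum" by auto
  then have "compactin spectrum_top ?U"
    using compact_Int_closedin[OF compactin_spectrum_eval[OF e(1)] closedin_tight_spectrum] by simp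
  then have "compactin tight_top ?U"
    unfolding tight_top_def by (simp add: compactin_subtopology)
  then show "\<exists>U K. openin tight_top U \<and> compactin tight_top K \<and> \<phi> \<in> U \<and> U \<subseteq> K"
    using \<phi> e openin_tight_eval by blast
qed

text \<open>Each coordinate of s\<phi> is a coordinate of \<phi>, at the conjugated
  idempotent.\<close>

lemma continuous_map_spec_act_spectrum:
  "continuous_map (subtopology spectrum_top {\<phi> \<in> spectrum. \<phi> (dom_idem s)}) spectrum_top (spec_act s)"
  (is "continuous_map ?D _ _")
proof -
  have "continuous_map ?D (product_topology (\<lambda>_. discrete_topology UNIV) idempotents) (spec_act s)"
    unfolding continuous_map_componentwise
  proof (intro conjI ballI)
    show "spec_act s ` topspace ?D \<subseteq> extensional idempotents"
      by (auto simp: spec_act_def)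
    fix e :: 'a assume e: "e \<in> idempotents"
    then show "continuous_map ?D (discrete_topology UNIV) (\<lambda>\<phi>. spec_act s \<phi> e)"
      unfolding spec_act_apply[OF e]
      by (intro continuous_map_from_subtopology continuous_map_spectrum_eval) simp
  qed
  \<comment> \<open>The instantiated equation unfolds the target topology only; the domain keeps its
    form so that the fact just proved still applies.\<close>
  then show ?thesis
    unfolding spectrum_top_def[THEN arg_cong[where f = "\<lambda>X. continuous_map ?D X (spec_act s)"]]
      continuous_map_in_subtopology
    by (auto simp: spec_act_spectrum)
qed

text \<open>The action of s is continuous on the open set D(\<open>star s * s\<close>) and maps
  ultrafilters to ultrafilters. Hence it maps limits of ultrafilters inside this set to limits of
  ultrafilters.\<close>

lemma spec_act_tight:
  assumes "\<phi> \<in> tight_spectrum" "\<phi> (dom_idem s)"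
  shows "spec_act s \<phi> \<in> tight_spectrum"
  unfolding tight_spectrum_def in_closure_of
proof (intro conjI allI impI)
  let ?D = "{\<phi> \<in> spectrum. \<phi> (dom_idem s)}"
  show "spec_act s \<phi> \<in> topspace spectrum_top"
    using assms by (simp add: spec_act_spectrum)
  fix T assume T: "spec_act s \<phi> \<in> T \<and> openin spectrum_top T"
  define V where "V = {\<psi> \<in> topspace (subtopology spectrum_top ?D). spec_act s \<psi> \<in> T}"
  have "openin (subtopology spectrum_top ?D) V"
    unfolding V_def
    using T by (intro openin_continuous_map_preimage[OF continuous_map_spec_act_spectrum]) simp
  \<comment> \<open>The preimage is open in the domain of s, which is itself open, so it is a
    neighbourhood in the whole spectrum and meets the ultrafilters.\<close>
  then have "openin spectrum_top V"
    by (rule openin_trans_full) (simp add: openin_spectrum_eval)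
  moreover have "\<phi> \<in> V"
    using assms T by (simp add: V_def)
  moreover have "\<phi> \<in> spectrum_top closure_of {char_fun F | F. idem_ultrafilter F}"
    using assms(1) unfolding tight_spectrum_def .
  ultimately obtain \<psi> where "\<psi> \<in> {char_fun F | F. idem_ultrafilter F}" "\<psi> \<in> V"
    unfolding in_closure_of by meson
  moreover from this have "\<psi> (dom_idem s)" "spec_act s \<psi> \<in> T"
    by (simp_all add: V_def)
  ultimately show "\<exists>y. y \<in> {char_fun F | F. idem_ultrafilter F} \<and> y \<in> T"
    using spec_act_ultrafilter[of \<psi> s] by blast
qed

lemma continuous_map_spec_act:
  "continuous_map (subtopology tight_top {\<phi> \<in> tight_spectrum. \<phi> (dom_idem s)}) tight_top (spec_act s)"
proof -
  let ?D = "{\<phi> \<in> tight_spectrum. \<phi> (dom_idem s)}"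
  have "subtopology tight_top ?D =
      subtopology (subtopology spectrum_top {\<phi> \<in> spectrum. \<phi> (dom_idem s)}) ?D"
    unfolding tight_top_def subtopology_subtopology by (rule arg_cong) auto
  then have "continuous_map (subtopology tight_top ?D) spectrum_top (spec_act s)"
    by (simp add: continuous_map_from_subtopology continuous_map_spec_act_spectrum)
  then show ?thesis
    unfolding tight_top_def[THEN arg_cong[where f = "\<lambda>X. continuous_map (subtopology tight_top ?D) X (spec_act s)"]]
      continuous_map_in_subtopology
    by (auto simp: spec_act_tight)
qed

section \<open>The partial action of the universal group\<close>

text \<open>The domain of g is the union of the sets D(\<open>star s * s\<close>) over all s that
  represent g. The value uses an arbitrary such s; under idempotent purity
  \<open>tight_action_eq\<close> shows that every admissible s gives the same point.\<close>

definition tight_action ::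
    "('s::inverse_semigroup_zero \<times> bool) list set \<Rightarrow> ('s \<Rightarrow> bool) \<rightharpoonup> ('s \<Rightarrow> bool)" where
  "tight_action g \<phi> =
     (if \<phi> \<in> tight_spectrum \<and> (\<exists>s. univ_gen s = g \<and> \<phi> (dom_idem s))
      then Some (spec_act (SOME s. univ_gen s = g \<and> \<phi> (dom_idem s)) \<phi>) else None)"

lemma dom_tight_action:
  "dom (tight_action g) = {\<phi> \<in> tight_spectrum. \<exists>s. univ_gen s = g \<and> \<phi> (dom_idem s)}"
  by (auto simp: tight_action_def dom_def)

lemma spectrum_dom_nonzero: "\<phi> \<in> spectrum \<Longrightarrow> \<phi> (dom_idem s) \<Longrightarrow> s \<noteq> 0"
  by auto

text \<open>Here u = s e with \<phi> e = 1. The idempotent e is non-zero, maps to the identity of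
  the group and fixes \<phi>, so u and s cannot be told apart at \<phi>.\<close>

lemma germ_univ_gen:
  assumes \<phi>: "\<phi> \<in> spectrum" and "natural_le u s" "\<phi> (dom_idem u)"
  shows "univ_gen u = univ_gen s" "spec_act u \<phi> = spec_act s \<phi>" "\<phi> (dom_idem s)"
proof -
  obtain e where e: "e \<in> idempotents" "u = s * e"
    using assms(2) by (auto simp: natural_le_def)
  then have "\<phi> e"
    using spectrum_dom_mult[OF \<phi>, of s e] assms(3) by (simp add: idempotentsD)
  then have "e \<noteq> 0" "u \<noteq> 0"
    using assms by auto
  then show "univ_gen u = univ_gen s"
    using e univ_gen_mult[of s e] univ_gen_carrier[of s]
    by (simp add: univ_gen_idem group.is_monoid group_universal_group monoid.r_one)
  show act: "spec_act u \<phi> = spec_act s \<phi>"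
    using e \<phi> \<open>\<phi> e\<close> by (simp add: spec_act_mult spec_act_idem)
  have "\<phi> (dom_idem u) = spec_act e \<phi> (dom_idem s)"
    by (simp add: spec_act_dom e)
  then show "\<phi> (dom_idem s)"
    using e \<phi> \<open>\<phi> e\<close> assms(3) by (simp add: spec_act_idem)
qed

text \<open>Purity is stated for the canonical map itself, so that the auxiliary group
  \<open>H\<close> does not occur below. The parameter \<open>S\<close> serves only to name the
  type.\<close>

locale pure_semigroup =
  fixes S :: "'s::inverse_semigroup_zero itself"
  assumes pure: "\<And>s::'s. univ_gen s = \<one>\<^bsub>universal_group\<^esub> \<Longrightarrow> s \<noteq> 0 \<Longrightarrow> s \<in> idempotents"
begin

interpretation U: group "universal_group :: ('s \<times> bool) list set monoid"
  by (rule group_universal_group)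

lemma common_restriction:
  fixes s t :: 's
  assumes \<phi>: "\<phi> \<in> spectrum" and eq: "univ_gen s = univ_gen t"
    and s: "\<phi> (dom_idem s)" and t: "\<phi> (dom_idem t)"
  shows "\<exists>u. natural_le u s \<and> natural_le u t \<and> \<phi> (dom_idem u)"
proof (intro exI conjI)
  let ?u = "s * (star t * t)"
  have "t \<noteq> 0" using \<phi> t spectrum_dom_nonzero by metis
  \<comment> \<open>The canonical map is multiplicative on non-zero products only. The common point
    \<phi> of the two domains is what shows \<open>s * star t\<close> to be non-zero.\<close>
  have "\<phi> (dom_idem s * dom_idem t)" using \<phi> s t by (simp add: spectrum_mult)
  then have "s * star t \<noteq> 0"
    using \<phi> by (metis mult.assoc mult_zero_left mult_zero_right spectrum_zero)
  moreover from this have "univ_gen (s * star t) = \<one>\<^bsub>universal_group\<^esub>"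
    using \<open>t \<noteq> 0\<close> by (simp add: univ_gen_mult univ_gen_star eq)
  ultimately have "s * star t \<in> idempotents" using pure by blast
  then show "natural_le ?u t"
    by (rule natural_leI_left) (simp add: mult.assoc)
  show "natural_le ?u s" by (rule natural_leI) simp_all
  have "\<phi> (dom_idem ?u) = spec_act (star t * t) \<phi> (dom_idem s)"
    by (simp only: spec_act_dom)
  then show "\<phi> (dom_idem ?u)" using \<phi> s t by (simp add: spec_act_idem)
qed

lemma spec_act_cong:
  fixes s t :: 's
  assumes "\<phi> \<in> spectrum" "univ_gen s = univ_gen t" "\<phi> (dom_idem s)" "\<phi> (dom_idem t)"
  shows "spec_act s \<phi> = spec_act t \<phi>"
  using common_restriction[OF assms] germ_univ_gen(2) assms(1) by metis

lemma tight_action_eq: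
  fixes s :: 's
  assumes "\<phi> \<in> tight_spectrum" "\<phi> (dom_idem s)" "univ_gen s = g"
  shows "tight_action g \<phi> = Some (spec_act s \<phi>)"
proof -
  let ?P = "\<lambda>s. univ_gen s = g \<and> \<phi> (dom_idem s)"
  have "?P s" using assms by simp
  then have "?P (SOME s. ?P s)" by (rule someI)
  then have "spec_act (SOME s. ?P s) \<phi> = spec_act s \<phi>"
    using assms by (intro spec_act_cong) auto
  moreover have "\<exists>s. ?P s" using assms by blast
  ultimately show ?thesis
    using assms(1) by (simp add: tight_action_def)
qed

lemma tight_action_SomeE:
  assumes "tight_action g \<phi> = Some \<psi>"
  obtains s :: 's where "\<phi> \<in> tight_spectrum" "\<phi> (dom_idem s)" "univ_gen s = g" "\<psi> = spec_act s \<phi>"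
proof -
  from assms obtain s where "\<phi> \<in> tight_spectrum" "univ_gen s = g" "\<phi> (dom_idem s)"
    by (auto simp: tight_action_def split: if_splits)
  then show ?thesis
    using that[of s] tight_action_eq[of \<phi> s g] assms by simp
qed

lemma tight_action_inv:
  fixes g :: "('s \<times> bool) list set"
  assumes "g \<in> carrier universal_group" "tight_action g \<phi> = Some \<psi>"
  shows "tight_action (inv\<^bsub>universal_group\<^esub> g) \<psi> = Some \<phi>"
proof -
  from assms(2) obtain s where s: "\<phi> \<in> tight_spectrum" "\<phi> (dom_idem s)" "univ_gen s = g"
    "\<psi> = spec_act s \<phi>" by (rule tight_action_SomeE)
  then have "s \<noteq> 0" using spectrum_dom_nonzero[of \<phi> s] by auto
  then have "univ_gen (star s) = inv\<^bsub>universal_group\<^esub> g"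
    using s by (simp add: univ_gen_star)
  then have "tight_action (inv\<^bsub>universal_group\<^esub> g) \<psi> = Some (spec_act (star s) \<psi>)"
    using s by (intro tight_action_eq) (simp_all add: spec_act_tight)
  then show ?thesis using s by (simp add: spec_act_star)
qed

lemma tight_action_inv_iff:
  fixes g :: "('s \<times> bool) list set"
  assumes "g \<in> carrier universal_group"
  shows "tight_action (inv\<^bsub>universal_group\<^esub> g) \<psi> = Some \<phi> \<longleftrightarrow> tight_action g \<phi> = Some \<psi>"
  using tight_action_inv[of g \<phi> \<psi>] tight_action_inv[of "inv\<^bsub>universal_group\<^esub> g" \<psi> \<phi>] assms by auto

lemma ran_tight_action:
  fixes g :: "('s \<times> bool) list set"
  assumes "g \<in> carrier universal_group"
  shows "ran (tight_action g) = dom (tight_action (inv\<^bsub>universal_group\<^esub> g))"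
  using tight_action_inv_iff[OF assms] by (auto simp: ran_def dom_def)

lemma openin_dom_tight_action: "openin tight_top (dom (tight_action g))"
proof -
  have "dom (tight_action g) = (\<Union>s\<in>{s. univ_gen s = g}. {\<phi> \<in> tight_spectrum. \<phi> (dom_idem s)})"
    unfolding dom_tight_action by auto
  then show ?thesis by (auto intro!: openin_tight_eval)
qed

text \<open>The domain of g is covered by the open sets D(\<open>star s * s\<close>) with s
  representing g, and on each of them the map is the action of s. A preimage is therefore a union of
  open preimages.\<close>

lemma continuous_map_tight_action:
  fixes g :: "('s \<times> bool) list set"
  shows "continuous_map (subtopology tight_top (dom (tight_action g))) tight_top
    (\<lambda>\<phi>. the (tight_action g \<phi>))"
  unfolding continuous_map
proof (intro conjI allI impI)
  show "(\<lambda>\<phi>. the (tight_action g \<phi>)) ` topspace (subtopology tight_top (dom (tight_action g)))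
      \<subseteq> topspace tight_top"
    by (auto simp: dom_tight_action tight_action_eq spec_act_tight)
  fix V :: "('s \<Rightarrow> bool) set" assume V: "openin tight_top V"
  let ?D = "\<lambda>s. {\<phi> \<in> tight_spectrum. \<phi> (dom_idem s)}"
  have "openin tight_top {\<phi> \<in> topspace (subtopology tight_top (?D s)). spec_act s \<phi> \<in> V}" for s
    using openin_continuous_map_preimage[OF continuous_map_spec_act V, of s]
    by (rule openin_trans_full) (simp add: openin_tight_eval)
  then have "openin tight_top (\<Union>s\<in>{s. univ_gen s = g}.
      {\<phi> \<in> topspace (subtopology tight_top (?D s)). spec_act s \<phi> \<in> V})" (is "openin _ ?W")
    by blast
  moreover have "?W = {\<phi> \<in> topspace (subtopology tight_top (dom (tight_action g))).
      the (tight_action g \<phi>) \<in> V}"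
    by (auto simp: dom_tight_action tight_action_eq)
  ultimately have "openin tight_top {\<phi> \<in> topspace (subtopology tight_top (dom (tight_action g))).
      the (tight_action g \<phi>) \<in> V}"
    by metis
  then show "openin (subtopology tight_top (dom (tight_action g)))
      {\<phi> \<in> topspace (subtopology tight_top (dom (tight_action g))). the (tight_action g \<phi>) \<in> V}"
    by (subst openin_open_subtopology[OF openin_dom_tight_action]) (simp add: subset_iff)
qed

lemma partial_action_tight:
  "partial_action universal_group tight_top
    (tight_action :: ('s \<times> bool) list set \<Rightarrow> ('s \<Rightarrow> bool) \<rightharpoonup> ('s \<Rightarrow> bool))"
  unfolding partial_action_def
proof (intro conjI ballI allI)
  fix g :: "('s \<times> bool) list set" assume g: "g \<in> carrier universal_group"
  show "openin tight_top (dom (tight_action g))" "openin tight_top (ran (tight_action g))"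
    by (simp_all add: ran_tight_action g openin_dom_tight_action)
  let ?g' = "inv\<^bsub>universal_group\<^esub> g"
  have ran_ex: "\<exists>x. tight_action g x = Some y \<and> tight_action ?g' y = Some x"
    if "y \<in> ran (tight_action g)" for y
    using that tight_action_inv[OF g] by (auto simp: ran_def)
  have dom_ex: "\<exists>y. tight_action g x = Some y \<and> tight_action ?g' y = Some x"
    if "x \<in> dom (tight_action g)" for x
    using that tight_action_inv[OF g] by (auto simp: dom_def)
  have "homeomorphic_maps (subtopology tight_top (dom (tight_action g)))
      (subtopology tight_top (ran (tight_action g)))
      (\<lambda>x. the (tight_action g x)) (\<lambda>x. the (tight_action ?g' x))"
    unfolding homeomorphic_maps_def continuous_map_in_subtopology
  proof (intro conjI ballI)
    show "continuous_map (subtopology tight_top (ran (tight_action g))) tight_top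
        (\<lambda>x. the (tight_action ?g' x))"
      by (simp add: ran_tight_action g continuous_map_tight_action)
    show "continuous_map (subtopology tight_top (dom (tight_action g))) tight_top
        (\<lambda>x. the (tight_action g x))"
      by (rule continuous_map_tight_action)
  qed (auto dest!: ran_ex dom_ex intro: ranI)
  then show "homeomorphic_map (subtopology tight_top (dom (tight_action g)))
      (subtopology tight_top (ran (tight_action g))) (\<lambda>x. the (tight_action g x))"
    using homeomorphic_map_maps by blast
next
  fix g h :: "('s \<times> bool) list set"
  assume "g \<in> carrier universal_group" "h \<in> carrier universal_group"
  show "tight_action g \<circ>\<^sub>m tight_action h \<subseteq>\<^sub>m tight_action (g \<otimes>\<^bsub>universal_group\<^esub> h)"
    unfolding map_le_def
  proof
    fix \<phi> assume "\<phi> \<in> dom (tight_action g \<circ>\<^sub>m tight_action h)"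
    then obtain \<psi> \<rho> where *: "tight_action h \<phi> = Some \<psi>" "tight_action g \<psi> = Some \<rho>"
      by (auto simp: map_comp_def split: option.splits)
    from *(1) obtain t where t: "\<phi> \<in> tight_spectrum" "\<phi> (dom_idem t)" "univ_gen t = h"
      "\<psi> = spec_act t \<phi>" by (rule tight_action_SomeE)
    from *(2) obtain s where s: "\<psi> (dom_idem s)" "univ_gen s = g" "\<rho> = spec_act s \<psi>"
      by (rule tight_action_SomeE)
    have dom: "\<phi> (dom_idem (s * t))"
      using s(1) unfolding t(4) spec_act_dom .
    then have "s * t \<noteq> 0"
      using t(1) spectrum_dom_nonzero[of \<phi> "s * t"] by auto
    then have "univ_gen (s * t) = g \<otimes>\<^bsub>universal_group\<^esub> h"
      using s t by (simp add: univ_gen_mult)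
    then show "(tight_action g \<circ>\<^sub>m tight_action h) \<phi> = tight_action (g \<otimes>\<^bsub>universal_group\<^esub> h) \<phi>"
      using * s t dom tight_action_eq[of \<phi> "s * t"] by (simp add: map_comp_def spec_act_mult)
  qed
next
  show "tight_action \<one>\<^bsub>universal_group\<^esub> = Some |` topspace (tight_top :: ('s \<Rightarrow> bool) topology)"
  proof
    fix \<phi> :: "'s \<Rightarrow> bool"
    show "tight_action \<one>\<^bsub>universal_group\<^esub> \<phi> = (Some |` topspace tight_top) \<phi>"
    proof (cases "\<phi> \<in> tight_spectrum")
      case True
      \<comment> \<open>Any idempotent with value 1 at \<phi> represents the identity of the group
        there, and it fixes \<phi>.\<close>
      then obtain e where e: "e \<in> idempotents" "\<phi> e"
        using spectrum_ex[of \<phi>] by auto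
      then have "e \<noteq> 0" using True spectrum_zero by blast
      then have "tight_action \<one>\<^bsub>universal_group\<^esub> \<phi> = Some (spec_act e \<phi>)"
        using e True by (intro tight_action_eq) (simp_all add: idempotentsD univ_gen_idem)
      then show ?thesis using e True by (simp add: spec_act_idem)
    qed (simp add: tight_action_def)
  qed
qed (simp_all add: group_universal_group locally_compact_tight_top Hausdorff_tight_top
      tight_action_inv_iff)


section \<open>The groupoid of germs\<close>

text \<open>At a fixed point the existence of a common restriction amounts to equality in the
  universal group: one direction is purity, the other holds because restrictions keep the group
  element. All structure maps, defined by unique description, are evaluated through this.\<close>

lemma mem_germ_iff:
  fixes s :: 's
  assumes "\<phi> \<in> tight_spectrum" "\<phi> (dom_idem s)"
  shows "(t, \<psi>) \<in> germ s \<phi> \<longleftrightarrow> \<psi> = \<phi> \<and> \<phi> (dom_idem t) \<and> univ_gen t = univ_gen s"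
proof -
  have "(\<exists>u. natural_le u s \<and> natural_le u t \<and> \<phi> (dom_idem u)) \<longleftrightarrow>
      \<phi> (dom_idem t) \<and> univ_gen t = univ_gen s"
    using common_restriction[of \<phi> s t] germ_univ_gen[of \<phi> _ s] germ_univ_gen[of \<phi> _ t] assms
    by (metis tight_spectrumD)
  then show ?thesis
    using assms by (auto simp: germ_def germ_rel_def)
qed

lemma germ_cong:
  fixes s t :: 's
  assumes "\<phi> \<in> tight_spectrum" "\<phi> (dom_idem s)" "\<phi> (dom_idem t)" "univ_gen s = univ_gen t"
  shows "germ s \<phi> = germ t \<phi>"
  using assms by (auto simp: mem_germ_iff)

definition germs :: "('s \<times> ('s \<Rightarrow> bool)) set set" where
  "germs = {germ s \<phi> | s \<phi>. \<phi> \<in> tight_spectrum \<and> \<phi> (dom_idem s)}"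

lemma topspace_tight_groupoid: "topspace (arrow_top tight_groupoid) = germs"
proof -
  let ?B = "{{germ s \<phi> | \<phi>. \<phi> \<in> U} | s U. openin tight_top U \<and> (\<forall>\<phi>\<in>U. \<phi> (dom_idem (s::'s)))}"
  have "\<Union> ?B = germs"
  proof (intro equalityI subsetI)
    fix A assume "A \<in> \<Union> ?B"
    then obtain s U \<phi> where *: "openin tight_top U" "\<forall>\<phi>\<in>U. \<phi> (dom_idem s)" "\<phi> \<in> U" "A = germ s \<phi>"
      by blast
    then have "\<phi> \<in> tight_spectrum"
      using openin_subset[OF *(1)] by auto
    then show "A \<in> germs" using * unfolding germs_def by blast
  next
    fix A :: "('s \<times> ('s \<Rightarrow> bool)) set"
    assume "A \<in> germs"
    then obtain s \<phi> where s: "A = germ s \<phi>" "\<phi> \<in> tight_spectrum" "\<phi> (dom_idem s)"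
      unfolding germs_def by blast
    let ?U = "{\<phi> \<in> tight_spectrum. \<phi> (dom_idem s)}"
    have "openin tight_top ?U" by (simp add: openin_tight_eval)
    then have "{germ s \<phi> | \<phi>. \<phi> \<in> ?U} \<in> ?B" by blast
    moreover have "A \<in> {germ s \<phi> | \<phi>. \<phi> \<in> ?U}" using s by blast
    ultimately show "A \<in> \<Union> ?B" by (rule UnionI)
  qed
  then show ?thesis
    by (simp add: tight_groupoid_def topology_generated_by_topspace)
qed

lemma gdom_germ:
  fixes s :: 's
  assumes "\<phi> \<in> tight_spectrum" "\<phi> (dom_idem s)"
  shows "gdom tight_groupoid (germ s \<phi>) = \<phi>"
  using assms by (auto simp: tight_groupoid_def mem_germ_iff intro!: the_equality)

lemma gran_germ:
  fixes s :: 's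
  assumes "\<phi> \<in> tight_spectrum" "\<phi> (dom_idem s)"
  shows "gran tight_groupoid (germ s \<phi>) = spec_act s \<phi>"
  using assms by (auto simp: tight_groupoid_def mem_germ_iff intro!: the_equality spec_act_cong)

text \<open>Any other representative t has the same group element as s, so it acts on \<phi> as s
  does, and \<open>star t\<close>, \<open>star s\<close> again have equal group elements. The
  description of the inverse is thus satisfied by one germ only.\<close>

lemma ginv_germ:
  fixes s :: 's
  assumes "\<phi> \<in> tight_spectrum" "\<phi> (dom_idem s)"
  shows "ginv tight_groupoid (germ s \<phi>) = germ (star s) (spec_act s \<phi>)"
proof -
  have "germ (star t) (spec_act t \<phi>) = germ (star s) (spec_act s \<phi>)"
    if "\<phi> (dom_idem t)" "univ_gen t = univ_gen s" for t
  proof -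
    have "spec_act t \<phi> = spec_act s \<phi>" using that assms by (intro spec_act_cong) auto
    moreover have "t \<noteq> 0" "s \<noteq> 0"
      using that assms spectrum_dom_nonzero[of \<phi>] by blast+
    then have "univ_gen (star t) = univ_gen (star s)" using that by (simp add: univ_gen_star)
    moreover have "spec_act t \<phi> (t * star t)" "spec_act s \<phi> (s * star s)"
      unfolding spec_act_ran by fact+
    ultimately show ?thesis
      using assms by (simp add: spec_act_tight germ_cong[of _ "star t" "star s"])
  qed
  note * = this
  show ?thesis
    unfolding tight_groupoid_def top_groupoid.simps
  proof (rule the_equality)
    show "\<exists>t \<psi>. (t, \<psi>) \<in> germ s \<phi> \<and> germ (star s) (spec_act s \<phi>) = germ (star t) (spec_act t \<psi>)"
      using assms by (intro exI[of _ s] exI[of _ \<phi>]) (simp add: mem_germ_iff)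
    fix B assume "\<exists>t \<psi>. (t, \<psi>) \<in> germ s \<phi> \<and> B = germ (star t) (spec_act t \<psi>)"
    then obtain t \<psi> where "(t, \<psi>) \<in> germ s \<phi>" "B = germ (star t) (spec_act t \<psi>)"
      by blast
    then show "B = germ (star s) (spec_act s \<phi>)"
      using *[of t] mem_germ_iff[OF assms, of t \<psi>] by simp
  qed
qed

lemma gmul_germ:
  fixes s t :: 's
  assumes "\<phi> \<in> tight_spectrum" "\<phi> (dom_idem t)" "spec_act t \<phi> (dom_idem s)"
  shows "gmul tight_groupoid (germ s (spec_act t \<phi>)) (germ t \<phi>) = germ (s * t) \<phi>"
proof -
  have "germ (s' * t') \<phi> = germ (s * t) \<phi>"
    if "univ_gen s' = univ_gen s" "univ_gen t' = univ_gen t"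
      "\<phi> (dom_idem t')" "spec_act t' \<phi> (dom_idem s')" for s' t'
  proof -
    \<comment> \<open>Both products have \<phi> in their domain. Being non-zero, they are mapped to
      the product of the group elements, which does not depend on the representatives.\<close>
    have "s' * t' \<noteq> 0" "s * t \<noteq> 0"
      using that assms spectrum_dom_nonzero[of \<phi>] unfolding spec_act_dom by blast+
    then show ?thesis
      using that assms unfolding spec_act_dom by (intro germ_cong) (simp_all add: univ_gen_mult)
  qed
  note * = this
  have t: "spec_act t \<phi> \<in> tight_spectrum" using assms(1,2) by (rule spec_act_tight)
  show ?thesis
    unfolding tight_groupoid_def top_groupoid.simps
  proof (rule the_equality)
    show "\<exists>s' t' \<psi>. (s', spec_act t' \<psi>) \<in> germ s (spec_act t \<phi>) \<and> (t', \<psi>) \<in> germ t \<phi> \<and>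
        germ (s * t) \<phi> = germ (s' * t') \<psi>"
      using assms t by (intro exI[of _ s] exI[of _ t] exI[of _ \<phi>]) (simp add: mem_germ_iff)
    fix C assume "\<exists>s' t' \<psi>. (s', spec_act t' \<psi>) \<in> germ s (spec_act t \<phi>) \<and> (t', \<psi>) \<in> germ t \<phi> \<and>
        C = germ (s' * t') \<psi>"
    then obtain s' t' \<psi> where "(s', spec_act t' \<psi>) \<in> germ s (spec_act t \<phi>)" "(t', \<psi>) \<in> germ t \<phi>"
      "C = germ (s' * t') \<psi>"
      by blast
    then show "C = germ (s * t) \<phi>"
      using *[of s' t'] mem_germ_iff[OF assms(1,2), of t' \<psi>]
        mem_germ_iff[OF t assms(3), of s' "spec_act t' \<psi>"] by simp
  qed
qed

section \<open>Germs as arrows of the transformation groupoid\<close>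

definition germ_to_pair :: "('s \<times> ('s \<Rightarrow> bool)) set \<Rightarrow> ('s \<times> bool) list set \<times> ('s \<Rightarrow> bool)" where
  "germ_to_pair A = (SOME p. \<exists>s. fst p = univ_gen s \<and> (s, snd p) \<in> A)"

text \<open>As a set, a germ is the whole fibre of semigroup elements over one group element and one
  point, so the inverse map needs no choice of a representative.\<close>

definition pair_to_germ :: "('s \<times> bool) list set \<times> ('s \<Rightarrow> bool) \<Rightarrow> ('s \<times> ('s \<Rightarrow> bool)) set" where
  "pair_to_germ p = {(s, \<phi>). \<phi> = snd p \<and> univ_gen s = fst p \<and> \<phi> (dom_idem s)}"

lemma germ_to_pair_germ:
  assumes "\<phi> \<in> tight_spectrum" "\<phi> (dom_idem s)"
  shows "germ_to_pair (germ s \<phi>) = (univ_gen s, \<phi>)"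
  unfolding germ_to_pair_def
  by (rule some_equality) (use assms in \<open>auto simp: mem_germ_iff\<close>)

lemma pair_to_germ_eq:
  assumes "\<phi> \<in> tight_spectrum" "\<phi> (dom_idem s)"
  shows "pair_to_germ (univ_gen s, \<phi>) = germ s \<phi>"
  using assms by (auto simp: pair_to_germ_def mem_germ_iff)

abbreviation tight_transformation where
  "tight_transformation \<equiv> transformation_groupoid universal_group
    (tight_top :: ('s \<Rightarrow> bool) topology) tight_action"

lemma arrows_tight_transformation:
  "{(g, x). g \<in> carrier universal_group \<and> x \<in> dom (tight_action g)} =
    {(univ_gen s, \<phi>) | s \<phi>. \<phi> \<in> tight_spectrum \<and> \<phi> (dom_idem (s::'s))}"
  by (auto simp: dom_tight_action)

lemma topspace_tight_transformation:
  "topspace (arrow_top tight_transformation) =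
    {(univ_gen s, \<phi>) | s \<phi>. \<phi> \<in> tight_spectrum \<and> \<phi> (dom_idem (s::'s))}"
  unfolding transformation_groupoid_def arrows_tight_transformation by auto

text \<open>The generator of the germ topology given by s and U corresponds to the slice of U over
  the group element of s, and such slices describe the topology of a product with a discrete
  factor.\<close>

lemma homeomorphic_maps_germs:
  "homeomorphic_maps (arrow_top tight_groupoid) (arrow_top tight_transformation)
    germ_to_pair pair_to_germ"
  unfolding homeomorphic_maps_def topspace_tight_groupoid topspace_tight_transformation
proof (intro conjI ballI)
  let ?W = "{(univ_gen s, \<phi>) | s \<phi>. \<phi> \<in> tight_spectrum \<and> \<phi> (dom_idem (s::'s))}"
  have arrow: "arrow_top tight_transformation = subtopology
      (prod_topology (discrete_topology (carrier universal_group)) tight_top) ?W"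
    by (simp add: transformation_groupoid_def arrows_tight_transformation)
  show "continuous_map (arrow_top tight_groupoid) (arrow_top tight_transformation) germ_to_pair"
    unfolding continuous_map topspace_tight_groupoid topspace_tight_transformation
  proof (intro conjI allI impI)
    show "germ_to_pair ` germs \<subseteq> ?W"
      by (auto simp: germs_def germ_to_pair_germ)
    fix V assume "openin (arrow_top tight_transformation) V"
    then obtain V' where V':
      "openin (prod_topology (discrete_topology (carrier universal_group)) tight_top) V'"
      "V = V' \<inter> ?W"
      unfolding arrow openin_subtopology by blast
    show "openin (arrow_top tight_groupoid) {A \<in> germs. germ_to_pair A \<in> V}"
    proof (subst openin_subopen, intro ballI)
      fix A assume "A \<in> {A \<in> germs. germ_to_pair A \<in> V}"
      then obtain s \<phi> where A: "A = germ s \<phi>" "\<phi> \<in> tight_spectrum" "\<phi> (dom_idem s)"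
        "(univ_gen s, \<phi>) \<in> V"
        by (auto simp: germs_def germ_to_pair_germ)
      \<comment> \<open>The slice of the open set over the group element of s is intersected with
        the domain of s; this makes the germs of s over it one of the generating sets.\<close>
      define U where "U = {\<psi> \<in> tight_spectrum. (univ_gen s, \<psi>) \<in> V'} \<inter>
        {\<psi> \<in> tight_spectrum. \<psi> (dom_idem s)}"
      have "continuous_map tight_top (prod_topology (discrete_topology (carrier universal_group))
          tight_top) (\<lambda>\<psi>. (univ_gen s, \<psi>))"
        by (intro continuous_map_pairedI) simp_all
      from openin_continuous_map_preimage[OF this V'(1)] have "openin tight_top U"
        unfolding U_def by (intro openin_Int openin_tight_eval) simp_all
      then have "openin (arrow_top tight_groupoid) {germ s \<psi> | \<psi>. \<psi> \<in> U}"
        unfolding tight_groupoid_def top_groupoid.simps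
        by (intro topology_generated_by_Basis) (use U_def in blast)
      moreover have "A \<in> {germ s \<psi> | \<psi>. \<psi> \<in> U}"
        using A V' by (auto simp: U_def)
      moreover have "{germ s \<psi> | \<psi>. \<psi> \<in> U} \<subseteq> {A \<in> germs. germ_to_pair A \<in> V}"
        using V'(2) by (auto simp: U_def germs_def germ_to_pair_germ)
      ultimately show "\<exists>T. openin (arrow_top tight_groupoid) T \<and> A \<in> T \<and>
          T \<subseteq> {A \<in> germs. germ_to_pair A \<in> V}"
        by blast
    qed
  qed
  show "continuous_map (arrow_top tight_transformation) (arrow_top tight_groupoid) pair_to_germ"
  proof -
    let ?B = "{{germ s \<phi> | \<phi>. \<phi> \<in> U} | s U. openin tight_top U \<and> (\<forall>\<phi>\<in>U. \<phi> (dom_idem (s::'s)))}"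
    have "continuous_map (arrow_top tight_transformation) (topology_generated_by ?B) pair_to_germ"
    proof (rule continuous_on_generated_topo)
      show "pair_to_germ ` topspace (arrow_top tight_transformation) \<subseteq> \<Union> ?B"
      proof -
        have "\<Union> ?B = germs"
          using topspace_tight_groupoid by (simp add: tight_groupoid_def topology_generated_by_topspace)
        moreover have "germ s \<phi> \<in> germs" if "\<phi> \<in> tight_spectrum" "\<phi> (dom_idem s)" for s \<phi>
          using that unfolding germs_def by blast
        ultimately show ?thesis
          by (auto simp: topspace_tight_transformation pair_to_germ_eq)
      qed
      fix B assume "B \<in> ?B"
      then obtain s U where B: "B = {germ s \<phi> | \<phi>. \<phi> \<in> U}" "openin tight_top U"
        "\<forall>\<phi>\<in>U. \<phi> (dom_idem s)" by blast
      have U: "U \<subseteq> tight_spectrum" using openin_subset[OF B(2)] by simp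
      have "pair_to_germ -` B \<inter> ?W = ({univ_gen s} \<times> U) \<inter> ?W"
      proof (intro equalityI subsetI)
        fix p assume p: "p \<in> pair_to_germ -` B \<inter> ?W"
        then obtain t \<phi> where t: "p = (univ_gen t, \<phi>)" "\<phi> \<in> tight_spectrum" "\<phi> (dom_idem t)"
          by blast
        then obtain \<psi> where \<psi>: "germ t \<phi> = germ s \<psi>" "\<psi> \<in> U"
          using p B(1) by (auto simp: pair_to_germ_eq)
        then have "\<psi> \<in> tight_spectrum" "\<psi> (dom_idem s)" using B(3) U by blast+
        then have "p = (univ_gen s, \<psi>)"
          using germ_to_pair_germ[of \<psi> s] germ_to_pair_germ[OF t(2,3)] \<psi>(1) t(1) by simp
        then show "p \<in> ({univ_gen s} \<times> U) \<inter> ?W"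
          using \<psi> p by blast
      next
        fix p assume p: "p \<in> ({univ_gen s} \<times> U) \<inter> ?W"
        then obtain \<phi> where "p = (univ_gen s, \<phi>)" "\<phi> \<in> U" by blast
        then show "p \<in> pair_to_germ -` B \<inter> ?W"
          using B U p pair_to_germ_eq[of \<phi> s] by blast
      qed
      moreover have "openin (arrow_top tight_transformation) (({univ_gen s} \<times> U) \<inter> ?W)"
        unfolding arrow using B(2)
        by (intro openin_subtopology_Int) (simp add: openin_prod_Times_iff)
      ultimately show "openin (arrow_top tight_transformation)
          (pair_to_germ -` B \<inter> topspace (arrow_top tight_transformation))"
        by (simp add: topspace_tight_transformation)
    qed
    then show ?thesis by (simp add: tight_groupoid_def)
  qed
qed (auto simp: germs_def germ_to_pair_germ pair_to_germ_eq)

text \<open>A \<open>top_groupoid\<close> is a bare record, so closure of the product has to be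
  proved separately. It is what allows the inverse homeomorphism to be applied to a product of
  arrows.\<close>

lemma gmul_tight_groupoid_closed:
  assumes "\<alpha> \<in> topspace (arrow_top (tight_groupoid :: (('s \<times> ('s \<Rightarrow> bool)) set, _) top_groupoid))"
    and "\<beta> \<in> topspace (arrow_top tight_groupoid)"
    and "gdom tight_groupoid \<alpha> = gran tight_groupoid \<beta>"
  shows "gmul tight_groupoid \<alpha> \<beta> \<in> topspace (arrow_top tight_groupoid)"
    and "germ_to_pair (gmul tight_groupoid \<alpha> \<beta>) =
      gmul tight_transformation (germ_to_pair \<alpha>) (germ_to_pair \<beta>)"
proof -
  from assms(1) obtain s \<psi> where s: "\<alpha> = germ s \<psi>" "\<psi> \<in> tight_spectrum" "\<psi> (dom_idem s)"
    by (auto simp: topspace_tight_groupoid germs_def)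
  from assms(2) obtain t \<phi> where t: "\<beta> = germ t \<phi>" "\<phi> \<in> tight_spectrum" "\<phi> (dom_idem t)"
    by (auto simp: topspace_tight_groupoid germs_def)
  have \<psi>: "\<psi> = spec_act t \<phi>"
    using s t assms(3) by (simp add: gdom_germ gran_germ)
  have dom: "\<phi> (dom_idem (s * t))"
    using s(3) unfolding \<psi> spec_act_dom .
  then have "s * t \<noteq> 0"
    using t(2) spectrum_dom_nonzero[of \<phi> "s * t"] by auto
  have mul: "gmul tight_groupoid \<alpha> \<beta> = germ (s * t) \<phi>"
    unfolding s(1) t(1) \<psi> by (rule gmul_germ) (use s t \<psi> in auto)
  show "gmul tight_groupoid \<alpha> \<beta> \<in> topspace (arrow_top tight_groupoid)"
    unfolding mul topspace_tight_groupoid germs_def using t dom by blast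
  show "germ_to_pair (gmul tight_groupoid \<alpha> \<beta>) =
      gmul tight_transformation (germ_to_pair \<alpha>) (germ_to_pair \<beta>)"
    unfolding s(1) t(1) using s(2,3) t(2,3) dom \<open>s * t \<noteq> 0\<close>
    by (simp add: germ_to_pair_germ transformation_groupoid_def univ_gen_mult mul[unfolded s(1) t(1)])
qed

lemma germ_to_pair_hom:
  assumes "\<alpha> \<in> topspace (arrow_top
    (tight_groupoid :: (('s \<times> ('s \<Rightarrow> bool)) set, 's \<Rightarrow> bool) top_groupoid))"
  shows "gdom tight_transformation (germ_to_pair \<alpha>) = gdom tight_groupoid \<alpha>"
    and "gran tight_transformation (germ_to_pair \<alpha>) = gran tight_groupoid \<alpha>"
    and "germ_to_pair (ginv tight_groupoid \<alpha>) = ginv tight_transformation (germ_to_pair \<alpha>)"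
    and "ginv tight_groupoid \<alpha> \<in> topspace (arrow_top tight_groupoid)"
proof -
  from assms obtain s \<phi> where s: "\<alpha> = germ s \<phi>" "\<phi> \<in> tight_spectrum" "\<phi> (dom_idem s)"
    by (auto simp: topspace_tight_groupoid germs_def)
  then have "s \<noteq> 0" using spectrum_dom_nonzero[of \<phi> s] by auto
  have star: "spec_act s \<phi> (dom_idem (star s))" "spec_act s \<phi> \<in> tight_spectrum"
    using s by (simp_all add: spec_act_tight)
  then show "ginv tight_groupoid \<alpha> \<in> topspace (arrow_top tight_groupoid)"
    unfolding s(1) ginv_germ[OF s(2,3)] topspace_tight_groupoid germs_def by blast
  show "gdom tight_transformation (germ_to_pair \<alpha>) = gdom tight_groupoid \<alpha>"
    "gran tight_transformation (germ_to_pair \<alpha>) = gran tight_groupoid \<alpha>"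
    "germ_to_pair (ginv tight_groupoid \<alpha>) = ginv tight_transformation (germ_to_pair \<alpha>)"
    using s star \<open>s \<noteq> 0\<close> by (simp_all add: germ_to_pair_germ transformation_groupoid_def gdom_germ
        gran_germ ginv_germ tight_action_eq univ_gen_star)
qed

lemma top_groupoid_iso_tight:
  "top_groupoid_iso (tight_groupoid :: (('s \<times> ('s \<Rightarrow> bool)) set, 's \<Rightarrow> bool) top_groupoid)
    tight_transformation"
  unfolding top_groupoid_iso_def
proof (rule exI[of _ germ_to_pair], rule exI[of _ id], intro conjI ballI impI)
  show "homeomorphic_map (arrow_top tight_groupoid) (arrow_top tight_transformation) germ_to_pair"
    using homeomorphic_maps_germs homeomorphic_map_maps by blast
  show "homeomorphic_map (object_top tight_groupoid) (object_top tight_transformation) id"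
    by (simp add: tight_groupoid_def transformation_groupoid_def homeomorphic_map_id)
qed (simp_all add: germ_to_pair_hom gmul_tight_groupoid_closed(2))

lemma Hausdorff_tight_groupoid: "Hausdorff_space (arrow_top
    (tight_groupoid :: (('s \<times> ('s \<Rightarrow> bool)) set, 's \<Rightarrow> bool) top_groupoid))"
proof -
  have "Hausdorff_space (arrow_top tight_transformation)"
    unfolding transformation_groupoid_def
    by (simp add: Hausdorff_space_subtopology Hausdorff_space_prod_topology Hausdorff_tight_top)
  then show ?thesis
    using homeomorphic_maps_germs homeomorphic_Hausdorff_space homeomorphic_space_def by blast
qed

end

section \<open>Star algebras and their completions\<close>

lemma null_sequence_le:
  fixes f g :: "nat \<Rightarrow> real"
  assumes "\<And>n. 0 \<le> f n" "\<And>n. f n \<le> g n" "g \<longlonglongrightarrow> 0"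
  shows "f \<longlonglongrightarrow> 0"
  by (rule tendsto_sandwich[OF _ _ tendsto_const assms(3)]) (use assms in simp_all)

text \<open>The laws collected here are the linear ones: sums, scalars, bilinearity of the product
  and conjugate linearity of the star. The record has neither a zero nor a negation;
  \<open>ascale A 0 b\<close> acts as zero for every b, and differences are formed by scaling with
  -1.\<close>

locale star_alg =
  fixes A :: "('a, 'm) star_algebra_scheme"
  assumes add_closed [simp]: "a \<in> acarrier A \<Longrightarrow> b \<in> acarrier A \<Longrightarrow> aadd A a b \<in> acarrier A"
    and scale_closed [simp]: "a \<in> acarrier A \<Longrightarrow> ascale A r a \<in> acarrier A"
    and mult_closed [simp]: "a \<in> acarrier A \<Longrightarrow> b \<in> acarrier A \<Longrightarrow> amult A a b \<in> acarrier A"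
    and star_closed [simp]: "a \<in> acarrier A \<Longrightarrow> astar A a \<in> acarrier A"
    and add_assoc: "a \<in> acarrier A \<Longrightarrow> b \<in> acarrier A \<Longrightarrow> c \<in> acarrier A \<Longrightarrow>
      aadd A (aadd A a b) c = aadd A a (aadd A b c)"
    and add_commute: "a \<in> acarrier A \<Longrightarrow> b \<in> acarrier A \<Longrightarrow> aadd A a b = aadd A b a"
    and scale_scale: "a \<in> acarrier A \<Longrightarrow> ascale A r (ascale A s a) = ascale A (r * s) a"
    and scale_one: "a \<in> acarrier A \<Longrightarrow> ascale A 1 a = a"
    and scale_add: "a \<in> acarrier A \<Longrightarrow> b \<in> acarrier A \<Longrightarrow>
      ascale A r (aadd A a b) = aadd A (ascale A r a) (ascale A r b)"
    and add_scale: "a \<in> acarrier A \<Longrightarrow> aadd A (ascale A r a) (ascale A s a) = ascale A (r + s) a"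
    and add_scale_zero: "a \<in> acarrier A \<Longrightarrow> b \<in> acarrier A \<Longrightarrow> aadd A a (ascale A 0 b) = a"
    and mult_add_left: "a \<in> acarrier A \<Longrightarrow> b \<in> acarrier A \<Longrightarrow> c \<in> acarrier A \<Longrightarrow>
      amult A (aadd A a b) c = aadd A (amult A a c) (amult A b c)"
    and mult_add_right: "a \<in> acarrier A \<Longrightarrow> b \<in> acarrier A \<Longrightarrow> c \<in> acarrier A \<Longrightarrow>
      amult A c (aadd A a b) = aadd A (amult A c a) (amult A c b)"
    and mult_scale_left: "a \<in> acarrier A \<Longrightarrow> b \<in> acarrier A \<Longrightarrow>
      amult A (ascale A r a) b = ascale A r (amult A a b)"
    and mult_scale_right: "a \<in> acarrier A \<Longrightarrow> b \<in> acarrier A \<Longrightarrow>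
      amult A a (ascale A r b) = ascale A r (amult A a b)"
    and star_add: "a \<in> acarrier A \<Longrightarrow> b \<in> acarrier A \<Longrightarrow>
      astar A (aadd A a b) = aadd A (astar A a) (astar A b)"
    and star_scale: "a \<in> acarrier A \<Longrightarrow> astar A (ascale A r a) = ascale A (cnj r) (astar A a)"
begin

definition diff :: "'a \<Rightarrow> 'a \<Rightarrow> 'a" where
  "diff a b = aadd A a (ascale A (- 1) b)"

lemma diff_closed [simp]: "a \<in> acarrier A \<Longrightarrow> b \<in> acarrier A \<Longrightarrow> diff a b \<in> acarrier A"
  by (simp add: diff_def)

lemma add_left_commute:
  "a \<in> acarrier A \<Longrightarrow> b \<in> acarrier A \<Longrightarrow> c \<in> acarrier A \<Longrightarrow>
    aadd A b (aadd A a c) = aadd A a (aadd A b c)"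
  by (metis add_assoc add_commute)

lemma scale_minus_one_add: "a \<in> acarrier A \<Longrightarrow> aadd A (ascale A (- 1) a) a = ascale A 0 a"
  using add_scale[of a "- 1" 1] by (simp add: scale_one)

lemma diff_self: "a \<in> acarrier A \<Longrightarrow> diff a a = ascale A 0 a"
  by (simp add: diff_def add_commute[of a] scale_minus_one_add)

lemma diff_add_cancel:
  "a \<in> acarrier A \<Longrightarrow> b \<in> acarrier A \<Longrightarrow> aadd A (diff a b) b = a"
  by (simp add: diff_def add_assoc scale_minus_one_add add_scale_zero)

lemma diff_swap: "a \<in> acarrier A \<Longrightarrow> b \<in> acarrier A \<Longrightarrow> ascale A (- 1) (diff a b) = diff b a"
  by (simp add: diff_def scale_add scale_scale scale_one add_commute)

lemma diff_trans:
  assumes "a \<in> acarrier A" "b \<in> acarrier A" "c \<in> acarrier A"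
  shows "aadd A (diff a b) (diff b c) = diff a c"
proof -
  have "aadd A (diff a b) (diff b c) = aadd A (aadd A (diff a b) b) (ascale A (- 1) c)"
    using assms by (simp add: diff_def[of b c] add_assoc)
  then show ?thesis using assms by (simp add: diff_add_cancel diff_def[of a c])
qed

lemma diff_add:
  "a \<in> acarrier A \<Longrightarrow> b \<in> acarrier A \<Longrightarrow> c \<in> acarrier A \<Longrightarrow> d \<in> acarrier A \<Longrightarrow>
    diff (aadd A a b) (aadd A c d) = aadd A (diff a c) (diff b d)"
  by (simp add: diff_def scale_add add_assoc add_left_commute)

lemma diff_scale:
  "a \<in> acarrier A \<Longrightarrow> b \<in> acarrier A \<Longrightarrow> diff (ascale A r a) (ascale A r b) = ascale A r (diff a b)"
  by (simp add: diff_def scale_add scale_scale)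

lemma diff_star:
  "a \<in> acarrier A \<Longrightarrow> b \<in> acarrier A \<Longrightarrow> diff (astar A a) (astar A b) = astar A (diff a b)"
  by (simp add: diff_def star_add star_scale)

text \<open>The usual splitting a b - c d = (a - c) b + c (b - d), with the mixed term c b
  inserted.\<close>

lemma diff_mult:
  assumes "a \<in> acarrier A" "b \<in> acarrier A" "c \<in> acarrier A" "d \<in> acarrier A"
  shows "diff (amult A a b) (amult A c d) = aadd A (amult A (diff a c) b) (amult A c (diff b d))"
proof -
  have "amult A (diff a c) b = diff (amult A a b) (amult A c b)"
    using assms by (simp add: diff_def mult_add_left mult_scale_left)
  moreover have "amult A c (diff b d) = diff (amult A c b) (amult A c d)"
    using assms by (simp add: diff_def mult_add_right mult_scale_right)
  ultimately show ?thesis using assms by (simp add: diff_trans)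
qed

end

text \<open>Weak enough to cover both the maximal C*-seminorm, along which algebras are completed,
  and the l1-norm, which in general fails the C*-identity.\<close>

locale seminormed_star_alg = star_alg A for A :: "('a, 'm) star_algebra_scheme" +
  fixes p :: "'a \<Rightarrow> real"
  assumes p_nonneg [simp]: "a \<in> acarrier A \<Longrightarrow> 0 \<le> p a"
    and p_scale: "a \<in> acarrier A \<Longrightarrow> p (ascale A c a) = cmod c * p a"
    and p_add: "a \<in> acarrier A \<Longrightarrow> b \<in> acarrier A \<Longrightarrow> p (aadd A a b) \<le> p a + p b"
    and p_mult: "a \<in> acarrier A \<Longrightarrow> b \<in> acarrier A \<Longrightarrow> p (amult A a b) \<le> p a * p b"
    and p_star: "a \<in> acarrier A \<Longrightarrow> p (astar A a) = p a"
begin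

abbreviation dst where "dst \<equiv> pdist A p"
abbreviation cls where "cls u \<equiv> cauchy_rel A p `` {u}"

lemma dst_eq: "dst a b = p (diff a b)"
  by (simp add: pdist_def diff_def)

lemma dst_nonneg [simp]: "a \<in> acarrier A \<Longrightarrow> b \<in> acarrier A \<Longrightarrow> 0 \<le> dst a b"
  by (simp add: dst_eq)

lemma dst_self [simp]: "a \<in> acarrier A \<Longrightarrow> dst a a = 0"
  by (simp add: dst_eq diff_self p_scale)

lemma dst_commute: "a \<in> acarrier A \<Longrightarrow> b \<in> acarrier A \<Longrightarrow> dst a b = dst b a"
  using p_scale[of "diff a b" "- 1"] by (simp add: dst_eq diff_swap)

lemma dst_triangle:
  "a \<in> acarrier A \<Longrightarrow> b \<in> acarrier A \<Longrightarrow> c \<in> acarrier A \<Longrightarrow> dst a c \<le> dst a b + dst b c"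
  using p_add[of "diff a b" "diff b c"] by (simp add: dst_eq diff_trans)

lemma abs_diff_le_dst:
  assumes "a \<in> acarrier A" "b \<in> acarrier A"
  shows "\<bar>p a - p b\<bar> \<le> dst a b"
proof -
  have "p a \<le> dst a b + p b" "p b \<le> dst b a + p a"
    using p_add[of "diff a b" b] p_add[of "diff b a" a] assms
    by (simp_all add: dst_eq diff_add_cancel)
  then show ?thesis using dst_commute assms by fastforce
qed

lemma dst_add:
  "a \<in> acarrier A \<Longrightarrow> b \<in> acarrier A \<Longrightarrow> c \<in> acarrier A \<Longrightarrow> d \<in> acarrier A \<Longrightarrow>
    dst (aadd A a b) (aadd A c d) \<le> dst a c + dst b d"
  by (simp add: dst_eq diff_add p_add)

lemma dst_scale:
  "a \<in> acarrier A \<Longrightarrow> b \<in> acarrier A \<Longrightarrow> dst (ascale A r a) (ascale A r b) = cmod r * dst a b"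
  by (simp add: dst_eq diff_scale p_scale)

lemma dst_star:
  "a \<in> acarrier A \<Longrightarrow> b \<in> acarrier A \<Longrightarrow> dst (astar A a) (astar A b) = dst a b"
  by (simp add: dst_eq diff_star p_star)

lemma dst_mult:
  assumes "a \<in> acarrier A" "b \<in> acarrier A" "c \<in> acarrier A" "d \<in> acarrier A"
  shows "dst (amult A a b) (amult A c d) \<le> dst a c * p b + p c * dst b d"
proof -
  have "dst (amult A a b) (amult A c d) \<le> p (amult A (diff a c) b) + p (amult A c (diff b d))"
    using assms by (simp add: dst_eq diff_mult p_add)
  also have "\<dots> \<le> dst a c * p b + p c * dst b d"
    using assms unfolding dst_eq by (intro add_mono p_mult) simp_all
  finally show ?thesis .
qed

lemma cauchy_seqsD:
  assumes "u \<in> cauchy_seqs A p"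
  shows "u n \<in> acarrier A"
    and "\<epsilon> > 0 \<Longrightarrow> \<exists>N. \<forall>m\<ge>N. \<forall>n\<ge>N. dst (u m) (u n) < \<epsilon>"
  using assms unfolding cauchy_seqs_def by auto

lemma cauchy_seqsI:
  assumes "\<And>n. u n \<in> acarrier A"
    and "\<And>\<epsilon>. \<epsilon> > 0 \<Longrightarrow> \<exists>N. \<forall>m\<ge>N. \<forall>n\<ge>N. dst (u m) (u n) < \<epsilon>"
  shows "u \<in> cauchy_seqs A p"
  using assms unfolding cauchy_seqs_def by auto

lemma cauchy_seqs_norm_Cauchy:
  assumes "u \<in> cauchy_seqs A p"
  shows "Cauchy (\<lambda>n. p (u n))"
proof (rule metric_CauchyI)
  fix \<epsilon> :: real assume "\<epsilon> > 0"
  then obtain N where "\<forall>m\<ge>N. \<forall>n\<ge>N. dst (u m) (u n) < \<epsilon>"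
    using cauchy_seqsD(2)[OF assms] by blast
  then show "\<exists>M. \<forall>m\<ge>M. \<forall>n\<ge>M. dist (p (u m)) (p (u n)) < \<epsilon>"
    using abs_diff_le_dst cauchy_seqsD(1)[OF assms] unfolding dist_real_def
    by (meson order_le_less_trans)
qed

lemma cauchy_seqs_bounded:
  assumes "u \<in> cauchy_seqs A p"
  obtains K where "K > 0" "\<And>n. p (u n) \<le> K"
proof -
  have "Bseq (\<lambda>n. p (u n))"
    using cauchy_seqs_norm_Cauchy[OF assms] by (rule Cauchy_Bseq)
  then obtain K where "K > 0" "\<And>n. norm (p (u n)) \<le> K"
    by (auto elim: BseqE)
  then show ?thesis using that[of K] by (metis abs_ge_self order_trans real_norm_def)
qed

lemma cauchy_rel_iff:
  "(u, v) \<in> cauchy_rel A p \<longleftrightarrow>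
    u \<in> cauchy_seqs A p \<and> v \<in> cauchy_seqs A p \<and> (\<lambda>n. dst (u n) (v n)) \<longlonglongrightarrow> 0"
  by (simp add: cauchy_rel_def)

lemma equiv_cauchy_rel: "equiv (cauchy_seqs A p) (cauchy_rel A p)"
proof (rule equivI)
  show "cauchy_rel A p \<subseteq> cauchy_seqs A p \<times> cauchy_seqs A p"
    by (auto simp: cauchy_rel_iff)
  show "refl_on (cauchy_seqs A p) (cauchy_rel A p)"
    by (auto simp: refl_on_def cauchy_rel_iff cauchy_seqsD(1))
  show "sym (cauchy_rel A p)"
  proof (rule symI)
    fix u v assume uv: "(u, v) \<in> cauchy_rel A p"
    then have "(\<lambda>n. dst (u n) (v n)) = (\<lambda>n. dst (v n) (u n))"
      by (intro ext dst_commute) (auto simp: cauchy_rel_iff cauchy_seqsD(1))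
    then show "(v, u) \<in> cauchy_rel A p"
      using uv by (simp add: cauchy_rel_iff)
  qed
  show "trans (cauchy_rel A p)"
  proof (rule transI)
    fix u v w assume *: "(u, v) \<in> cauchy_rel A p" "(v, w) \<in> cauchy_rel A p"
    then have "(\<lambda>n. dst (u n) (v n) + dst (v n) (w n)) \<longlonglongrightarrow> 0 + 0"
      by (intro tendsto_add) (auto simp: cauchy_rel_iff)
    then have lim: "(\<lambda>n. dst (u n) (v n) + dst (v n) (w n)) \<longlonglongrightarrow> 0" by simp
    have "(\<lambda>n. dst (u n) (w n)) \<longlonglongrightarrow> 0"
      using * by (intro null_sequence_le[OF _ dst_triangle lim]) (simp_all add: cauchy_rel_iff cauchy_seqsD(1))
    then show "(u, w) \<in> cauchy_rel A p"
      using * by (simp add: cauchy_rel_iff)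
  qed
qed

lemma cls_eq_iff:
  "u \<in> cauchy_seqs A p \<Longrightarrow> v \<in> cauchy_seqs A p \<Longrightarrow>
    cls u = cls v \<longleftrightarrow> (\<lambda>n. dst (u n) (v n)) \<longlonglongrightarrow> 0"
  using eq_equiv_class_iff[OF equiv_cauchy_rel] by (simp add: cauchy_rel_iff)

section \<open>Algebra operations on classes of Cauchy sequences\<close>

lemma cauchy_add:
  assumes u: "u \<in> cauchy_seqs A p" and v: "v \<in> cauchy_seqs A p"
  shows "(\<lambda>n. aadd A (u n) (v n)) \<in> cauchy_seqs A p"
proof (rule cauchy_seqsI)
  fix \<epsilon> :: real assume "\<epsilon> > 0"
  then obtain M N where M: "\<forall>m\<ge>M. \<forall>n\<ge>M. dst (u m) (u n) < \<epsilon> / 2"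
    and N: "\<forall>m\<ge>N. \<forall>n\<ge>N. dst (v m) (v n) < \<epsilon> / 2"
    using cauchy_seqsD(2)[OF u, of "\<epsilon> / 2"] cauchy_seqsD(2)[OF v, of "\<epsilon> / 2"] by auto
  have "dst (aadd A (u m) (v m)) (aadd A (u n) (v n)) < \<epsilon>" if "m \<ge> max M N" "n \<ge> max M N" for m n
  proof -
    have "dst (u m) (u n) < \<epsilon> / 2" "dst (v m) (v n) < \<epsilon> / 2"
      using that M N by auto
    then show ?thesis
      using dst_add[of "u m" "v m" "u n" "v n"] u v by (simp add: cauchy_seqsD(1))
  qed
  then show "\<exists>N. \<forall>m\<ge>N. \<forall>n\<ge>N. dst (aadd A (u m) (v m)) (aadd A (u n) (v n)) < \<epsilon>"
    by blast
qed (use assms in \<open>simp add: cauchy_seqsD(1)\<close>)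

lemma cauchy_scale:
  assumes u: "u \<in> cauchy_seqs A p"
  shows "(\<lambda>n. ascale A c (u n)) \<in> cauchy_seqs A p"
proof (rule cauchy_seqsI)
  fix \<epsilon> :: real assume "\<epsilon> > 0"
  \<comment> \<open>The summand 1 keeps the denominator positive when c is zero.\<close>
  then obtain M where M: "\<forall>m\<ge>M. \<forall>n\<ge>M. dst (u m) (u n) < \<epsilon> / (cmod c + 1)"
    using cauchy_seqsD(2)[OF u, of "\<epsilon> / (cmod c + 1)"] by (auto simp: add_nonneg_pos)
  have "dst (ascale A c (u m)) (ascale A c (u n)) < \<epsilon>" if "m \<ge> M" "n \<ge> M" for m n
  proof -
    have "dst (ascale A c (u m)) (ascale A c (u n)) \<le> (cmod c + 1) * dst (u m) (u n)"
      using u by (simp add: dst_scale cauchy_seqsD(1) mult_right_mono)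
    also have "\<dots> < (cmod c + 1) * (\<epsilon> / (cmod c + 1))"
      using M that by (intro mult_strict_left_mono) (auto simp: add_nonneg_pos)
    also have "\<dots> = \<epsilon>"
      using norm_ge_zero[of c] by (simp add: add_nonneg_eq_0_iff)
    finally show ?thesis .
  qed
  then show "\<exists>N. \<forall>m\<ge>N. \<forall>n\<ge>N. dst (ascale A c (u m)) (ascale A c (u n)) < \<epsilon>"
    by blast
qed (use assms in \<open>simp add: cauchy_seqsD(1)\<close>)

lemma cauchy_star:
  "u \<in> cauchy_seqs A p \<Longrightarrow> (\<lambda>n. astar A (u n)) \<in> cauchy_seqs A p"
  using cauchy_seqsD[of u] by (intro cauchy_seqsI) (simp_all add: dst_star)

lemma cauchy_mult:
  assumes u: "u \<in> cauchy_seqs A p" and v: "v \<in> cauchy_seqs A p"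
  shows "(\<lambda>n. amult A (u n) (v n)) \<in> cauchy_seqs A p"
proof (rule cauchy_seqsI)
  fix \<epsilon> :: real assume "\<epsilon> > 0"
  \<comment> \<open>Cauchy sequences are bounded in seminorm, and the bounds are taken positive so
    that they can be divided by. Half of \<epsilon> goes to each summand of
    \<open>dst_mult\<close>.\<close>
  obtain K L where K: "K > 0" "\<And>n. p (u n) \<le> K" and L: "L > 0" "\<And>n. p (v n) \<le> L"
    using cauchy_seqs_bounded[OF u] cauchy_seqs_bounded[OF v] by metis
  obtain M N where M: "\<forall>m\<ge>M. \<forall>n\<ge>M. dst (u m) (u n) < \<epsilon> / (2 * L)"
    and N: "\<forall>m\<ge>N. \<forall>n\<ge>N. dst (v m) (v n) < \<epsilon> / (2 * K)"
    using cauchy_seqsD(2)[OF u, of "\<epsilon> / (2 * L)"] cauchy_seqsD(2)[OF v, of "\<epsilon> / (2 * K)"]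
      \<open>\<epsilon> > 0\<close> K(1) L(1) by auto
  have "dst (amult A (u m) (v m)) (amult A (u n) (v n)) < \<epsilon>"
    if "m \<ge> max M N" "n \<ge> max M N" for m n
  proof -
    have "dst (u m) (u n) < \<epsilon> / (2 * L)" "dst (v m) (v n) < \<epsilon> / (2 * K)"
      using that M N by auto
    then have "dst (u m) (u n) * L < \<epsilon> / 2" "K * dst (v m) (v n) < \<epsilon> / 2"
      using K(1) L(1) by (simp_all add: field_simps)
    moreover have "dst (u m) (u n) * p (v m) \<le> dst (u m) (u n) * L"
      using L(2) u by (intro mult_left_mono) (simp_all add: cauchy_seqsD(1))
    moreover have "p (u n) * dst (v m) (v n) \<le> K * dst (v m) (v n)"
      using K(2) v by (intro mult_right_mono) (simp_all add: cauchy_seqsD(1))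
    ultimately show ?thesis
      using dst_mult[of "u m" "v m" "u n" "v n"] u v by (simp add: cauchy_seqsD(1))
  qed
  then show "\<exists>N. \<forall>m\<ge>N. \<forall>n\<ge>N. dst (amult A (u m) (v m)) (amult A (u n) (v n)) < \<epsilon>"
    by blast
qed (use assms in \<open>simp add: cauchy_seqsD(1)\<close>)

text \<open>The operations of \<open>completion\<close> are unions over all representatives.
  Equivalent sequences have equivalent sums, so the union consists of a single class; the other
  operations are treated in the same way.\<close>

lemma add_cls:
  assumes "u \<in> cauchy_seqs A p" "v \<in> cauchy_seqs A p"
  shows "aadd (completion A p) (cls u) (cls v) = cls (\<lambda>n. aadd A (u n) (v n))"
proof -
  have "cls (\<lambda>n. aadd A (u n) (v n)) = cls (\<lambda>n. aadd A (u' n) (v' n))"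
    if uv: "(u, u') \<in> cauchy_rel A p" "(v, v') \<in> cauchy_rel A p" for u v u' v'
  proof -
    have "(\<lambda>n. dst (u n) (u' n) + dst (v n) (v' n)) \<longlonglongrightarrow> 0 + 0"
      using uv by (intro tendsto_add) (auto simp: cauchy_rel_iff)
    then have lim: "(\<lambda>n. dst (u n) (u' n) + dst (v n) (v' n)) \<longlonglongrightarrow> 0" by simp
    have "(\<lambda>n. dst (aadd A (u n) (v n)) (aadd A (u' n) (v' n))) \<longlonglongrightarrow> 0"
      using uv by (intro null_sequence_le[OF _ dst_add lim]) (simp_all add: cauchy_rel_iff cauchy_seqsD(1))
    then show ?thesis
      using uv by (subst cls_eq_iff) (auto simp: cauchy_rel_iff cauchy_add)
  qed
  then have "(\<lambda>u v. cls (\<lambda>n. aadd A (u n) (v n))) respects2 cauchy_rel A p"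
    by (intro congruent2I') simp
  from UN_equiv_class2[OF equiv_cauchy_rel equiv_cauchy_rel this assms]
  show ?thesis by (simp add: completion_def)
qed

lemma mult_cls:
  assumes "u \<in> cauchy_seqs A p" "v \<in> cauchy_seqs A p"
  shows "amult (completion A p) (cls u) (cls v) = cls (\<lambda>n. amult A (u n) (v n))"
proof -
  have "cls (\<lambda>n. amult A (u n) (v n)) = cls (\<lambda>n. amult A (u' n) (v' n))"
    if uv: "(u, u') \<in> cauchy_rel A p" "(v, v') \<in> cauchy_rel A p" for u v u' v'
  proof -
    \<comment> \<open>The estimate \<open>dst_mult\<close> involves the seminorm of the old second
      factor and of the new first factor, so these two sequences are the ones to be bounded.\<close>
    obtain K L where K: "K > 0" "\<And>n. p (u' n) \<le> K" and L: "L > 0" "\<And>n. p (v n) \<le> L"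
      using cauchy_seqs_bounded[of u'] cauchy_seqs_bounded[of v] uv unfolding cauchy_rel_iff by metis
    have "(\<lambda>n. dst (u n) (u' n) * L + K * dst (v n) (v' n)) \<longlonglongrightarrow> 0 * L + K * 0"
      using uv by (intro tendsto_intros) (auto simp: cauchy_rel_iff)
    then have lim: "(\<lambda>n. dst (u n) (u' n) * L + K * dst (v n) (v' n)) \<longlonglongrightarrow> 0" by simp
    have "dst (amult A (u n) (v n)) (amult A (u' n) (v' n)) \<le>
        dst (u n) (u' n) * L + K * dst (v n) (v' n)" for n
    proof -
      have "dst (u n) (u' n) * p (v n) \<le> dst (u n) (u' n) * L"
        using L(2) uv by (intro mult_left_mono) (simp_all add: cauchy_seqsD(1) cauchy_rel_iff)
      moreover have "p (u' n) * dst (v n) (v' n) \<le> K * dst (v n) (v' n)"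
        using K(2) uv by (intro mult_right_mono) (simp_all add: cauchy_seqsD(1) cauchy_rel_iff)
      ultimately show ?thesis
        using dst_mult[of "u n" "v n" "u' n" "v' n"] uv
        by (simp add: cauchy_seqsD(1) cauchy_rel_iff)
    qed
    then have "(\<lambda>n. dst (amult A (u n) (v n)) (amult A (u' n) (v' n))) \<longlonglongrightarrow> 0"
      using uv by (intro null_sequence_le[OF _ _ lim]) (simp_all add: cauchy_rel_iff cauchy_seqsD(1))
    then show ?thesis
      using uv by (subst cls_eq_iff) (auto simp: cauchy_rel_iff cauchy_mult)
  qed
  then have "(\<lambda>u v. cls (\<lambda>n. amult A (u n) (v n))) respects2 cauchy_rel A p"
    by (intro congruent2I') simp
  from UN_equiv_class2[OF equiv_cauchy_rel equiv_cauchy_rel this assms]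
  show ?thesis by (simp add: completion_def)
qed

lemma scale_cls:
  assumes "u \<in> cauchy_seqs A p"
  shows "ascale (completion A p) c (cls u) = cls (\<lambda>n. ascale A c (u n))"
proof -
  have "cls (\<lambda>n. ascale A c (u n)) = cls (\<lambda>n. ascale A c (u' n))"
    if uv: "(u, u') \<in> cauchy_rel A p" for u u'
  proof -
    have "(\<lambda>n. cmod c * dst (u n) (u' n)) \<longlonglongrightarrow> cmod c * 0"
      using uv by (intro tendsto_mult tendsto_const) (auto simp: cauchy_rel_iff)
    then show ?thesis
      using uv by (subst cls_eq_iff)
        (auto simp: cauchy_rel_iff cauchy_scale dst_scale cauchy_seqsD(1))
  qed
  then have "(\<lambda>u. cls (\<lambda>n. ascale A c (u n))) respects cauchy_rel A p"
    by (intro congruentI) simp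
  from UN_equiv_class[OF equiv_cauchy_rel this assms]
  show ?thesis by (simp add: completion_def)
qed

lemma star_cls:
  assumes "u \<in> cauchy_seqs A p"
  shows "astar (completion A p) (cls u) = cls (\<lambda>n. astar A (u n))"
proof -
  have "cls (\<lambda>n. astar A (u n)) = cls (\<lambda>n. astar A (u' n))"
    if uv: "(u, u') \<in> cauchy_rel A p" for u u'
    using uv by (subst cls_eq_iff)
      (auto simp: cauchy_rel_iff cauchy_star dst_star cauchy_seqsD(1))
  then have "(\<lambda>u. cls (\<lambda>n. astar A (u n))) respects cauchy_rel A p"
    by (intro congruentI) simp
  from UN_equiv_class[OF equiv_cauchy_rel this assms]
  show ?thesis by (simp add: completion_def)
qed

text \<open>The seminorms along two equivalent sequences differ by a null sequence, so the limit
  depends on the class alone and the description in \<open>completion\<close> picks it out.\<close>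

lemma norm_cls:
  assumes u: "u \<in> cauchy_seqs A p" and lim: "(\<lambda>n. p (u n)) \<longlonglongrightarrow> r"
  shows "anorm (completion A p) (cls u) = r"
proof -
  have "(\<lambda>n. p (v n)) \<longlonglongrightarrow> r" if "v \<in> cls u" for v
  proof -
    have v: "v \<in> cauchy_seqs A p" "(\<lambda>n. dst (u n) (v n)) \<longlonglongrightarrow> 0"
      using that by (auto simp: cauchy_rel_iff)
    have "(\<lambda>n. p (u n) - p (v n)) \<longlonglongrightarrow> 0"
      using u v abs_diff_le_dst
      by (intro Lim_null_comparison[OF _ v(2)] always_eventually) (auto simp: cauchy_seqsD(1))
    from tendsto_diff[OF lim this] show ?thesis by simp
  qed
  moreover have "u \<in> cls u" using equiv_class_self[OF equiv_cauchy_rel u] .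
  ultimately have "(THE r. \<exists>v\<in>cls u. (\<lambda>n. p (v n)) \<longlonglongrightarrow> r) = r"
    by (intro the_equality) (auto intro: LIMSEQ_unique)
  then show ?thesis by (simp add: completion_def)
qed

lemma completion_carrierE:
  assumes "U \<in> acarrier (completion A p)"
  obtains u where "u \<in> cauchy_seqs A p" "U = cls u"
  using assms by (auto simp: completion_def elim: quotientE)

lemma cls_carrier: "u \<in> cauchy_seqs A p \<Longrightarrow> cls u \<in> acarrier (completion A p)"
  by (auto simp: completion_def intro: quotientI)

end

locale star_alg_hom =
  fixes A :: "('a, 'm) star_algebra_scheme" and B :: "('b, 'n) star_algebra_scheme"
    and j :: "'a \<Rightarrow> 'b"
  assumes hom_closed: "a \<in> acarrier A \<Longrightarrow> j a \<in> acarrier B"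
    and hom_add: "a \<in> acarrier A \<Longrightarrow> b \<in> acarrier A \<Longrightarrow> j (aadd A a b) = aadd B (j a) (j b)"
    and hom_scale: "a \<in> acarrier A \<Longrightarrow> j (ascale A c a) = ascale B c (j a)"
    and hom_mult: "a \<in> acarrier A \<Longrightarrow> b \<in> acarrier A \<Longrightarrow> j (amult A a b) = amult B (j a) (j b)"
    and hom_star: "a \<in> acarrier A \<Longrightarrow> j (astar A a) = astar B (j a)"

text \<open>Applying j term by term preserves distances, which makes the map on classes well defined
  and injective at once. Density is needed for surjectivity alone.\<close>

lemma cstar_iso_completion:
  assumes "seminormed_star_alg A p" "seminormed_star_alg B q" "star_alg_hom A B j"
    and iso: "\<And>a. a \<in> acarrier A \<Longrightarrow> q (j a) = p a"
    and dense: "\<And>b \<epsilon>. b \<in> acarrier B \<Longrightarrow> \<epsilon> > 0 \<Longrightarrow> \<exists>a\<in>acarrier A. pdist B q b (j a) < \<epsilon>"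
  shows "cstar_iso (completion A p) (completion B q)"
proof -
  interpret A: seminormed_star_alg A p by fact
  interpret B: seminormed_star_alg B q by fact
  interpret star_alg_hom A B j by fact
  have dst: "B.dst (j a) (j b) = A.dst a b" if "a \<in> acarrier A" "b \<in> acarrier A" for a b
    using that by (simp add: pdist_def iso flip: hom_add hom_scale)
  have j: "(\<lambda>n. j (u n)) \<in> cauchy_seqs B q" if "u \<in> cauchy_seqs A p" for u
    using A.cauchy_seqsD[OF that] by (intro B.cauchy_seqsI) (simp_all add: hom_closed dst)
  define \<Phi> where "\<Phi> U = (\<Union>u\<in>U. B.cls (\<lambda>n. j (u n)))" for U
  have cls_eq: "B.cls (\<lambda>n. j (u n)) = B.cls (\<lambda>n. j (v n)) \<longleftrightarrow> A.cls u = A.cls v"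
    if "u \<in> cauchy_seqs A p" "v \<in> cauchy_seqs A p" for u v
    using that by (simp add: A.cls_eq_iff B.cls_eq_iff j dst A.cauchy_seqsD(1))
  have \<Phi>: "\<Phi> (A.cls u) = B.cls (\<lambda>n. j (u n))" if "u \<in> cauchy_seqs A p" for u
    unfolding \<Phi>_def
  proof (rule UN_equiv_class[OF A.equiv_cauchy_rel _ that], rule congruentI)
    fix v w assume vw: "(v, w) \<in> cauchy_rel A p"
    then have "A.cls v = A.cls w" by (rule equiv_class_eq[OF A.equiv_cauchy_rel])
    then show "B.cls (\<lambda>n. j (v n)) = B.cls (\<lambda>n. j (w n))"
      using vw by (subst cls_eq) (auto simp: A.cauchy_rel_iff)
  qed
  have inj: "inj_on \<Phi> (acarrier (completion A p))"
  proof (rule inj_onI)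
    fix U V assume "U \<in> acarrier (completion A p)" "V \<in> acarrier (completion A p)" "\<Phi> U = \<Phi> V"
    then show "U = V"
      by (elim A.completion_carrierE) (simp add: \<Phi> cls_eq)
  qed
  have surj: "\<Phi> ` acarrier (completion A p) = acarrier (completion B q)"
  proof (intro equalityI subsetI)
    fix V assume "V \<in> \<Phi> ` acarrier (completion A p)"
    then show "V \<in> acarrier (completion B q)"
      by (auto elim!: A.completion_carrierE simp: \<Phi> j intro!: B.cls_carrier)
  next
    fix V assume "V \<in> acarrier (completion B q)"
    then obtain v where v: "v \<in> cauchy_seqs B q" "V = B.cls v"
      by (rule B.completion_carrierE)
    \<comment> \<open>The n-th term is approximated with error below 1/(n+1). The approximants then
      form a sequence equivalent to v, and they are Cauchy in \<open>A\<close> because j preserves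
      distances.\<close>
    have "\<exists>a\<in>acarrier A. B.dst (v n) (j a) < 1 / real (Suc n)" for n
      by (rule dense) (simp_all add: B.cauchy_seqsD(1)[OF v(1)])
    then obtain u where u: "\<And>n. u n \<in> acarrier A" "\<And>n. B.dst (v n) (j (u n)) < 1 / real (Suc n)"
      by metis
    have ju: "j (u n) \<in> acarrier B" and vB: "v n \<in> acarrier B" for n
      using u hom_closed B.cauchy_seqsD(1)[OF v(1)] by auto
    have lim: "(\<lambda>n. B.dst (v n) (j (u n))) \<longlonglongrightarrow> 0"
      using u(2) ju vB
      by (intro null_sequence_le[OF _ _ LIMSEQ_Suc[OF lim_1_over_n]]) (simp_all add: less_imp_le)
    have "u \<in> cauchy_seqs A p"
    proof (rule A.cauchy_seqsI)
      fix \<epsilon> :: real assume "\<epsilon> > 0"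
      then obtain M where M: "\<forall>m\<ge>M. \<forall>n\<ge>M. B.dst (v m) (v n) < \<epsilon> / 3"
        using B.cauchy_seqsD(2)[OF v(1), of "\<epsilon> / 3"] by auto
      have "eventually (\<lambda>n. B.dst (v n) (j (u n)) < \<epsilon> / 3) sequentially"
        using lim \<open>\<epsilon> > 0\<close> by (intro order_tendstoD(2)[OF lim]) simp
      then obtain N where N: "\<And>n. n \<ge> N \<Longrightarrow> B.dst (v n) (j (u n)) < \<epsilon> / 3"
        by (auto simp: eventually_sequentially)
      have "A.dst (u m) (u n) < \<epsilon>" if mn: "m \<ge> max M N" "n \<ge> max M N" for m n
      proof -
        have "B.dst (j (u m)) (j (u n)) \<le>
            B.dst (v m) (j (u m)) + (B.dst (v m) (v n) + B.dst (v n) (j (u n)))"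
          using B.dst_triangle[OF ju[of m] vB[of m] ju[of n]]
            B.dst_triangle[OF vB[of m] vB[of n] ju[of n]] B.dst_commute[OF ju[of m] vB[of m]] by simp
        also have "\<dots> < \<epsilon> / 3 + (\<epsilon> / 3 + \<epsilon> / 3)"
          using M N mn by (intro add_strict_mono) auto
        finally show ?thesis using u by (simp add: dst)
      qed
      then show "\<exists>N. \<forall>m\<ge>N. \<forall>n\<ge>N. A.dst (u m) (u n) < \<epsilon>" by blast
    qed (rule u)
    moreover from this have "V = \<Phi> (A.cls u)"
      using lim v by (simp add: \<Phi> j B.cls_eq_iff)
    ultimately show "V \<in> \<Phi> ` acarrier (completion A p)"
      by (auto intro: A.cls_carrier)
  qed
  have ops: "\<Phi> (aadd (completion A p) U V) = aadd (completion B q) (\<Phi> U) (\<Phi> V) \<and>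
      \<Phi> (amult (completion A p) U V) = amult (completion B q) (\<Phi> U) (\<Phi> V)"
    if UV: "U \<in> acarrier (completion A p)" "V \<in> acarrier (completion A p)" for U V
  proof -
    from UV obtain u v where "u \<in> cauchy_seqs A p" "U = A.cls u" "v \<in> cauchy_seqs A p" "V = A.cls v"
      by (elim A.completion_carrierE)
    then show ?thesis
      by (simp add: A.add_cls A.mult_cls B.add_cls B.mult_cls \<Phi> j A.cauchy_add A.cauchy_mult
          hom_add hom_mult A.cauchy_seqsD(1))
  qed
  have ops': "\<Phi> (ascale (completion A p) c U) = ascale (completion B q) c (\<Phi> U) \<and>
      \<Phi> (astar (completion A p) U) = astar (completion B q) (\<Phi> U) \<and>
      anorm (completion B q) (\<Phi> U) = anorm (completion A p) U"
    if U: "U \<in> acarrier (completion A p)" for U c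
  proof -
    from U obtain u where u: "u \<in> cauchy_seqs A p" "U = A.cls u"
      by (elim A.completion_carrierE)
    obtain r where r: "(\<lambda>n. p (u n)) \<longlonglongrightarrow> r"
      using A.cauchy_seqs_norm_Cauchy[OF u(1)] by (auto simp: Cauchy_convergent_iff convergent_def)
    then have "(\<lambda>n. q (j (u n))) \<longlonglongrightarrow> r"
      using u by (simp add: iso A.cauchy_seqsD(1))
    with r u show ?thesis
      by (simp add: A.scale_cls A.star_cls B.scale_cls B.star_cls \<Phi> j A.cauchy_scale A.cauchy_star
          hom_scale hom_star A.cauchy_seqsD(1) A.norm_cls B.norm_cls)
  qed
  show ?thesis
    unfolding cstar_iso_def bij_betw_def
    by (intro exI[of _ \<Phi>] conjI ballI allI) (simp_all add: inj surj ops ops')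
qed

section \<open>Dense embeddings and enveloping algebras\<close>

lemma cstar_seminormD:
  assumes "cstar_seminorm A p" "a \<in> acarrier A"
  shows "0 \<le> p a" "p (astar A a) = p a" "p (amult A (astar A a) a) = (p a)\<^sup>2"
    and "p (ascale A c a) = cmod c * p a"
    and "b \<in> acarrier A \<Longrightarrow> p (aadd A a b) \<le> p a + p b"
    and "b \<in> acarrier A \<Longrightarrow> p (amult A a b) \<le> p a * p b"
  using assms unfolding cstar_seminorm_def by auto

lemma seminormed_cstar_seminorm:
  "star_alg A \<Longrightarrow> cstar_seminorm A p \<Longrightarrow> seminormed_star_alg A p"
  by (intro seminormed_star_alg.intro seminormed_star_alg_axioms.intro)
    (auto simp: cstar_seminormD)

text \<open>It makes the family over which the maximal seminorm is taken non-empty, as a supremum of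
  reals requires, and yields that the supremum is non-negative.\<close>

lemma cstar_seminorm_zero: "cstar_seminorm A (\<lambda>_. 0)"
  by (simp add: cstar_seminorm_def)

text \<open>A supremum of reals is meaningful only when bounded; the bound \<open>N\<close> provides
  this at every element, after which the inequalities pass to the supremum.\<close>

lemma seminormed_max_cstar_seminorm:
  assumes "star_alg A"
    and bound: "\<And>p a. cstar_seminorm A p \<Longrightarrow> a \<in> acarrier A \<Longrightarrow> p a \<le> N a"
  shows "seminormed_star_alg A (max_cstar_seminorm A)"
proof -
  interpret star_alg A by fact
  let ?M = "max_cstar_seminorm A"
  have bdd: "bdd_above ((\<lambda>p. p a) ` Collect (cstar_seminorm A))" if "a \<in> acarrier A" for a
    using bound that by (auto intro!: bdd_aboveI2[where M = "N a"])
  have ne: "Collect (cstar_seminorm A) \<noteq> {}"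
    using cstar_seminorm_zero by blast
  have upper: "p a \<le> ?M a" if "cstar_seminorm A p" "a \<in> acarrier A" for p a
    unfolding max_cstar_seminorm_def using bdd that by (intro cSUP_upper) auto
  have least: "?M a \<le> x" if "\<And>p. cstar_seminorm A p \<Longrightarrow> p a \<le> x" for x a
    unfolding max_cstar_seminorm_def using ne that by (intro cSUP_least) auto
  have nonneg: "0 \<le> ?M a" if "a \<in> acarrier A" for a
    using upper[OF cstar_seminorm_zero that] .
  show ?thesis
  proof (intro seminormed_star_alg.intro seminormed_star_alg_axioms.intro)
    fix a b c assume a: "a \<in> acarrier A"
    show "0 \<le> ?M a" using a by (rule nonneg)
    \<comment> \<open>Only one inequality passes directly to the supremum. The reverse one is this
      inequality for the scalar 1/c applied to c a, which leaves c = 0 as a separate case.\<close>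
    have le: "?M (ascale A c a) \<le> cmod c * ?M a" if "a \<in> acarrier A" for c a
      using that by (intro least) (simp add: cstar_seminormD(4) mult_left_mono upper)
    show "?M (ascale A c a) = cmod c * ?M a"
    proof (cases "c = 0")
      case True
      then show ?thesis using le[OF a, of 0] nonneg[of "ascale A 0 a"] a by simp
    next
      case False
      have "?M a \<le> cmod (inverse c) * ?M (ascale A c a)"
        using le[of "ascale A c a" "inverse c"] a False by (simp add: scale_scale scale_one)
      then have "cmod c * ?M a \<le> ?M (ascale A c a)"
        using False unfolding norm_inverse by (simp add: field_simps)
      then show ?thesis using le[OF a] by (intro antisym)
    qed
    show "?M (astar A a) = ?M a"
      unfolding max_cstar_seminorm_def using a by (intro SUP_cong) (auto simp: cstar_seminormD)
    assume b: "b \<in> acarrier A"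
    show "?M (aadd A a b) \<le> ?M a + ?M b"
    proof (rule least)
      fix p assume p: "cstar_seminorm A p"
      show "p (aadd A a b) \<le> ?M a + ?M b"
        using cstar_seminormD(5)[OF p a b] upper[OF p a] upper[OF p b] by simp
    qed
    show "?M (amult A a b) \<le> ?M a * ?M b"
    proof (rule least)
      fix p assume p: "cstar_seminorm A p"
      have "p (amult A a b) \<le> p a * p b" by (rule cstar_seminormD(6)[OF p a b])
      also have "\<dots> \<le> ?M a * ?M b"
        using upper[OF p a] upper[OF p b] cstar_seminormD(1)[OF p] a b nonneg
        by (intro mult_mono) auto
      finally show "p (amult A a b) \<le> ?M a * ?M b" .
    qed
  qed fact
qed

text \<open>Equations can be tested after an injective homomorphism. This spares the verification of
  the laws for convolution, whose product is a sum over factorizations of an arrow.\<close>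

lemma star_alg_transfer:
  assumes "star_alg B" "star_alg_hom A B j" and inj: "inj_on j (acarrier A)"
    and cl: "\<And>a b. a \<in> acarrier A \<Longrightarrow> b \<in> acarrier A \<Longrightarrow> aadd A a b \<in> acarrier A"
      "\<And>a c. a \<in> acarrier A \<Longrightarrow> ascale A c a \<in> acarrier A"
      "\<And>a b. a \<in> acarrier A \<Longrightarrow> b \<in> acarrier A \<Longrightarrow> amult A a b \<in> acarrier A"
      "\<And>a. a \<in> acarrier A \<Longrightarrow> astar A a \<in> acarrier A"
  shows "star_alg A"
proof -
  interpret B: star_alg B by fact
  interpret star_alg_hom A B j by fact
  note hom = hom_closed hom_add hom_scale hom_mult hom_star cl
  show ?thesis
    by unfold_locales
      (use hom in \<open>simp_all add: inj_on_eq_iff[OF inj, symmetric] B.add_assoc B.scale_scale B.scale_one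
        B.scale_add B.add_scale B.add_scale_zero B.mult_add_left B.mult_add_right B.mult_scale_left
        B.mult_scale_right B.star_add B.star_scale\<close>, metis hom B.add_commute)
qed

text \<open>The extension of a C*-seminorm from the dense subalgebra is its limit along approximating
  sequences; the norm \<open>N\<close> makes all operations continuous.\<close>

lemma cstar_seminorm_extend:
  assumes "star_alg A" "seminormed_star_alg B N" "star_alg_hom A B j"
    and dense: "\<And>b \<epsilon>. b \<in> acarrier B \<Longrightarrow> \<epsilon> > 0 \<Longrightarrow> \<exists>a\<in>acarrier A. pdist B N b (j a) < \<epsilon>"
    and p: "cstar_seminorm A p" and bound: "\<And>a. a \<in> acarrier A \<Longrightarrow> p a \<le> N (j a)"
  obtains q where "cstar_seminorm B q" "\<And>a. a \<in> acarrier A \<Longrightarrow> q (j a) = p a"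
proof -
  interpret A: seminormed_star_alg A p
    by (intro seminormed_cstar_seminorm) fact+
  interpret B: seminormed_star_alg B N by fact
  interpret star_alg_hom A B j by fact
  have dst: "A.dst a b \<le> B.dst (j a) (j b)" if "a \<in> acarrier A" "b \<in> acarrier A" for a b
    using bound[of "A.diff a b"] that by (simp add: pdist_def A.diff_def hom_add hom_scale)
  \<comment> \<open>Approximation is measured in \<open>N\<close>, not in the seminorm to be
    extended: the latter does not exist on \<open>B\<close> yet, while \<open>N\<close> dominates it
    on the image of \<open>A\<close>.\<close>
  define approx where "approx u b \<longleftrightarrow>
    (\<forall>n. u n \<in> acarrier A) \<and> (\<lambda>n. B.dst b (j (u n))) \<longlonglongrightarrow> 0" for u b
  have approxD: "u n \<in> acarrier A" "(\<lambda>n. B.dst b (j (u n))) \<longlonglongrightarrow> 0" if "approx u b" for u b n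
    using that by (auto simp: approx_def)
  have approxI: "approx u b" if "\<And>n. u n \<in> acarrier A" "b \<in> acarrier B"
    "\<And>n. B.dst b (j (u n)) \<le> f n" "f \<longlonglongrightarrow> 0" for u b f
    unfolding approx_def using that hom_closed
    by (intro conjI allI null_sequence_le[OF _ _ that(4)]) simp_all
  have ex: "\<exists>u. approx u b" if "b \<in> acarrier B" for b
  proof -
    have "\<exists>a\<in>acarrier A. B.dst b (j a) < 1 / real (Suc n)" for n
      using that by (intro dense) simp_all
    then obtain u where u: "\<And>n. u n \<in> acarrier A" "\<And>n. B.dst b (j (u n)) < 1 / real (Suc n)"
      by metis
    then have "approx u b"
      using that by (intro approxI[OF _ _ _ LIMSEQ_Suc[OF lim_1_over_n]]) (auto simp: less_imp_le)
    then show ?thesis by blast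
  qed
  \<comment> \<open>Two sequences approaching the same element have seminorms with the same limit.
    This makes the chosen sequence in the definition of q immaterial.\<close>
  have close: "(\<lambda>n. p (u n) - p (v n)) \<longlonglongrightarrow> 0"
    if b: "b \<in> acarrier B" and u: "approx u b" and v: "approx v b" for u v b
  proof (rule Lim_null_comparison[OF always_eventually])
    show "(\<lambda>n. B.dst b (j (u n)) + B.dst b (j (v n))) \<longlonglongrightarrow> 0"
      using tendsto_add[OF approxD(2)[OF u] approxD(2)[OF v]] by simp
    show "\<forall>n. norm (p (u n) - p (v n)) \<le> B.dst b (j (u n)) + B.dst b (j (v n))"
    proof
      fix n
      have un: "u n \<in> acarrier A" "v n \<in> acarrier A" using u v approxD by blast+
      then have "\<bar>p (u n) - p (v n)\<bar> \<le> B.dst (j (u n)) (j (v n))"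
        using A.abs_diff_le_dst dst order_trans by blast
      also have "\<dots> \<le> B.dst (j (u n)) b + B.dst b (j (v n))"
        using un b by (intro B.dst_triangle) (simp_all add: hom_closed)
      finally show "norm (p (u n) - p (v n)) \<le> B.dst b (j (u n)) + B.dst b (j (v n))"
        using un b B.dst_commute[of "j (u n)" b] by (simp add: hom_closed)
    qed
  qed
  have conv: "convergent (\<lambda>n. p (u n))" if b: "b \<in> acarrier B" and u: "approx u b" for u b
  proof -
    have "Cauchy (\<lambda>n. p (u n))"
    proof (rule metric_CauchyI)
      fix \<epsilon> :: real assume "\<epsilon> > 0"
      then have "eventually (\<lambda>n. B.dst b (j (u n)) < \<epsilon> / 2) sequentially"
        by (intro order_tendstoD(2)[OF approxD(2)[OF u]]) simp
      then obtain M where M: "\<And>n. n \<ge> M \<Longrightarrow> B.dst b (j (u n)) < \<epsilon> / 2"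
        by (auto simp: eventually_sequentially)
      have "dist (p (u m)) (p (u n)) < \<epsilon>" if mn: "m \<ge> M" "n \<ge> M" for m n
      proof -
        have un: "u m \<in> acarrier A" "u n \<in> acarrier A" using u approxD by blast+
        then have "\<bar>p (u m) - p (u n)\<bar> \<le> B.dst (j (u m)) (j (u n))"
          using A.abs_diff_le_dst dst order_trans by blast
        also have "\<dots> \<le> B.dst (j (u m)) b + B.dst b (j (u n))"
          using un b by (intro B.dst_triangle) (simp_all add: hom_closed)
        also have "B.dst (j (u m)) b = B.dst b (j (u m))"
          using un b by (intro B.dst_commute) (simp_all add: hom_closed)
        finally show ?thesis
          using M[OF mn(1)] M[OF mn(2)] by (simp add: dist_real_def)
      qed
      then show "\<exists>M. \<forall>m\<ge>M. \<forall>n\<ge>M. dist (p (u m)) (p (u n)) < \<epsilon>" by blast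
    qed
    then show ?thesis by (simp add: Cauchy_convergent_iff)
  qed
  define q where "q b = lim (\<lambda>n. p ((SOME u. approx u b) n))" for b
  have lim: "(\<lambda>n. p (u n)) \<longlonglongrightarrow> q b" if b: "b \<in> acarrier B" and u: "approx u b" for u b
  proof -
    let ?v = "SOME u. approx u b"
    have v: "approx ?v b" using ex[OF b] by (rule someI_ex)
    then have "(\<lambda>n. p (?v n)) \<longlonglongrightarrow> q b"
      using conv[OF b v] by (simp add: q_def convergent_LIMSEQ_iff)
    from tendsto_add[OF close[OF b u v] this] show ?thesis by simp
  qed
  have const: "approx (\<lambda>_. a) (j a)" if "a \<in> acarrier A" for a
    using that by (simp add: approx_def hom_closed)
  have add: "approx (\<lambda>n. aadd A (u n) (v n)) (aadd B a b)"
    if "a \<in> acarrier B" "b \<in> acarrier B" "approx u a" "approx v b" for a b u v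
  proof (rule approxI)
    show "(\<lambda>n. B.dst a (j (u n)) + B.dst b (j (v n))) \<longlonglongrightarrow> 0"
      using tendsto_add[OF approxD(2)[OF that(3)] approxD(2)[OF that(4)]] by simp
  qed (use that in \<open>simp_all add: approxD hom_add hom_closed B.dst_add\<close>)
  have scale: "approx (\<lambda>n. ascale A c (u n)) (ascale B c a)"
    if "a \<in> acarrier B" "approx u a" for a u c
  proof (rule approxI)
    show "(\<lambda>n. cmod c * B.dst a (j (u n))) \<longlonglongrightarrow> 0"
      using tendsto_mult_left[OF approxD(2)[OF that(2)], of "cmod c"] by simp
  qed (use that in \<open>simp_all add: approxD hom_scale hom_closed B.dst_scale\<close>)
  have star: "approx (\<lambda>n. astar A (u n)) (astar B a)"
    if "a \<in> acarrier B" "approx u a" for a u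
    using that approxD(1)[OF that(2)]
    by (intro approxI[OF _ _ _ approxD(2)[OF that(2)]])
      (simp_all add: hom_star hom_closed B.dst_star)
  have mult: "approx (\<lambda>n. amult A (u n) (v n)) (amult B a b)"
    if "a \<in> acarrier B" "b \<in> acarrier B" "approx u a" "approx v b" for a b u v
  proof (rule approxI)
    let ?x = "\<lambda>n. B.dst a (j (u n))" and ?y = "\<lambda>n. B.dst b (j (v n))"
    have "(\<lambda>n. ?x n * N b + (N a + ?x n) * ?y n) \<longlonglongrightarrow> 0 * N b + (N a + 0) * 0"
      using that by (intro tendsto_intros approxD(2))
    then show "(\<lambda>n. ?x n * N b + (N a + ?x n) * ?y n) \<longlonglongrightarrow> 0" by simp
    fix n
    have uv: "j (u n) \<in> acarrier B" "j (v n) \<in> acarrier B"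
      using that approxD hom_closed by blast+
    \<comment> \<open>The product estimate contains the norm of the approximant, which is replaced
      by the fixed norm of a plus a null sequence so that the bound tends to zero.\<close>
    have "N (j (u n)) \<le> N a + ?x n"
      using B.abs_diff_le_dst[of a "j (u n)"] uv that by simp
    then have "N (j (u n)) * ?y n \<le> (N a + ?x n) * ?y n"
      using uv that by (intro mult_right_mono) simp_all
    then show "B.dst (amult B a b) (j (amult A (u n) (v n))) \<le> ?x n * N b + (N a + ?x n) * ?y n"
      using B.dst_mult[of a b "j (u n)" "j (v n)"] uv that approxD by (simp add: hom_mult)
  qed (use that in \<open>simp_all add: approxD\<close>)
  have "cstar_seminorm B q"
    unfolding cstar_seminorm_def
  proof (intro conjI ballI allI)
    fix a assume a: "a \<in> acarrier B"
    obtain u where u: "approx u a" using ex a by blast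
    note ua = approxD(1)[OF u] and l = lim[OF a u]
    show "0 \<le> q a"
      using l by (rule LIMSEQ_le_const) (simp add: ua)
    have "(\<lambda>n. p (u n)) \<longlonglongrightarrow> q (astar B a)"
      using lim[OF _ star[OF a u]] a by (simp add: A.p_star ua)
    then show "q (astar B a) = q a" using l by (rule LIMSEQ_unique)
    have "(\<lambda>n. (p (u n))\<^sup>2) \<longlonglongrightarrow> q (amult B (astar B a) a)"
      using lim[OF _ mult[OF _ a star[OF a u] u]] a by (simp add: cstar_seminormD(3)[OF p] ua)
    then show "q (amult B (astar B a) a) = (q a)\<^sup>2"
      by (rule LIMSEQ_unique) (intro tendsto_power l)
    {
      fix c
      have "(\<lambda>n. cmod c * p (u n)) \<longlonglongrightarrow> q (ascale B c a)"
        using lim[OF _ scale[OF a u]] a by (simp add: A.p_scale ua)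
      then show "q (ascale B c a) = cmod c * q a"
        by (rule LIMSEQ_unique) (intro tendsto_intros l)
    }
    fix b assume b: "b \<in> acarrier B"
    obtain v where v: "approx v b" using ex b by blast
    note vb = approxD(1)[OF v] and l' = lim[OF b v]
    show "q (aadd B a b) \<le> q a + q b"
      by (rule LIMSEQ_le[OF lim[OF _ add[OF a b u v]] tendsto_add[OF l l']])
        (use a b ua vb in \<open>auto simp: A.p_add\<close>)
    show "q (amult B a b) \<le> q a * q b"
      by (rule LIMSEQ_le[OF lim[OF _ mult[OF a b u v]] tendsto_mult[OF l l']])
        (use a b ua vb in \<open>auto simp: A.p_mult\<close>)
  qed
  moreover have "q (j a) = p a" if "a \<in> acarrier A" for a
    using lim[OF _ const[OF that]] that by (simp add: hom_closed LIMSEQ_const_iff)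
  ultimately show ?thesis using that by blast
qed

lemma cstar_seminorm_restrict:
  assumes "star_alg A" "star_alg_hom A B j" "cstar_seminorm B q"
  shows "cstar_seminorm A (\<lambda>a. q (j a))"
proof -
  interpret A: star_alg A by fact
  interpret star_alg_hom A B j by fact
  show ?thesis
    using cstar_seminormD[OF assms(3)] unfolding cstar_seminorm_def
    by (simp add: hom_closed hom_add hom_scale hom_mult hom_star)
qed

theorem cstar_iso_enveloping:
  assumes A: "star_alg A" and B: "seminormed_star_alg B N" and j: "star_alg_hom A B j"
    and dense: "\<And>b \<epsilon>. b \<in> acarrier B \<Longrightarrow> \<epsilon> > 0 \<Longrightarrow> \<exists>a\<in>acarrier A. pdist B N b (j a) < \<epsilon>"
    and boundA: "\<And>p a. cstar_seminorm A p \<Longrightarrow> a \<in> acarrier A \<Longrightarrow> p a \<le> N (j a)"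
    and boundB: "\<And>q b. cstar_seminorm B q \<Longrightarrow> b \<in> acarrier B \<Longrightarrow> q b \<le> N b"
  shows "cstar_iso (enveloping_cstar A) (enveloping_cstar B)"
  unfolding enveloping_cstar_def
proof (rule cstar_iso_completion[OF _ _ j])
  interpret B: seminormed_star_alg B N by fact
  interpret star_alg_hom A B j by fact
  have ne: "Collect (cstar_seminorm A) \<noteq> {}" for A :: "('x, 'y) star_algebra_scheme"
    using cstar_seminorm_zero by blast
  show "seminormed_star_alg A (max_cstar_seminorm A)"
    by (rule seminormed_max_cstar_seminorm[OF A, where N = "\<lambda>a. N (j a)"]) (rule boundA)
  show "seminormed_star_alg B (max_cstar_seminorm B)"
    by (rule seminormed_max_cstar_seminorm[OF B.star_alg_axioms, where N = N]) (rule boundB)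
  show "max_cstar_seminorm B (j a) = max_cstar_seminorm A a" if a: "a \<in> acarrier A" for a
  proof (rule antisym)
    show "max_cstar_seminorm B (j a) \<le> max_cstar_seminorm A a"
      unfolding max_cstar_seminorm_def
    proof (rule cSUP_mono[OF ne])
      show "bdd_above ((\<lambda>p. p a) ` Collect (cstar_seminorm A))"
        using boundA a by (auto intro!: bdd_aboveI2[where M = "N (j a)"])
      show "\<exists>p\<in>Collect (cstar_seminorm A). q (j a) \<le> p a" if "q \<in> Collect (cstar_seminorm B)" for q
        using cstar_seminorm_restrict[OF A j] that
        by (intro bexI[of _ "\<lambda>a. q (j a)"]) auto
    qed
    show "max_cstar_seminorm A a \<le> max_cstar_seminorm B (j a)"
      unfolding max_cstar_seminorm_def
    proof (rule cSUP_mono[OF ne])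
      show "bdd_above ((\<lambda>p. p (j a)) ` Collect (cstar_seminorm B))"
        using boundB hom_closed[OF a] by (auto intro!: bdd_aboveI2[where M = "N (j a)"])
      show "\<exists>q\<in>Collect (cstar_seminorm B). p a \<le> q (j a)" if "p \<in> Collect (cstar_seminorm A)" for p
        using cstar_seminorm_extend[OF A B j dense, of p] boundA a that
        by (metis mem_Collect_eq order_refl)
    qed
  qed
  show "\<exists>a\<in>acarrier A. pdist B (max_cstar_seminorm B) b (j a) < \<epsilon>"
    if b: "b \<in> acarrier B" and "\<epsilon> > 0" for b \<epsilon>
  proof -
    \<comment> \<open>Every C*-seminorm on \<open>B\<close> lies below \<open>N\<close>, hence so
      does the maximal one, and density in \<open>N\<close> implies density in the maximal
      C*-seminorm.\<close>
    obtain a where a: "a \<in> acarrier A" "pdist B N b (j a) < \<epsilon>" using dense[OF b \<open>\<epsilon> > 0\<close>] by blast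
    have "pdist B (max_cstar_seminorm B) b (j a) \<le> pdist B N b (j a)"
      unfolding pdist_def max_cstar_seminorm_def
      using ne boundB b hom_closed[OF a(1)] by (intro cSUP_least) auto
    then show ?thesis using a by force
  qed
qed

section \<open>Functions vanishing at infinity on open subsets\<close>

lemma continuous_map_complex_mult:
  fixes f g :: "'x \<Rightarrow> complex"
  shows "continuous_map X euclidean f \<Longrightarrow> continuous_map X euclidean g \<Longrightarrow>
    continuous_map X euclidean (\<lambda>x. f x * g x)"
  by (simp add: continuous_map_atin tendsto_mult)

lemma continuous_map_compose_continuous_on:
  "continuous_map X euclidean f \<Longrightarrow> continuous_on UNIV h \<Longrightarrow> continuous_map X euclidean (\<lambda>x. h (f x))"
  using continuous_map_compose[of X euclidean f euclidean h] by (simp add: o_def)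

text \<open>The extension by zero is continuous across the boundary of U: an open set around 0 has a
  preimage containing the complement of a compact set, and compact sets are closed in a Hausdorff
  space. An open set without 0 has its preimage inside U.\<close>

lemma C0_on_continuous_map:
  assumes X: "Hausdorff_space X" and U: "openin X U" and f: "f \<in> C0_on X U"
  shows "continuous_map X euclidean f"
  unfolding continuous_map
proof (intro conjI allI impI)
  fix V :: "complex set" assume "openin euclidean V"
  then have V: "open V" by simp
  have fU: "continuous_map (subtopology X U) euclidean f" and f0: "\<And>x. x \<notin> U \<Longrightarrow> f x = 0"
    using f by (auto simp: C0_on_def)
  have "openin (subtopology X U) {x \<in> topspace (subtopology X U). f x \<in> V}"
    using fU V by (intro openin_continuous_map_preimage) auto
  then have W: "openin X {x \<in> topspace (subtopology X U). f x \<in> V}"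
    using U openin_trans_full by blast
  have UX: "U \<subseteq> topspace X" using U by (rule openin_subset)
  show "openin X {x \<in> topspace X. f x \<in> V}"
  proof (cases "0 \<in> V")
    case True
    then obtain \<epsilon> where \<epsilon>: "\<epsilon> > 0" "ball 0 \<epsilon> \<subseteq> V"
      using V open_contains_ball by blast
    then obtain K where K: "compactin X K" "K \<subseteq> U" "\<forall>x\<in>U - K. cmod (f x) < \<epsilon>"
      using f unfolding C0_on_def by blast
    have "f x \<in> V" if "x \<in> topspace X - K" for x
      using that K(3) \<epsilon> f0 True by (cases "x \<in> U") (auto simp: subset_iff)
    then have "{x \<in> topspace X. f x \<in> V} =
        {x \<in> topspace (subtopology X U). f x \<in> V} \<union> (topspace X - K)"
      using K(2) UX by auto
    moreover have "openin X (topspace X - K)"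
      using compactin_imp_closedin[OF X K(1)] by (simp add: closedin_def)
    ultimately show ?thesis using W by auto
  next
    case False
    then have "{x \<in> topspace X. f x \<in> V} = {x \<in> topspace (subtopology X U). f x \<in> V}"
      using f0 by auto metis
    then show ?thesis using W by simp
  qed
qed simp

text \<open>All conditions except the vanishing off U now refer to the whole space. Changing U then
  only affects that one condition, which makes intersections and enlargements of U easy.\<close>

lemma C0_on_iff:
  assumes X: "Hausdorff_space X" and U: "openin X U"
  shows "f \<in> C0_on X U \<longleftrightarrow> continuous_map X euclidean f \<and> (\<forall>x. x \<notin> U \<longrightarrow> f x = 0) \<and>
    (\<forall>\<epsilon>>0. compactin X {x \<in> topspace X. \<epsilon> \<le> cmod (f x)})"
proof
  assume f: "f \<in> C0_on X U"
  have cont: "continuous_map X euclidean f" by (rule C0_on_continuous_map[OF assms f])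
  have f0: "\<And>x. x \<notin> U \<Longrightarrow> f x = 0" using f by (auto simp: C0_on_def)
  have "compactin X {x \<in> topspace X. \<epsilon> \<le> cmod (f x)}" if eps: "\<epsilon> > 0" for \<epsilon>
  proof -
    obtain K where K: "compactin X K" "K \<subseteq> U" "\<forall>x\<in>U - K. cmod (f x) < \<epsilon>"
      using f eps unfolding C0_on_def by blast
    show ?thesis
    proof (rule closed_compactin[OF K(1)])
      show "{x \<in> topspace X. \<epsilon> \<le> cmod (f x)} \<subseteq> K"
      proof
        fix x assume x: "x \<in> {x \<in> topspace X. \<epsilon> \<le> cmod (f x)}"
        then have "f x \<noteq> 0" using eps by auto
        then have "x \<in> U" using f0 by blast
        then show "x \<in> K" using x K(3) by force
      qed
      have "closed {z :: complex. \<epsilon> \<le> cmod z}"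
        by (intro closed_Collect_le continuous_intros)
      then show "closedin X {x \<in> topspace X. \<epsilon> \<le> cmod (f x)}"
        using closedin_continuous_map_preimage[OF cont, of "{z. \<epsilon> \<le> cmod z}"] by simp
    qed
  qed
  then show "continuous_map X euclidean f \<and> (\<forall>x. x \<notin> U \<longrightarrow> f x = 0) \<and>
    (\<forall>\<epsilon>>0. compactin X {x \<in> topspace X. \<epsilon> \<le> cmod (f x)})"
    using cont f0 by blast
next
  assume *: "continuous_map X euclidean f \<and> (\<forall>x. x \<notin> U \<longrightarrow> f x = 0) \<and>
    (\<forall>\<epsilon>>0. compactin X {x \<in> topspace X. \<epsilon> \<le> cmod (f x)})"
  have "\<exists>K. compactin X K \<and> K \<subseteq> U \<and> (\<forall>x\<in>U - K. cmod (f x) < \<epsilon>)" if "\<epsilon> > 0" for \<epsilon>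
  proof (intro exI conjI)
    show "compactin X {x \<in> topspace X. \<epsilon> \<le> cmod (f x)}" using * that by blast
    show "{x \<in> topspace X. \<epsilon> \<le> cmod (f x)} \<subseteq> U"
    proof
      fix x assume "x \<in> {x \<in> topspace X. \<epsilon> \<le> cmod (f x)}"
      then have "f x \<noteq> 0" using that by auto
      then show "x \<in> U" using * by blast
    qed
    show "\<forall>x\<in>U - {x \<in> topspace X. \<epsilon> \<le> cmod (f x)}. cmod (f x) < \<epsilon>"
      using openin_subset[OF U] by auto
  qed
  then show "f \<in> C0_on X U"
    using * by (simp add: C0_on_def continuous_map_from_subtopology)
qed

lemma Cc_on_subset_C0_on: "Cc_on X U \<subseteq> C0_on X U"
proof
  fix f :: "'a \<Rightarrow> complex" assume "f \<in> Cc_on X U"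
  then obtain K where K: "continuous_map (subtopology X U) euclidean f" "compactin X K" "K \<subseteq> U"
    "\<And>x. x \<notin> K \<Longrightarrow> f x = 0"
    unfolding Cc_on_def by blast
  then have "\<forall>x\<in>U - K. cmod (f x) < \<epsilon>" if "\<epsilon> > 0" for \<epsilon> using that by simp
  then show "f \<in> C0_on X U"
    using K unfolding C0_on_def by blast
qed

lemma Cc_on_iff:
  assumes "Hausdorff_space X" "openin X U"
  shows "f \<in> Cc_on X U \<longleftrightarrow> continuous_map X euclidean f \<and>
    (\<exists>K. compactin X K \<and> K \<subseteq> U \<and> (\<forall>x. x \<notin> K \<longrightarrow> f x = 0))"
proof
  assume f: "f \<in> Cc_on X U"
  then have "f \<in> C0_on X U" using Cc_on_subset_C0_on by blast
  then show "continuous_map X euclidean f \<and> (\<exists>K. compactin X K \<and> K \<subseteq> U \<and> (\<forall>x. x \<notin> K \<longrightarrow> f x = 0))"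
    using C0_on_continuous_map[OF assms] f by (simp add: Cc_on_def)
qed (simp add: Cc_on_def continuous_map_from_subtopology)

text \<open>The set where |f| is at least 1 is compact, so f is bounded on it; elsewhere 1 is a
  bound.\<close>

lemma C0_on_bounded:
  assumes "Hausdorff_space X" "openin X U" "f \<in> C0_on X U"
  obtains M where "M \<ge> 0" "\<And>x. cmod (f x) \<le> M"
proof -
  let ?K = "{x \<in> topspace X. 1 \<le> cmod (f x)}"
  have f: "continuous_map X euclidean f" "\<And>x. x \<notin> U \<Longrightarrow> f x = 0" "compactin X ?K"
    using assms by (simp_all add: C0_on_iff)
  have "compact (f ` ?K)" using image_compactin[OF f(3,1)] by simp
  then obtain M where M: "\<And>x. x \<in> ?K \<Longrightarrow> cmod (f x) \<le> M"
    using compact_imp_bounded bounded_iff by (metis imageI)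
  have "cmod (f x) \<le> max M 1" for x
  proof (cases "x \<in> ?K")
    case False
    then have "x \<notin> U \<or> cmod (f x) < 1" using openin_subset[OF assms(2)] by auto
    then show ?thesis using f(2) by (cases "x \<in> U") auto
  qed (use M in fastforce)
  then show ?thesis by (intro that[of "max M 1"]) auto
qed

lemma C0_on_bdd_above:
  "Hausdorff_space X \<Longrightarrow> openin X U \<Longrightarrow> f \<in> C0_on X U \<Longrightarrow> bdd_above (range (\<lambda>x. cmod (f x)))"
  by (metis C0_on_bounded bdd_aboveI2)

lemma C0_on_zero: "(\<lambda>_. 0) \<in> C0_on X U" and Cc_on_zero: "(\<lambda>_. 0) \<in> Cc_on X U"
proof -
  show "(\<lambda>_. 0) \<in> Cc_on X U"
    by (auto simp: Cc_on_def intro!: exI[of _ "{}"])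
  then show "(\<lambda>_. 0) \<in> C0_on X U" using Cc_on_subset_C0_on by blast
qed

lemma C0_on_mono:
  "Hausdorff_space X \<Longrightarrow> openin X U \<Longrightarrow> openin X V \<Longrightarrow> U \<subseteq> V \<Longrightarrow> f \<in> C0_on X U \<Longrightarrow> f \<in> C0_on X V"
  by (auto simp: C0_on_iff)

lemma Cc_on_mono:
  "Hausdorff_space X \<Longrightarrow> openin X U \<Longrightarrow> openin X V \<Longrightarrow> U \<subseteq> V \<Longrightarrow> f \<in> Cc_on X U \<Longrightarrow> f \<in> Cc_on X V"
  unfolding Cc_on_iff by (meson subset_trans)

text \<open>The sets where |f| is at least \<epsilon> are closed by continuity, so it is enough to
  enclose each of them in a compact set.\<close>

lemma C0_on_dominated:
  assumes X: "Hausdorff_space X" and U: "openin X U" and f: "continuous_map X euclidean f"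
    and K: "\<And>\<epsilon>. \<epsilon> > 0 \<Longrightarrow> \<exists>K. compactin X K \<and> (\<forall>x\<in>topspace X. \<epsilon> \<le> cmod (f x) \<longrightarrow> x \<in> K)"
    and zero: "\<And>x. x \<notin> U \<Longrightarrow> f x = 0"
  shows "f \<in> C0_on X U"
  unfolding C0_on_iff[OF X U]
proof (intro conjI allI impI)
  fix \<epsilon> :: real assume "\<epsilon> > 0"
  then obtain K where K': "compactin X K" "\<forall>x\<in>topspace X. \<epsilon> \<le> cmod (f x) \<longrightarrow> x \<in> K"
    using K by blast
  have "closed {z :: complex. \<epsilon> \<le> cmod z}"
    by (intro closed_Collect_le continuous_intros)
  then have "closedin X {x \<in> topspace X. \<epsilon> \<le> cmod (f x)}"
    using closedin_continuous_map_preimage[OF f, of "{z. \<epsilon> \<le> cmod z}"] by simp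
  then show "compactin X {x \<in> topspace X. \<epsilon> \<le> cmod (f x)}"
    using K' by (intro closed_compactin[OF K'(1)]) auto
qed (use f zero in auto)

lemma C0_on_add:
  assumes X: "Hausdorff_space X" and U: "openin X U" and f: "f \<in> C0_on X U" and g: "g \<in> C0_on X U"
  shows "(\<lambda>x. f x + g x) \<in> C0_on X U"
proof (rule C0_on_dominated[OF X U])
  show "continuous_map X euclidean (\<lambda>x. f x + g x)"
    using assms by (intro continuous_map_add) (auto simp: C0_on_iff)
  fix \<epsilon> :: real assume "\<epsilon> > 0"
  let ?K = "\<lambda>f. {x \<in> topspace X. \<epsilon> / 2 \<le> cmod (f x)}"
  have "compactin X (?K f)" "compactin X (?K g)"
    using f g \<open>\<epsilon> > 0\<close> unfolding C0_on_iff[OF X U] by (meson half_gt_zero)+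
  then have "compactin X (?K f \<union> ?K g)"
    by (rule compactin_Un)
  moreover have "x \<in> ?K f \<union> ?K g" if "x \<in> topspace X" "\<epsilon> \<le> cmod (f x + g x)" for x
    using that norm_triangle_ineq[of "f x" "g x"] by auto
  ultimately show "\<exists>K. compactin X K \<and> (\<forall>x\<in>topspace X. \<epsilon> \<le> cmod (f x + g x) \<longrightarrow> x \<in> K)"
    by blast
next
  show "\<And>x. x \<notin> U \<Longrightarrow> f x + g x = 0" using f g by (simp add: C0_on_def)
qed

lemma C0_on_mult_bounded:
  assumes X: "Hausdorff_space X" and U: "openin X U" and f: "f \<in> C0_on X U"
    and h: "continuous_map X euclidean h" "\<And>x. x \<in> topspace X \<Longrightarrow> cmod (h x) \<le> M"
  shows "(\<lambda>x. f x * h x) \<in> C0_on X U"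
proof (rule C0_on_dominated[OF X U])
  show "continuous_map X euclidean (\<lambda>x. f x * h x)"
    using assms by (intro continuous_map_complex_mult) (auto simp: C0_on_iff)
  fix \<epsilon> :: real assume \<epsilon>: "\<epsilon> > 0"
  \<comment> \<open>The bound M is enlarged to |M| + 1 to be a positive divisor.\<close>
  let ?K = "{x \<in> topspace X. \<epsilon> / (\<bar>M\<bar> + 1) \<le> cmod (f x)}"
  have "compactin X ?K"
    using f \<epsilon> unfolding C0_on_iff[OF X U] by simp
  moreover have "x \<in> ?K" if x: "x \<in> topspace X" "\<epsilon> \<le> cmod (f x * h x)" for x
  proof -
    have "\<epsilon> \<le> cmod (f x) * cmod (h x)" using x by (simp add: norm_mult)
    also have "\<dots> \<le> cmod (f x) * (\<bar>M\<bar> + 1)"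
      using h(2)[OF x(1)] by (intro mult_left_mono) auto
    finally show ?thesis using x by (simp add: divide_le_eq)
  qed
  ultimately show "\<exists>K. compactin X K \<and> (\<forall>x\<in>topspace X. \<epsilon> \<le> cmod (f x * h x) \<longrightarrow> x \<in> K)"
    by blast
next
  show "\<And>x. x \<notin> U \<Longrightarrow> f x * h x = 0" using f by (simp add: C0_on_def)
qed

lemma C0_on_mult:
  assumes X: "Hausdorff_space X" and U: "openin X U" and V: "openin X V"
    and f: "f \<in> C0_on X U" and g: "g \<in> C0_on X V"
  shows "(\<lambda>x. f x * g x) \<in> C0_on X (U \<inter> V)"
proof -
  obtain M where "\<And>x. cmod (g x) \<le> M" using C0_on_bounded[OF X V g] by metis
  then have "(\<lambda>x. f x * g x) \<in> C0_on X U"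
    using g by (intro C0_on_mult_bounded[OF X U f]) (auto simp: C0_on_iff[OF X V])
  then show ?thesis
    using g unfolding C0_on_iff[OF X U] C0_on_iff[OF X V] C0_on_iff[OF X openin_Int[OF U V]] by auto
qed

lemma C0_on_cnj:
  assumes X: "Hausdorff_space X" and U: "openin X U" and f: "f \<in> C0_on X U"
  shows "(\<lambda>x. cnj (f x)) \<in> C0_on X U"
proof -
  have "continuous_map X euclidean (\<lambda>x. cnj (f x))"
    using f by (intro continuous_map_compose_continuous_on[of X f cnj] continuous_intros)
      (auto simp: C0_on_iff[OF X U])
  then show ?thesis using f by (simp add: C0_on_iff[OF X U])
qed

lemma Cc_on_add:
  assumes X: "Hausdorff_space X" and U: "openin X U" and f: "f \<in> Cc_on X U" and g: "g \<in> Cc_on X U"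
  shows "(\<lambda>x. f x + g x) \<in> Cc_on X U"
proof -
  obtain K L where K: "compactin X K" "K \<subseteq> U" "\<And>x. x \<notin> K \<Longrightarrow> f x = 0"
    and L: "compactin X L" "L \<subseteq> U" "\<And>x. x \<notin> L \<Longrightarrow> g x = 0"
    using f g unfolding Cc_on_def by blast
  have "continuous_map X euclidean (\<lambda>x. f x + g x)"
    using assms by (intro continuous_map_add) (auto simp: Cc_on_iff)
  moreover have "compactin X (K \<union> L)" "K \<union> L \<subseteq> U" "\<forall>x. x \<notin> K \<union> L \<longrightarrow> f x + g x = 0"
    using K L by (auto intro: compactin_Un)
  ultimately show ?thesis unfolding Cc_on_iff[OF X U] by blast
qed

lemma Cc_on_mult_continuous:
  assumes X: "Hausdorff_space X" and U: "openin X U" and f: "f \<in> Cc_on X U"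
    and h: "continuous_map X euclidean h"
  shows "(\<lambda>x. f x * h x) \<in> Cc_on X U"
proof -
  obtain K where K: "compactin X K" "K \<subseteq> U" "\<And>x. x \<notin> K \<Longrightarrow> f x = 0"
    using f unfolding Cc_on_def by blast
  have "continuous_map X euclidean (\<lambda>x. f x * h x)"
    using assms by (intro continuous_map_complex_mult) (auto simp: Cc_on_iff)
  moreover have "\<forall>x. x \<notin> K \<longrightarrow> f x * h x = 0" using K by simp
  ultimately show ?thesis unfolding Cc_on_iff[OF X U] using K by blast
qed

lemma Cc_on_mult:
  assumes X: "Hausdorff_space X" and U: "openin X U" and V: "openin X V"
    and f: "f \<in> Cc_on X U" and g: "g \<in> Cc_on X V"
  shows "(\<lambda>x. f x * g x) \<in> Cc_on X (U \<inter> V)"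
proof -
  obtain K L where K: "compactin X K" "K \<subseteq> U" "\<And>x. x \<notin> K \<Longrightarrow> f x = 0"
    and L: "compactin X L" "L \<subseteq> V" "\<And>x. x \<notin> L \<Longrightarrow> g x = 0"
    using f g unfolding Cc_on_def by blast
  have "compactin X (K \<inter> L)"
    using K(1) compactin_imp_closedin[OF X L(1)] by (rule compact_Int_closedin)
  moreover have "continuous_map X euclidean (\<lambda>x. f x * g x)"
    using f g by (intro continuous_map_complex_mult) (auto simp: Cc_on_iff[OF X U] Cc_on_iff[OF X V])
  moreover have "K \<inter> L \<subseteq> U \<inter> V" "\<forall>x. x \<notin> K \<inter> L \<longrightarrow> f x * g x = 0"
    using K L by auto
  ultimately show ?thesis unfolding Cc_on_iff[OF X openin_Int[OF U V]] by blast
qed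

lemma Cc_on_cnj:
  assumes X: "Hausdorff_space X" and U: "openin X U" and f: "f \<in> Cc_on X U"
  shows "(\<lambda>x. cnj (f x)) \<in> Cc_on X U"
proof -
  have "continuous_map X euclidean (\<lambda>x. cnj (f x))"
    using f by (intro continuous_map_compose_continuous_on[of X f cnj] continuous_intros)
      (auto simp: Cc_on_iff[OF X U])
  then show ?thesis using f by (simp add: Cc_on_iff[OF X U])
qed

text \<open>Soft thresholding: the function c lowers the modulus of z by \<epsilon> and sends the
  disc of radius \<epsilon> to 0. It is continuous, moves no point by more than \<epsilon>, and c(f)
  is supported in the compact set where |f| is at least \<epsilon>.\<close>

lemma Cc_on_approx:
  assumes X: "Hausdorff_space X" and U: "openin X U" and f: "f \<in> C0_on X U" and "\<epsilon> > 0"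
  obtains g where "g \<in> Cc_on X U" "\<And>x. cmod (f x - g x) \<le> \<epsilon>" "(\<And>x. f x = 0) \<Longrightarrow> g = (\<lambda>_. 0)"
proof
  define c where "c z = z - z * complex_of_real (\<epsilon> / max (cmod z) \<epsilon>)" for z
  have "continuous_on UNIV c"
    unfolding c_def using \<open>\<epsilon> > 0\<close> by (intro continuous_intros) auto
  then have "continuous_map X euclidean (\<lambda>x. c (f x))"
    using f by (intro continuous_map_compose_continuous_on[of X f c]) (auto simp: C0_on_iff[OF X U])
  moreover have "compactin X {x \<in> topspace X. \<epsilon> \<le> cmod (f x)}"
    using f \<open>\<epsilon> > 0\<close> by (auto simp: C0_on_iff[OF X U])
  moreover have "x \<in> U" if "\<epsilon> \<le> cmod (f x)" for x
    using that f \<open>\<epsilon> > 0\<close> by (auto simp: C0_on_iff[OF X U])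
  moreover have "c (f x) = 0" if "x \<notin> {x \<in> topspace X. \<epsilon> \<le> cmod (f x)}" for x
  proof (cases "x \<in> topspace X")
    case True
    then show ?thesis using that \<open>\<epsilon> > 0\<close> by (simp add: c_def max_def)
  next
    case False
    then have "x \<notin> U" using openin_subset[OF U] by auto
    then show ?thesis using f by (simp add: c_def C0_on_def)
  qed
  ultimately show "(\<lambda>x. c (f x)) \<in> Cc_on X U"
    unfolding Cc_on_iff[OF X U] by blast
  show "cmod (f x - c (f x)) \<le> \<epsilon>" for x
  proof -
    have "cmod (f x) * (\<epsilon> / max (cmod (f x)) \<epsilon>) = \<epsilon> * (cmod (f x) / max (cmod (f x)) \<epsilon>)"
      by simp
    also have "\<dots> \<le> \<epsilon> * 1"
      using \<open>\<epsilon> > 0\<close> by (intro mult_left_mono) (auto simp: divide_le_eq_1)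
    finally have "cmod (f x) * (\<epsilon> / max (cmod (f x)) \<epsilon>) \<le> \<epsilon>" by simp
    moreover have "cmod (f x - c (f x)) = cmod (f x) * (\<epsilon> / max (cmod (f x)) \<epsilon>)"
      using \<open>\<epsilon> > 0\<close> by (simp add: c_def norm_mult norm_divide)
    ultimately show ?thesis by simp
  qed
  show "(\<And>x. f x = 0) \<Longrightarrow> (\<lambda>x. c (f x)) = (\<lambda>_. 0)"
    by (simp add: c_def)
qed

section \<open>The supremum norm of functions extended by zero\<close>

definition supn :: "('x \<Rightarrow> complex) \<Rightarrow> real" where
  "supn f = (SUP x. cmod (f x))"

lemma supn_upper: "bdd_above (range (\<lambda>x. cmod (f x))) \<Longrightarrow> cmod (f x) \<le> supn f"
  unfolding supn_def by (rule cSUP_upper) simp_all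

lemma supn_least: "(\<And>x. cmod (f x) \<le> M) \<Longrightarrow> supn f \<le> M"
  unfolding supn_def by (rule cSUP_least) simp_all

lemma supn_zero [simp]: "supn (\<lambda>_. 0) = 0"
  by (simp add: supn_def)

lemma supn_nonneg: "bdd_above (range (\<lambda>x. cmod (f x))) \<Longrightarrow> 0 \<le> supn f"
  using supn_upper[of f undefined] norm_ge_zero order_trans by blast

lemma supn_cnj [simp]: "supn (\<lambda>x. cnj (f x)) = supn f"
  by (simp add: supn_def)

lemma supn_add:
  "bdd_above (range (\<lambda>x. cmod (f x))) \<Longrightarrow> bdd_above (range (\<lambda>x. cmod (g x))) \<Longrightarrow>
    supn (\<lambda>x. f x + g x) \<le> supn f + supn g"
  by (rule supn_least, rule norm_triangle_le, intro add_mono supn_upper)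

lemma supn_scale_le:
  "bdd_above (range (\<lambda>x. cmod (f x))) \<Longrightarrow> supn (\<lambda>x. c * f x) \<le> cmod c * supn f"
  by (rule supn_least) (simp add: norm_mult mult_left_mono supn_upper)

lemma supn_scale:
  assumes f: "bdd_above (range (\<lambda>x. cmod (f x)))"
  shows "supn (\<lambda>x. c * f x) = cmod c * supn f"
proof (cases "c = 0")
  case False
  have "bdd_above (range (\<lambda>x. cmod (c * f x)))"
    using supn_upper[OF f] by (intro bdd_aboveI2[where M = "cmod c * supn f"])
      (simp add: norm_mult mult_left_mono)
  from supn_scale_le[OF this, of "inverse c"] have "supn f \<le> cmod (inverse c) * supn (\<lambda>x. c * f x)"
    using False by (simp flip: mult.assoc)
  then have "cmod c * supn f \<le> supn (\<lambda>x. c * f x)"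
    using False unfolding norm_inverse by (simp add: field_simps)
  then show ?thesis using supn_scale_le[OF f, of c] by simp
qed simp

section \<open>Partial actions\<close>

locale partial_act =
  fixes G :: "('g, 'm) monoid_scheme" (structure) and X :: "'x topology" and \<theta> :: "'g \<Rightarrow> 'x \<rightharpoonup> 'x"
  assumes partial_action: "partial_action G X \<theta>"
begin

sublocale group G
  using partial_action by (simp add: partial_action_def)

lemma Hausdorff_X: "Hausdorff_space X"
  using partial_action by (simp add: partial_action_def)

lemma openin_dom: "g \<in> carrier G \<Longrightarrow> openin X (dom (\<theta> g))"
  and openin_ran: "g \<in> carrier G \<Longrightarrow> openin X (ran (\<theta> g))"
  using partial_action by (auto simp: partial_action_def)

lemma theta_inv_iff: "g \<in> carrier G \<Longrightarrow> \<theta> (inv g) y = Some x \<longleftrightarrow> \<theta> g x = Some y"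
  using partial_action by (simp add: partial_action_def)

lemma theta_one: "\<theta> \<one> = Some |` topspace X"
  using partial_action by (simp add: partial_action_def)

lemma theta_mult:
  assumes "g \<in> carrier G" "h \<in> carrier G" "\<theta> h x = Some y" "\<theta> g y = Some z"
  shows "\<theta> (g \<otimes> h) x = Some z"
proof -
  have "\<theta> g \<circ>\<^sub>m \<theta> h \<subseteq>\<^sub>m \<theta> (g \<otimes> h)"
    using partial_action assms(1,2) by (simp add: partial_action_def)
  moreover have "(\<theta> g \<circ>\<^sub>m \<theta> h) x = Some z" using assms by (simp add: map_comp_def)
  ultimately show ?thesis by (metis domI map_le_def)
qed

lemma theta_topspace:
  assumes "g \<in> carrier G" "\<theta> g x = Some y"
  shows "x \<in> topspace X" "y \<in> topspace X"
  using openin_subset[OF openin_dom[OF assms(1)]] openin_subset[OF openin_ran[OF assms(1)]] assms(2)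
  by (auto simp: dom_def ran_def)

lemma ran_theta: "g \<in> carrier G \<Longrightarrow> x \<in> ran (\<theta> g) \<longleftrightarrow> (\<exists>y. \<theta> (inv g) x = Some y)"
  by (auto simp: ran_def theta_inv_iff)

lemma dom_theta_inv: "g \<in> carrier G \<Longrightarrow> dom (\<theta> (inv g)) = ran (\<theta> g)"
  by (auto simp: ran_theta)

lemma ran_theta_inv: "g \<in> carrier G \<Longrightarrow> ran (\<theta> (inv g)) = dom (\<theta> g)"
  using dom_theta_inv[of "inv g"] by simp

lemma ran_theta_one: "ran (\<theta> \<one>) = topspace X"
  by (auto simp: theta_one ran_def restrict_map_def split: if_splits)

lemma continuous_map_theta:
  assumes "g \<in> carrier G"
  shows "continuous_map (subtopology X (dom (\<theta> g))) (subtopology X (ran (\<theta> g))) (\<lambda>x. the (\<theta> g x))"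
  using partial_action assms by (intro homeomorphic_imp_continuous_map) (simp add: partial_action_def)

lemma act_fun_Some: "\<theta> (inv g) x = Some y \<Longrightarrow> act_fun G \<theta> g f x = f y"
  by (simp add: act_fun_def)

lemma act_fun_None: "\<theta> (inv g) x = None \<Longrightarrow> act_fun G \<theta> g f x = 0"
  by (simp add: act_fun_def)

definition translate :: "'g \<Rightarrow> 'x set \<Rightarrow> 'x set" where
  "translate g W = {x. \<exists>y\<in>W. \<theta> g y = Some x}"

text \<open>The translate by g is the preimage under the action of the inverse of g, taken inside an
  open domain.\<close>

lemma openin_translate:
  assumes g: "g \<in> carrier G" and W: "openin X W"
  shows "openin X (translate g W)"
proof -
  let ?S = "subtopology X (dom (\<theta> (inv g)))"
  have "continuous_map ?S X (\<lambda>x. the (\<theta> (inv g) x))"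
    using continuous_map_theta[of "inv g"] g by (simp add: continuous_map_in_subtopology)
  then have "openin ?S {x \<in> topspace ?S. the (\<theta> (inv g) x) \<in> W}"
    using W by (rule openin_continuous_map_preimage)
  then have "openin X {x \<in> topspace ?S. the (\<theta> (inv g) x) \<in> W}"
    using openin_dom[of "inv g"] g by (auto intro: openin_trans_full)
  moreover have "{x \<in> topspace ?S. the (\<theta> (inv g) x) \<in> W} = translate g W"
  proof (intro equalityI subsetI)
    fix x assume "x \<in> {x \<in> topspace ?S. the (\<theta> (inv g) x) \<in> W}"
    then obtain y where "\<theta> (inv g) x = Some y" "y \<in> W" by auto
    then show "x \<in> translate g W" using g by (auto simp: translate_def theta_inv_iff)
  next
    fix x assume "x \<in> translate g W"
    then obtain y where "\<theta> g y = Some x" "y \<in> W" by (auto simp: translate_def)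
    moreover from this have "\<theta> (inv g) x = Some y" "x \<in> topspace X"
      using g theta_topspace[OF g] by (simp_all add: theta_inv_iff)
    ultimately show "x \<in> {x \<in> topspace ?S. the (\<theta> (inv g) x) \<in> W}" by auto
  qed
  ultimately show ?thesis by simp
qed

lemma compactin_translate:
  assumes g: "g \<in> carrier G" and K: "compactin X K" "K \<subseteq> dom (\<theta> g)"
  shows "compactin X (translate g K)"
proof -
  have "compactin (subtopology X (dom (\<theta> g))) K"
    using K by (simp add: compactin_subtopology)
  from image_compactin[OF this continuous_map_theta[OF g]]
  have "compactin X ((\<lambda>x. the (\<theta> g x)) ` K)"
    by (simp add: compactin_subtopology)
  moreover have "(\<lambda>x. the (\<theta> g x)) ` K = translate g K"
    using K(2) by (force simp: translate_def)
  ultimately show ?thesis by simp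
qed

lemma act_fun_nonzero:
  assumes "g \<in> carrier G" "act_fun G \<theta> g f x \<noteq> 0"
  obtains y where "\<theta> g y = Some x" "f y = act_fun G \<theta> g f x"
proof (cases "\<theta> (inv g) x")
  case (Some y)
  then show ?thesis using assms that[of y] by (simp add: act_fun_Some theta_inv_iff)
qed (use assms act_fun_None in auto)

lemma continuous_map_act_fun:
  assumes g: "g \<in> carrier G" and W: "openin X W"
    and f: "continuous_map X euclidean f"
  shows "continuous_map (subtopology X (translate g W)) euclidean (act_fun G \<theta> g f)"
proof (rule continuous_map_eq)
  have "translate g W \<subseteq> dom (\<theta> (inv g))"
    using g by (auto simp: translate_def dom_def theta_inv_iff)
  moreover have "continuous_map (subtopology X (dom (\<theta> (inv g)))) X (\<lambda>x. the (\<theta> (inv g) x))"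
    using continuous_map_theta[of "inv g"] g by (simp add: continuous_map_in_subtopology)
  ultimately have "continuous_map (subtopology X (translate g W)) X (\<lambda>x. the (\<theta> (inv g) x))"
    using continuous_map_from_subtopology_mono by blast
  from continuous_map_compose[OF this f]
  show "continuous_map (subtopology X (translate g W)) euclidean (f \<circ> (\<lambda>x. the (\<theta> (inv g) x)))" .
  fix x assume "x \<in> topspace (subtopology X (translate g W))"
  then obtain y where "\<theta> (inv g) x = Some y"
    using g by (auto simp: translate_def theta_inv_iff)
  then show "(f \<circ> (\<lambda>x. the (\<theta> (inv g) x))) x = act_fun G \<theta> g f x"
    by (simp add: act_fun_Some)
qed

lemma act_fun_C0:
  assumes g: "g \<in> carrier G" and W: "openin X W" "W \<subseteq> dom (\<theta> g)" and f: "f \<in> C0_on X W"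
  shows "act_fun G \<theta> g f \<in> C0_on X (translate g W)"
  unfolding C0_on_def
proof (intro CollectI conjI allI impI)
  show "continuous_map (subtopology X (translate g W)) euclidean (act_fun G \<theta> g f)"
    using f by (intro continuous_map_act_fun[OF g W(1)] C0_on_continuous_map[OF Hausdorff_X W(1)])
  fix x assume x: "x \<notin> translate g W"
  show "act_fun G \<theta> g f x = 0"
  proof (rule ccontr)
    assume *: "act_fun G \<theta> g f x \<noteq> 0"
    then obtain y where "\<theta> g y = Some x" "f y \<noteq> 0" by (metis act_fun_nonzero[OF g])
    then show False using x f by (auto simp: translate_def C0_on_def)
  qed
next
  fix \<epsilon> :: real assume "\<epsilon> > 0"
  then obtain K where K: "compactin X K" "K \<subseteq> W" "\<forall>x\<in>W - K. cmod (f x) < \<epsilon>"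
    using f unfolding C0_on_def by blast
  have "cmod (act_fun G \<theta> g f x) < \<epsilon>" if x: "x \<in> translate g W - translate g K" for x
  proof -
    obtain y where "y \<in> W" "\<theta> g y = Some x" "y \<notin> K"
      using x by (auto simp: translate_def)
    then show ?thesis using K(3) g by (simp add: act_fun_Some theta_inv_iff)
  qed
  moreover have "translate g K \<subseteq> translate g W" using K(2) by (auto simp: translate_def)
  moreover have "compactin X (translate g K)" using K W by (intro compactin_translate[OF g]) auto
  ultimately show "\<exists>K. compactin X K \<and> K \<subseteq> translate g W \<and>
      (\<forall>x\<in>translate g W - K. cmod (act_fun G \<theta> g f x) < \<epsilon>)"
    by blast
qed

lemma act_fun_Cc:
  assumes g: "g \<in> carrier G" and W: "openin X W" "W \<subseteq> dom (\<theta> g)" and f: "f \<in> Cc_on X W"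
  shows "act_fun G \<theta> g f \<in> Cc_on X (translate g W)"
  unfolding Cc_on_def
proof (intro CollectI conjI)
  show "continuous_map (subtopology X (translate g W)) euclidean (act_fun G \<theta> g f)"
    using f by (intro continuous_map_act_fun[OF g W(1)]) (simp add: Cc_on_iff[OF Hausdorff_X W(1)])
  obtain K where K: "compactin X K" "K \<subseteq> W" "\<And>x. x \<notin> K \<Longrightarrow> f x = 0"
    using f unfolding Cc_on_def by blast
  have "act_fun G \<theta> g f x = 0" if "x \<notin> translate g K" for x
  proof (rule ccontr)
    assume *: "act_fun G \<theta> g f x \<noteq> 0"
    then obtain y where "\<theta> g y = Some x" "f y \<noteq> 0" by (metis act_fun_nonzero[OF g])
    then show False using that K(3) by (auto simp: translate_def)
  qed
  moreover have "translate g K \<subseteq> translate g W" using K(2) by (auto simp: translate_def)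
  moreover have "compactin X (translate g K)" using K W by (intro compactin_translate[OF g]) auto
  ultimately show "\<exists>K. compactin X K \<and> K \<subseteq> translate g W \<and> (\<forall>x. x \<notin> K \<longrightarrow> act_fun G \<theta> g f x = 0)"
    by blast
qed

lemma translate_dom: "translate g (dom (\<theta> g)) = ran (\<theta> g)"
  by (auto simp: translate_def ran_def)

lemma supn_act_fun_le:
  assumes "bdd_above (range (\<lambda>x. cmod (f x)))"
  shows "supn (act_fun G \<theta> g f) \<le> supn f"
proof (rule supn_least)
  fix x
  show "cmod (act_fun G \<theta> g f x) \<le> supn f"
    using supn_upper[OF assms] supn_nonneg[OF assms] by (simp add: act_fun_def split: option.split)
qed

end


section \<open>The crossed product algebra\<close>

text \<open>The components of the elements are restricted to a family \<open>K\<close> of function spaces, which is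
  either \<open>C\<^sub>0\<close> or \<open>C\<^sub>c\<close>.\<close>

definition cross_alg ::
    "('g, 'm) monoid_scheme \<Rightarrow> 'x topology \<Rightarrow> ('g \<Rightarrow> 'x \<rightharpoonup> 'x) \<Rightarrow> ('x set \<Rightarrow> ('x \<Rightarrow> complex) set) \<Rightarrow>
     ('g \<Rightarrow> 'x \<Rightarrow> complex) star_algebra" where
  "cross_alg G X \<theta> K = (crossed_product_algebra G X \<theta>)
     \<lparr>acarrier := {a. finite {g. a g \<noteq> (\<lambda>_. 0)} \<and> {g. a g \<noteq> (\<lambda>_. 0)} \<subseteq> carrier G \<and>
        (\<forall>g\<in>carrier G. a g \<in> K (ran (\<theta> g)))}\<rparr>"

lemma cross_alg_C0: "cross_alg G X \<theta> (C0_on X) = crossed_product_algebra G X \<theta>"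
  by (simp add: cross_alg_def crossed_product_algebra_def)

lemma cross_alg_simps:
  "a \<in> acarrier (cross_alg G X \<theta> K) \<longleftrightarrow> finite {g. a g \<noteq> (\<lambda>_. 0)} \<and> {g. a g \<noteq> (\<lambda>_. 0)} \<subseteq> carrier G \<and>
    (\<forall>g\<in>carrier G. a g \<in> K (ran (\<theta> g)))"
  "aadd (cross_alg G X \<theta> K) = (\<lambda>a b g x. a g x + b g x)"
  "ascale (cross_alg G X \<theta> K) = (\<lambda>c a g x. c * a g x)"
  "amult (cross_alg G X \<theta> K) = amult (crossed_product_algebra G X \<theta>)"
  "astar (cross_alg G X \<theta> K) = astar (crossed_product_algebra G X \<theta>)"
  by (simp_all add: cross_alg_def crossed_product_algebra_def)

text \<open>The norm of the l1-sum of the coefficient spaces over G, the classical bound for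
  representations of a crossed product.\<close>

definition l1_norm :: "('g \<Rightarrow> 'x \<Rightarrow> complex) \<Rightarrow> real" where
  "l1_norm a = (\<Sum>g | a g \<noteq> (\<lambda>_. 0). supn (a g))"

lemma l1_norm_eq:
  assumes "finite F" "{g. a g \<noteq> (\<lambda>_. 0)} \<subseteq> F"
  shows "l1_norm a = (\<Sum>g\<in>F. supn (a g))"
  unfolding l1_norm_def by (rule sum.mono_neutral_left) (use assms in auto)

text \<open>The closure properties shared by U \<mapsto> C0(U) and U \<mapsto> Cc(U), so that the
  algebra structure and the bound on C*-seminorms are proved once for both. The law
  \<open>K_mult_bounded\<close> admits the unimodular multipliers of that bound, as well as
  scalars.\<close>

locale function_family = partial_act G X \<theta>
  for G :: "('g, 'm) monoid_scheme" (structure) and X :: "'x topology" and \<theta> +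
  fixes K :: "'x set \<Rightarrow> ('x \<Rightarrow> complex) set"
  assumes K_C0: "openin X U \<Longrightarrow> f \<in> K U \<Longrightarrow> f \<in> C0_on X U"
    and K_zero: "(\<lambda>_. 0) \<in> K U"
    and K_add: "openin X U \<Longrightarrow> f \<in> K U \<Longrightarrow> f' \<in> K U \<Longrightarrow> (\<lambda>x. f x + f' x) \<in> K U"
    and K_mult_bounded: "openin X U \<Longrightarrow> f \<in> K U \<Longrightarrow> continuous_map X euclidean h \<Longrightarrow>
      (\<And>x. x \<in> topspace X \<Longrightarrow> cmod (h x) \<le> M) \<Longrightarrow> (\<lambda>x. f x * h x) \<in> K U"
    and K_mult: "openin X U \<Longrightarrow> openin X V \<Longrightarrow> f \<in> K U \<Longrightarrow> f' \<in> K V \<Longrightarrow>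
      (\<lambda>x. f x * f' x) \<in> K (U \<inter> V)"
    and K_cnj: "openin X U \<Longrightarrow> f \<in> K U \<Longrightarrow> (\<lambda>x. cnj (f x)) \<in> K U"
    and K_mono: "openin X U \<Longrightarrow> openin X V \<Longrightarrow> U \<subseteq> V \<Longrightarrow> f \<in> K U \<Longrightarrow> f \<in> K V"
    and K_act: "g \<in> carrier G \<Longrightarrow> openin X U \<Longrightarrow> U \<subseteq> dom (\<theta> g) \<Longrightarrow> f \<in> K U \<Longrightarrow>
      act_fun G \<theta> g f \<in> K (translate g U)"
begin

abbreviation "B \<equiv> cross_alg G X \<theta> K"
abbreviation supp where "supp a \<equiv> {g. a g \<noteq> (\<lambda>_. 0)}"

lemma B_fin: "a \<in> acarrier B \<Longrightarrow> finite (supp a)"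
  and B_supp: "a \<in> acarrier B \<Longrightarrow> supp a \<subseteq> carrier G"
  and B_K: "a \<in> acarrier B \<Longrightarrow> g \<in> carrier G \<Longrightarrow> a g \<in> K (ran (\<theta> g))"
  by (simp_all add: cross_alg_simps)

lemma B_bdd:
  assumes "a \<in> acarrier B"
  shows "bdd_above (range (\<lambda>x. cmod (a g x)))"
proof (cases "g \<in> carrier G")
  case True
  then show ?thesis
    by (intro C0_on_bdd_above[OF Hausdorff_X openin_ran[OF True]]
        K_C0[OF openin_ran[OF True]] B_K[OF assms])
next
  case False
  then have "a g = (\<lambda>_. 0)" using B_supp[OF assms] by auto
  then show ?thesis by simp
qed

lemma B_outside: "a \<in> acarrier B \<Longrightarrow> g \<in> carrier G \<Longrightarrow> \<theta> (inv g) x = None \<Longrightarrow> a g x = 0"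
  using K_C0[OF openin_ran B_K] ran_theta[of g x] by (auto simp: C0_on_def)

lemma K_scale: "openin X U \<Longrightarrow> f \<in> K U \<Longrightarrow> (\<lambda>x. c * f x) \<in> K U"
  using K_mult_bounded[of U f "\<lambda>_. c" "cmod c"] by (simp add: mult.commute)

lemma K_sum:
  assumes "openin X U" "finite I" "\<And>i. i \<in> I \<Longrightarrow> F i \<in> K U"
  shows "(\<lambda>x. \<Sum>i\<in>I. F i x) \<in> K U"
  using assms(2,3) by (induction I rule: finite_induct) (simp_all add: K_zero K_add assms(1))

text \<open>The contribution of g and h to a product, in simplified form: translating a_g back by
  the inverse of g, multiplying by b_h and translating forward gives a_g(x) b_h(y), where y is the
  point that g sends to x, and zero if there is none.\<close>

definition mterm :: "('g \<Rightarrow> 'x \<Rightarrow> complex) \<Rightarrow> ('g \<Rightarrow> 'x \<Rightarrow> complex) \<Rightarrow> 'g \<Rightarrow> 'g \<Rightarrow> 'x \<Rightarrow> complex" where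
  "mterm a b g h x = (case \<theta> (inv g) x of None \<Rightarrow> 0 | Some y \<Rightarrow> a g x * b h y)"

lemma mterm_act_fun:
  "g \<in> carrier G \<Longrightarrow>
    act_fun G \<theta> g (\<lambda>y. act_fun G \<theta> (inv g) (a g) y * b h y) x = mterm a b g h x"
proof (cases "\<theta> (inv g) x")
  case (Some y)
  moreover assume "g \<in> carrier G"
  ultimately have "\<theta> (inv (inv g)) y = Some x" by (simp add: theta_inv_iff)
  then show ?thesis using Some by (simp add: mterm_def act_fun_Some)
qed (simp add: mterm_def act_fun_None)

lemma mterm_zero: "a g = (\<lambda>_. 0) \<Longrightarrow> mterm a b g h x = 0" "b h = (\<lambda>_. 0) \<Longrightarrow> mterm a b g h x = 0"
  by (simp_all add: mterm_def split: option.split)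

text \<open>The sum runs over arbitrary finite sets containing the supports, with an indicator for g
  h = k. Products of different elements can thus be summed over one index set and compared
  termwise.\<close>

lemma mult_eq:
  assumes F: "finite F" "F \<subseteq> carrier G" "supp a \<subseteq> F" and F': "finite F'" "supp b \<subseteq> F'"
  shows "amult B a b k x = (\<Sum>(g, h)\<in>F \<times> F'. if g \<otimes> h = k then mterm a b g h x else 0)"
proof -
  let ?S = "{(g, h). a g \<noteq> (\<lambda>_. 0) \<and> b h \<noteq> (\<lambda>_. 0) \<and> g \<otimes> h = k}"
  have "amult B a b k x = (\<Sum>(g, h)\<in>?S.
      act_fun G \<theta> g (\<lambda>y. act_fun G \<theta> (inv g) (a g) y * b h y) x)"
    by (simp add: cross_alg_simps crossed_product_algebra_def)
  also have "\<dots> = (\<Sum>(g, h)\<in>F \<times> F'. if g \<otimes> h = k then mterm a b g h x else 0)"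
  proof (rule sum.mono_neutral_cong_left)
    show "?S \<subseteq> F \<times> F'" using F F' by auto
    show "\<forall>i\<in>F \<times> F' - ?S. (case i of (g, h) \<Rightarrow> if g \<otimes> h = k then mterm a b g h x else 0) = 0"
      by (auto simp: mterm_zero split: if_splits)
    fix i assume "i \<in> ?S"
    then obtain g h where i: "i = (g, h)" "a g \<noteq> (\<lambda>_. 0)" "g \<otimes> h = k" by auto
    then have "g \<in> carrier G" using F by auto
    then show "(case i of (g, h) \<Rightarrow> act_fun G \<theta> g (\<lambda>y. act_fun G \<theta> (inv g) (a g) y * b h y) x) =
        (case i of (g, h) \<Rightarrow> if g \<otimes> h = k then mterm a b g h x else 0)"
      using i by (simp add: mterm_act_fun)
  qed (use F F' in simp)
  finally show ?thesis .
qed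

text \<open>The translated a_g lives on the domain of g, its product with b_h on the part of that
  domain inside the range of h. The translate of this part lies in the range of g h, because
  composites restrict the action of the product.\<close>

lemma mterm_K:
  assumes a: "a \<in> acarrier B" and b: "b \<in> acarrier B" and g: "g \<in> carrier G" and h: "h \<in> carrier G"
  shows "mterm a b g h \<in> K (ran (\<theta> (g \<otimes> h)))"
proof -
  have g': "inv g \<in> carrier G" using g by simp
  have "act_fun G \<theta> (inv g) (a g) \<in> K (translate (inv g) (dom (\<theta> (inv g))))"
    using B_K[OF a g] openin_ran[OF g] dom_theta_inv[OF g] by (intro K_act[OF g']) auto
  then have 1: "act_fun G \<theta> (inv g) (a g) \<in> K (dom (\<theta> g))"
    by (simp add: translate_dom ran_theta_inv g)
  have 2: "(\<lambda>y. act_fun G \<theta> (inv g) (a g) y * b h y) \<in> K (dom (\<theta> g) \<inter> ran (\<theta> h))"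
    by (rule K_mult[OF openin_dom[OF g] openin_ran[OF h] 1 B_K[OF b h]])
  have o: "openin X (dom (\<theta> g) \<inter> ran (\<theta> h))"
    using openin_dom[OF g] openin_ran[OF h] by (rule openin_Int)
  have 3: "act_fun G \<theta> g (\<lambda>y. act_fun G \<theta> (inv g) (a g) y * b h y) \<in>
      K (translate g (dom (\<theta> g) \<inter> ran (\<theta> h)))"
    by (rule K_act[OF g o _ 2]) simp
  have "translate g (dom (\<theta> g) \<inter> ran (\<theta> h)) \<subseteq> ran (\<theta> (g \<otimes> h))"
    using theta_mult[OF g h] by (auto simp: translate_def ran_def)
  then have "act_fun G \<theta> g (\<lambda>y. act_fun G \<theta> (inv g) (a g) y * b h y) \<in> K (ran (\<theta> (g \<otimes> h)))"
    using 3 g h by (intro K_mono[OF openin_translate[OF g o] openin_ran]) simp_all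
  moreover have "act_fun G \<theta> g (\<lambda>y. act_fun G \<theta> (inv g) (a g) y * b h y) = mterm a b g h"
    by (rule ext) (rule mterm_act_fun[OF g])
  ultimately show ?thesis by simp
qed

lemma mult_supp:
  assumes F: "finite F" "F \<subseteq> carrier G" "supp a \<subseteq> F" and F': "finite F'" "supp b \<subseteq> F'"
  shows "supp (amult B a b) \<subseteq> (\<lambda>(g, h). g \<otimes> h) ` (F \<times> F')"
proof
  fix k assume "k \<in> supp (amult B a b)"
  then obtain x where "amult B a b k x \<noteq> 0" by auto
  then obtain p where p: "p \<in> F \<times> F'" "(case p of (g, h) \<Rightarrow> if g \<otimes> h = k then mterm a b g h x else 0) \<noteq> 0"
    unfolding mult_eq[OF assms] by (rule sum.not_neutral_contains_not_neutral)
  then show "k \<in> (\<lambda>(g, h). g \<otimes> h) ` (F \<times> F')"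
    by (intro image_eqI[of _ _ p]) (auto split: if_splits)
qed

lemma mult_mem:
  assumes a: "a \<in> acarrier B" and b: "b \<in> acarrier B"
  shows "amult B a b \<in> acarrier B"
proof -
  note F = B_fin[OF a] B_supp[OF a] subset_refl B_fin[OF b] subset_refl
  have "amult B a b k \<in> K (ran (\<theta> k))" if k: "k \<in> carrier G" for k
  proof -
    have "amult B a b k = (\<lambda>x. \<Sum>p\<in>supp a \<times> supp b.
        (case p of (g, h) \<Rightarrow> (\<lambda>x. if g \<otimes> h = k then mterm a b g h x else 0)) x)"
      by (rule ext) (simp add: mult_eq[OF F] split_def)
    also have "\<dots> \<in> K (ran (\<theta> k))"
    proof (rule K_sum[OF openin_ran[OF k]])
      fix p assume "p \<in> supp a \<times> supp b"
      then obtain g h where p: "p = (g, h)" "g \<in> carrier G" "h \<in> carrier G"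
        using B_supp[OF a] B_supp[OF b] by auto
      show "(case p of (g, h) \<Rightarrow> \<lambda>x. if g \<otimes> h = k then mterm a b g h x else 0) \<in> K (ran (\<theta> k))"
        using mterm_K[OF a b p(2,3)] K_zero p(1) by (cases "g \<otimes> h = k") (auto simp: eta_contract_eq)
    qed (use F in simp)
    finally show ?thesis .
  qed
  moreover have "finite (supp (amult B a b))"
    using mult_supp[OF F] B_fin[OF a] B_fin[OF b] finite_subset by blast
  moreover have "(\<lambda>(g, h). g \<otimes> h) ` (supp a \<times> supp b) \<subseteq> carrier G"
    using B_supp[OF a] B_supp[OF b] by auto
  then have "supp (amult B a b) \<subseteq> carrier G"
    using mult_supp[OF F] by (rule subset_trans[rotated])
  ultimately show ?thesis by (simp add: cross_alg_simps(1))
qed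

lemma star_eq: "astar B a k x =
    (if k \<in> carrier G then (case \<theta> (inv k) x of None \<Rightarrow> 0 | Some y \<Rightarrow> cnj (a (inv k) y)) else 0)"
  by (simp add: cross_alg_simps crossed_product_algebra_def act_fun_def split: option.split)

lemma star_act_fun: "k \<in> carrier G \<Longrightarrow> astar B a k = act_fun G \<theta> k (\<lambda>y. cnj (a (inv k) y))"
  by (simp add: cross_alg_simps crossed_product_algebra_def)

lemma star_supp:
  assumes a: "a \<in> acarrier B"
  shows "supp (astar B a) \<subseteq> (\<lambda>g. inv g) ` supp a"
proof
  fix k assume "k \<in> supp (astar B a)"
  then obtain x where x: "astar B a k x \<noteq> 0" by auto
  then have "k \<in> carrier G" "a (inv k) \<noteq> (\<lambda>_. 0)"
    by (auto simp: star_eq split: if_splits option.splits)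
  then show "k \<in> (\<lambda>g. inv g) ` supp a"
    by (intro image_eqI[of _ _ "inv k"]) auto
qed

lemma star_mem:
  assumes a: "a \<in> acarrier B"
  shows "astar B a \<in> acarrier B"
proof -
  have "astar B a k \<in> K (ran (\<theta> k))" if k: "k \<in> carrier G" for k
  proof -
    have "(\<lambda>y. cnj (a (inv k) y)) \<in> K (dom (\<theta> k))"
      using B_K[OF a, of "inv k"] k openin_dom[OF k] by (intro K_cnj) (simp_all add: ran_theta_inv)
    from K_act[OF k openin_dom[OF k] subset_refl this] show ?thesis
      by (simp add: star_act_fun k translate_dom)
  qed
  moreover have "finite (supp (astar B a))"
    using star_supp[OF a] B_fin[OF a] finite_subset by blast
  moreover have "supp (astar B a) \<subseteq> carrier G"
    using star_supp[OF a] B_supp[OF a] by auto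
  ultimately show ?thesis by (simp add: cross_alg_simps(1))
qed

lemma add_mem:
  assumes a: "a \<in> acarrier B" and b: "b \<in> acarrier B"
  shows "aadd B a b \<in> acarrier B"
proof -
  have s: "supp (aadd B a b) \<subseteq> supp a \<union> supp b" by (auto simp: cross_alg_simps)
  then have "finite (supp (aadd B a b))"
    using B_fin[OF a] B_fin[OF b] finite_subset by blast
  moreover have "supp (aadd B a b) \<subseteq> carrier G"
    using s B_supp[OF a] B_supp[OF b] by blast
  moreover have "aadd B a b g \<in> K (ran (\<theta> g))" if "g \<in> carrier G" for g
    using K_add[OF openin_ran B_K[OF a] B_K[OF b]] that by (simp add: cross_alg_simps)
  ultimately show ?thesis by (simp add: cross_alg_simps(1))
qed

lemma scale_mem:
  assumes a: "a \<in> acarrier B"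
  shows "ascale B c a \<in> acarrier B"
proof -
  have s: "supp (ascale B c a) \<subseteq> supp a" by (auto simp: cross_alg_simps)
  then have "finite (supp (ascale B c a))"
    using B_fin[OF a] finite_subset by blast
  moreover have "supp (ascale B c a) \<subseteq> carrier G"
    using s B_supp[OF a] by blast
  moreover have "ascale B c a g \<in> K (ran (\<theta> g))" if "g \<in> carrier G" for g
    using K_scale[OF openin_ran B_K[OF a]] that by (simp add: cross_alg_simps)
  ultimately show ?thesis by (simp add: cross_alg_simps(1))
qed

lemma supp_add: "supp (aadd B a b) \<subseteq> supp a \<union> supp b"
  and supp_scale: "supp (ascale B c a) \<subseteq> supp a"
  by (auto simp: cross_alg_simps)

lemma star_alg_B: "star_alg B"
proof
  fix a b c r assume a: "a \<in> acarrier B" and b: "b \<in> acarrier B" and c: "c \<in> acarrier B"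
  let ?F = "supp a \<union> supp b" and ?F' = "supp c"
  note F = finite_UnI[OF B_fin[OF a] B_fin[OF b]] Un_least[OF B_supp[OF a] B_supp[OF b]]
  note F' = B_fin[OF c] B_supp[OF c]
  have s: "supp a \<subseteq> ?F" "supp b \<subseteq> ?F" "supp (aadd B a b) \<subseteq> ?F"
    using supp_add by auto
  show "amult B (aadd B a b) c = aadd B (amult B a c) (amult B b c)"
  proof (intro ext)
    fix k x
    have "mterm (aadd B a b) c g h x = mterm a c g h x + mterm b c g h x" for g h
      by (simp add: mterm_def cross_alg_simps distrib_right split: option.split)
    \<comment> \<open>Only the addition of the two products is unfolded; the sum inside the left
      factor stays folded so that \<open>mult_eq\<close> applies with the joint support.\<close>
    then show "amult B (aadd B a b) c k x = aadd B (amult B a c) (amult B b c) k x"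
      unfolding cross_alg_simps(2)[of G X \<theta> K, THEN fun_cong, THEN fun_cong, of "amult B a c"]
        mult_eq[OF F s(1) F'(1) subset_refl] mult_eq[OF F s(2) F'(1) subset_refl]
        mult_eq[OF F s(3) F'(1) subset_refl] sum.distrib[symmetric]
      by (intro sum.cong) auto
  qed
  show "amult B c (aadd B a b) = aadd B (amult B c a) (amult B c b)"
  proof (intro ext)
    fix k x
    have "mterm c (aadd B a b) g h x = mterm c a g h x + mterm c b g h x" for g h
      by (simp add: mterm_def cross_alg_simps distrib_left split: option.split)
    then show "amult B c (aadd B a b) k x = aadd B (amult B c a) (amult B c b) k x"
      unfolding cross_alg_simps(2)[of G X \<theta> K, THEN fun_cong, THEN fun_cong, of "amult B c a"]
        mult_eq[OF F' subset_refl F(1) s(1)] mult_eq[OF F' subset_refl F(1) s(2)]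
        mult_eq[OF F' subset_refl F(1) s(3)] sum.distrib[symmetric]
      by (intro sum.cong) auto
  qed
next
  fix a b r assume a: "a \<in> acarrier B" and b: "b \<in> acarrier B"
  note Fa = B_fin[OF a] B_supp[OF a]
  note Fb = B_fin[OF b] B_supp[OF b]
  show "amult B (ascale B r a) b = ascale B r (amult B a b)"
  proof (intro ext)
    fix k x
    have "mterm (ascale B r a) b g h x = r * mterm a b g h x" for g h
      by (simp add: mterm_def cross_alg_simps split: option.split)
    then show "amult B (ascale B r a) b k x = ascale B r (amult B a b) k x"
      unfolding cross_alg_simps(3)[of G X \<theta> K, THEN fun_cong, THEN fun_cong, of r "amult B a b"]
        mult_eq[OF Fa subset_refl Fb(1) subset_refl] mult_eq[OF Fa supp_scale Fb(1) subset_refl]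
        sum_distrib_left
      by (intro sum.cong) auto
  qed
  show "amult B a (ascale B r b) = ascale B r (amult B a b)"
  proof (intro ext)
    fix k x
    have "mterm a (ascale B r b) g h x = r * mterm a b g h x" for g h
      by (simp add: mterm_def cross_alg_simps split: option.split)
    then show "amult B a (ascale B r b) k x = ascale B r (amult B a b) k x"
      unfolding cross_alg_simps(3)[of G X \<theta> K, THEN fun_cong, THEN fun_cong, of r "amult B a b"]
        mult_eq[OF Fa subset_refl Fb(1) subset_refl] mult_eq[OF Fa subset_refl Fb(1) supp_scale]
        sum_distrib_left
      by (intro sum.cong) auto
  qed
  show "astar B (aadd B a b) = aadd B (astar B a) (astar B b)"
    unfolding cross_alg_simps(2)[of G X \<theta> K]
    by (intro ext) (simp add: star_eq split: option.split)
  show "astar B (ascale B r a) = ascale B (cnj r) (astar B a)"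
    unfolding cross_alg_simps(3)[of G X \<theta> K]
    by (intro ext) (simp add: star_eq split: option.split)
qed (simp_all add: add_mem scale_mem mult_mem star_mem, simp_all add: cross_alg_simps algebra_simps)

lemma supn_mterm_le:
  assumes a: "a \<in> acarrier B" and b: "b \<in> acarrier B"
  shows "cmod (mterm a b g h x) \<le> supn (a g) * supn (b h)"
  using supn_nonneg[OF B_bdd[OF a]] supn_nonneg[OF B_bdd[OF b]] supn_upper[OF B_bdd[OF a]]
    supn_upper[OF B_bdd[OF b]]
  by (auto simp: mterm_def norm_mult intro!: mult_mono split: option.split)

lemma star_involutive:
  assumes a: "a \<in> acarrier B"
  shows "astar B (astar B a) = a"
proof (intro ext)
  fix k x
  show "astar B (astar B a) k x = a k x"
  proof (cases "k \<in> carrier G")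
    case True
    then show ?thesis
    proof (cases "\<theta> (inv k) x")
      case None
      then show ?thesis using True B_outside[OF a True None] by (simp add: star_eq)
    next
      case (Some y)
      then have "\<theta> k y = Some x" using True by (simp add: theta_inv_iff)
      then show ?thesis using True Some by (simp add: star_eq)
    qed
  next
    case False
    then have "a k = (\<lambda>_. 0)" using B_supp[OF a] by blast
    then show ?thesis using False by (simp add: star_eq)
  qed
qed

text \<open>The star moves the coefficient at g to the inverse of g and translates it, which does
  not increase suprema. Equality then follows by applying the inequality to the star, since the star
  is involutive.\<close>

lemma l1_norm_star_le:
  assumes a: "a \<in> acarrier B"
  shows "l1_norm (astar B a) \<le> l1_norm a"
proof -
  have "l1_norm (astar B a) = (\<Sum>k\<in>(\<lambda>g. inv g) ` supp a. supn (astar B a k))"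
    using B_fin[OF a] star_supp[OF a] by (intro l1_norm_eq) auto
  also have "\<dots> = (\<Sum>g\<in>supp a. supn (astar B a (inv g)))"
    using B_supp[OF a] by (intro sum.reindex_cong[OF _ HOL.refl HOL.refl]) (auto intro!: inj_onI inv_inj[THEN inj_onD])
  also have "\<dots> \<le> (\<Sum>g\<in>supp a. supn (a g))"
  proof (rule sum_mono)
    fix g assume "g \<in> supp a"
    then have g: "g \<in> carrier G" using B_supp[OF a] by auto
    have "bdd_above (range (\<lambda>x. cmod (cnj (a g x))))" using B_bdd[OF a, of g] by simp
    from supn_act_fun_le[OF this, of "inv g"] show "supn (astar B a (inv g)) \<le> supn (a g)"
      using g by (simp add: star_act_fun)
  qed
  finally show ?thesis by (simp add: l1_norm_def)
qed

lemma seminormed_B: "seminormed_star_alg B l1_norm"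
proof (intro seminormed_star_alg.intro star_alg_B seminormed_star_alg_axioms.intro)
  fix a b c assume a: "a \<in> acarrier B"
  show "0 \<le> l1_norm a"
    unfolding l1_norm_def by (intro sum_nonneg supn_nonneg B_bdd[OF a])
  show "l1_norm (ascale B c a) = cmod c * l1_norm a"
    unfolding l1_norm_eq[OF B_fin[OF a] supp_scale] l1_norm_eq[OF B_fin[OF a] subset_refl]
      sum_distrib_left
    by (intro sum.cong) (simp_all add: cross_alg_simps supn_scale B_bdd[OF a])
  show "l1_norm (astar B a) = l1_norm a"
    using l1_norm_star_le[OF a] l1_norm_star_le[OF star_mem[OF a]] by (simp add: star_involutive[OF a])
  assume b: "b \<in> acarrier B"
  have F: "finite (supp a \<union> supp b)" using B_fin[OF a] B_fin[OF b] by simp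
  show "l1_norm (aadd B a b) \<le> l1_norm a + l1_norm b"
    unfolding l1_norm_eq[OF F supp_add] l1_norm_eq[OF F Un_upper1] l1_norm_eq[OF F Un_upper2]
      sum.distrib[symmetric]
    by (intro sum_mono) (simp add: cross_alg_simps supn_add B_bdd[OF a] B_bdd[OF b])
  note FF = B_fin[OF a] B_supp[OF a] subset_refl B_fin[OF b] subset_refl
  let ?P = "supp a \<times> supp b" and ?w = "\<lambda>(g, h). supn (a g) * supn (b h)"
  let ?M = "(\<lambda>(g, h). g \<otimes> h) ` ?P"
  have fin: "finite ?P" "finite ?M" using FF by auto
  have "l1_norm (amult B a b) = (\<Sum>k\<in>?M. supn (amult B a b k))"
    by (rule l1_norm_eq[OF fin(2) mult_supp[OF FF]])
  \<comment> \<open>Each pair (g, h) contributes at the single index k = g h. After exchanging the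
    sums every pair is counted once, and the total factors into the product of the two
    norms.\<close>
  also have "\<dots> \<le> (\<Sum>k\<in>?M. \<Sum>p\<in>?P. if (case p of (g, h) \<Rightarrow> g \<otimes> h) = k then ?w p else 0)"
  proof (intro sum_mono supn_least)
    fix k x
    show "cmod (amult B a b k x) \<le> (\<Sum>p\<in>?P. if (case p of (g, h) \<Rightarrow> g \<otimes> h) = k then ?w p else 0)"
      unfolding mult_eq[OF FF]
      by (intro sum_norm_le) (auto simp: supn_mterm_le[OF a b])
  qed
  also have "\<dots> = (\<Sum>p\<in>?P. \<Sum>k\<in>?M. if (case p of (g, h) \<Rightarrow> g \<otimes> h) = k then ?w p else 0)"
    by (rule sum.swap)
  also have "\<dots> = (\<Sum>p\<in>?P. ?w p)"
    using fin by (intro sum.cong HOL.refl) (auto simp: sum.delta)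
  also have "\<dots> = l1_norm a * l1_norm b"
    by (simp add: l1_norm_def sum_product sum.cartesian_product)
  finally show "l1_norm (amult B a b) \<le> l1_norm a * l1_norm b" .
qed

end

section \<open>Domination of all C*-seminorms by the l1-norm\<close>

context partial_act
begin

lemma act_fun_one:
  assumes "\<And>x. x \<notin> topspace X \<Longrightarrow> f x = 0"
  shows "act_fun G \<theta> \<one> f = f"
  using assms by (auto simp: act_fun_def theta_one restrict_map_def)

end

context function_family
begin

definition delta :: "'g \<Rightarrow> ('x \<Rightarrow> complex) \<Rightarrow> 'g \<Rightarrow> 'x \<Rightarrow> complex" where
  "delta g f = (\<lambda>k. if k = g then f else (\<lambda>_. 0))"

lemma delta_same [simp]: "delta g f g = f"
  by (simp add: delta_def)

lemma supp_delta: "supp (delta g f) \<subseteq> {g}"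
  by (auto simp: delta_def)

lemma delta_mem:
  assumes "g \<in> carrier G" "f \<in> K (ran (\<theta> g))"
  shows "delta g f \<in> acarrier B"
proof -
  have "finite (supp (delta g f))" using supp_delta finite_subset by blast
  moreover have "supp (delta g f) \<subseteq> carrier G" using supp_delta assms(1) by blast
  ultimately show ?thesis
    using assms K_zero by (simp add: cross_alg_simps(1)) (simp add: delta_def)
qed

lemma delta_star:
  assumes "g \<in> carrier G"
  shows "astar B (delta g f) = delta (inv g) (act_fun G \<theta> (inv g) (\<lambda>y. cnj (f y)))"
proof
  fix k
  show "astar B (delta g f) k = delta (inv g) (act_fun G \<theta> (inv g) (\<lambda>y. cnj (f y))) k"
  proof (cases "k = inv g")
    case True
    then show ?thesis using assms by (simp add: star_act_fun)
  next
    case False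
    then have "k \<in> carrier G \<Longrightarrow> inv k \<noteq> g" using assms by auto
    then show ?thesis
      using False by (auto simp: delta_def star_eq fun_eq_iff split: option.split)
  qed
qed

lemma delta_mult:
  assumes "g \<in> carrier G" "h \<in> carrier G"
  shows "amult B (delta g f) (delta h f') =
    delta (g \<otimes> h) (\<lambda>x. case \<theta> (inv g) x of None \<Rightarrow> 0 | Some y \<Rightarrow> f x * f' y)"
  by (intro ext, subst mult_eq[where F = "{g}" and F' = "{h}"])
    (use assms supp_delta in \<open>auto simp: delta_def mterm_def\<close>)

text \<open>The product lies over the identity and its coefficient is the translate of |f|^2.
  Through the C*-identity this reduces seminorms of f\<delta>_g to functions on the space.\<close>

lemma delta_star_mult:
  assumes g: "g \<in> carrier G"
  shows "amult B (astar B (delta g f)) (delta g f) =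
    delta \<one> (act_fun G \<theta> (inv g) (\<lambda>y. cnj (f y) * f y))"
proof -
  have "(case \<theta> (inv (inv g)) x of None \<Rightarrow> 0
      | Some y \<Rightarrow> act_fun G \<theta> (inv g) (\<lambda>y. cnj (f y)) x * f y) =
    act_fun G \<theta> (inv g) (\<lambda>y. cnj (f y) * f y) x" for x
    by (simp add: act_fun_def split: option.split)
  then show ?thesis
    using g by (simp add: delta_star delta_mult)
qed

text \<open>For real \<open>f\<close> with \<open>\<bar>f\<bar> \<le> 1\<close> the function \<open>u = f + \<i> \<surd>(1 - f\<^sup>2)\<close> is unimodular, so that
  \<open>f u\<close> and \<open>f \<cdot> cnj u\<close> have the same seminorm as \<open>f\<close>, while \<open>f\<^sup>2\<close> is their mean. Hence
  \<open>p(f)\<^sup>2 = p(f\<^sup>2) \<le> p(f)\<close>; no continuity of \<open>p\<close> is needed.\<close>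

lemma cstar_seminorm_delta_real:
  assumes p: "cstar_seminorm B p" and f: "f \<in> K (topspace X)"
    and real: "\<And>x. f x = of_real (Re (f x))" and le: "\<And>x. cmod (f x) \<le> 1"
  shows "p (delta \<one> f) \<le> 1"
proof -
  have mem: "delta \<one> f \<in> acarrier B" if "f \<in> K (topspace X)" for f
    using that by (intro delta_mem) (simp_all add: ran_theta_one)
  have sq: "(p (delta \<one> f))\<^sup>2 = p (delta \<one> (\<lambda>y. cnj (f y) * f y))" if f: "f \<in> K (topspace X)" for f
  proof -
    have "\<And>x. x \<notin> topspace X \<Longrightarrow> f x = 0"
      using K_C0[OF _ f] by (auto simp: C0_on_def)
    then have "act_fun G \<theta> \<one> (\<lambda>y. cnj (f y) * f y) = (\<lambda>y. cnj (f y) * f y)"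
      by (intro act_fun_one) simp
    then show ?thesis
      using cstar_seminormD(3)[OF p mem[OF f]] delta_star_mult[OF one_closed, of f] by simp
  qed
  \<comment> \<open>The real square root of HOL is defined and continuous on all reals, negative
    ones included, so c is continuous on the whole plane. On the values of f the radicand is
    non-negative and c has modulus 1.\<close>
  define c where "c z = complex_of_real (Re z) + \<i> * complex_of_real (sqrt (1 - (Re z)\<^sup>2))" for z
  define u where "u x = c (f x)" for x
  have "continuous_on UNIV c" "continuous_on UNIV (\<lambda>z. cnj (c z))"
    unfolding c_def by (intro continuous_intros)+
  moreover have fc: "continuous_map X euclidean f"
    using C0_on_continuous_map[OF Hausdorff_X _ K_C0[OF _ f]] by simp
  ultimately have u: "continuous_map X euclidean u" "continuous_map X euclidean (\<lambda>x. cnj (u x))"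
    using continuous_map_compose_continuous_on[OF fc, of c]
      continuous_map_compose_continuous_on[OF fc, of "\<lambda>z. cnj (c z)"]
    unfolding u_def by simp_all
  have Re1: "\<bar>Re (f x)\<bar> \<le> 1" for x
    using le[of x] abs_Re_le_cmod order_trans by blast
  then have Re2: "(Re (f x))\<^sup>2 \<le> 1" for x
    by (simp add: abs_square_le_1)
  have unit: "cnj (u x) * u x = 1" for x
  proof -
    have "cnj (u x) * u x = complex_of_real ((Re (f x))\<^sup>2 + (sqrt (1 - (Re (f x))\<^sup>2))\<^sup>2)"
      by (simp add: u_def c_def complex_eq_iff power2_eq_square)
    also have "\<dots> = 1" using Re2[of x] by simp
    finally show ?thesis .
  qed
  then have "(cmod (u x))\<^sup>2 = 1" for x
    by (metis complex_norm_square mult.commute of_real_eq_1_iff)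
  then have norm_u: "cmod (u x) \<le> 1" for x
    by (metis norm_ge_zero one_power2 order_refl power2_eq_imp_eq zero_le_one)
  let ?v = "\<lambda>x. f x * u x" and ?w = "\<lambda>x. f x * cnj (u x)"
  have v: "?v \<in> K (topspace X)" and w: "?w \<in> K (topspace X)"
    using u norm_u by (auto intro!: K_mult_bounded[where M = 1] f)
  have "(\<lambda>y. cnj (?v y) * ?v y) = (\<lambda>y. cnj (f y) * f y)"
    "(\<lambda>y. cnj (?w y) * ?w y) = (\<lambda>y. cnj (f y) * f y)"
    using unit by (simp_all add: fun_eq_iff algebra_simps)
  then have "(p (delta \<one> ?v))\<^sup>2 = (p (delta \<one> f))\<^sup>2" "(p (delta \<one> ?w))\<^sup>2 = (p (delta \<one> f))\<^sup>2"
    using sq[OF f] sq[OF v] sq[OF w] by simp_all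
  then have eq: "p (delta \<one> ?v) = p (delta \<one> f)" "p (delta \<one> ?w) = p (delta \<one> f)"
    using cstar_seminormD(1)[OF p mem[OF f]] cstar_seminormD(1)[OF p mem[OF v]]
      cstar_seminormD(1)[OF p mem[OF w]] by (simp_all add: power2_eq_iff_nonneg)
  have "u x + cnj (u x) = 2 * f x" for x
    using real[of x] by (simp add: u_def c_def complex_eq_iff)
  then have "f x * u x + f x * cnj (u x) = 2 * (f x * f x)" for x
    by (metis distrib_left mult.left_commute)
  moreover have "cnj (f x) = f x" for x
    using real[of x] by (metis complex_cnj_complex_of_real)
  ultimately have "delta \<one> (\<lambda>y. cnj (f y) * f y) =
      ascale B (1 / 2) (aadd B (delta \<one> ?v) (delta \<one> ?w))"
    by (auto simp: fun_eq_iff delta_def cross_alg_simps)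
  then have "(p (delta \<one> f))\<^sup>2 = 1 / 2 * p (aadd B (delta \<one> ?v) (delta \<one> ?w))"
    using sq[OF f] cstar_seminormD(4)[OF p add_mem[OF mem[OF v] mem[OF w]], of "1 / 2"] by simp
  also have "\<dots> \<le> p (delta \<one> f)"
    using cstar_seminormD(5)[OF p mem[OF v] mem[OF w]] eq by simp
  finally have "p (delta \<one> f) * p (delta \<one> f) \<le> 1 * p (delta \<one> f)"
    by (simp add: power2_eq_square)
  then show ?thesis
    using cstar_seminormD(1)[OF p mem[OF f]]
    by (cases "p (delta \<one> f) = 0") (auto simp: mult_le_cancel_right)
qed

text \<open>Rescaling reduces to the bound 1. As M may be zero, the division is by M + \<epsilon>,
  and \<epsilon> tends to 0 at the end.\<close>

lemma cstar_seminorm_delta_nonneg: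
  assumes p: "cstar_seminorm B p" and f: "f \<in> K (topspace X)"
    and real: "\<And>x. f x = of_real (Re (f x))" and le: "\<And>x. cmod (f x) \<le> M"
  shows "p (delta \<one> f) \<le> M"
proof -
  have mem: "delta \<one> f \<in> acarrier B" if "f \<in> K (topspace X)" for f
    using that by (intro delta_mem) (simp_all add: ran_theta_one)
  have "M \<ge> 0" using le[of undefined] norm_ge_zero order_trans by blast
  have *: "p (delta \<one> f) \<le> N" if N: "N > 0" "N \<ge> M" for N
  proof -
    let ?f = "\<lambda>x. complex_of_real (1 / N) * f x"
    have K: "?f \<in> K (topspace X)" by (rule K_scale) (simp_all add: f)
    have "?f x = of_real (Re (?f x))" for x
    proof -
      obtain r where "f x = of_real r" using real by blast
      then show ?thesis by simp
    qed
    moreover have "cmod (?f x) \<le> 1" for x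
    proof -
      have "cmod (f x) \<le> N" using le[of x] N by linarith
      then show ?thesis using N(1) by (simp add: norm_mult norm_divide)
    qed
    ultimately have "p (delta \<one> ?f) \<le> 1"
      by (intro cstar_seminorm_delta_real[OF p K])
    moreover have "delta \<one> f = ascale B (of_real N) (delta \<one> ?f)"
      using N(1) by (auto simp: fun_eq_iff delta_def cross_alg_simps)
    then have "p (delta \<one> f) = N * p (delta \<one> ?f)"
      using cstar_seminormD(4)[OF p mem[OF K], of "of_real N"] N(1) by simp
    ultimately show ?thesis using N(1) mult_left_mono[of "p (delta \<one> ?f)" 1 N] by simp
  qed
  show ?thesis
  proof (rule field_le_epsilon)
    fix \<epsilon> :: real assume "\<epsilon> > 0"
    then show "p (delta \<one> f) \<le> M + \<epsilon>" using \<open>M \<ge> 0\<close> by (intro *) auto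
  qed
qed

text \<open>By the C*-identity the square of the left side is the seminorm of the translate of |f|^2
  over the identity, a real function bounded by the square of the supremum.\<close>

lemma cstar_seminorm_delta_le:
  assumes p: "cstar_seminorm B p" and g: "g \<in> carrier G" and f: "f \<in> K (ran (\<theta> g))"
  shows "p (delta g f) \<le> supn f"
proof -
  let ?F = "act_fun G \<theta> (inv g) (\<lambda>y. cnj (f y) * f y)"
  have mem: "delta g f \<in> acarrier B" using g f by (rule delta_mem)
  have "bdd_above (range (\<lambda>x. cmod (f x)))"
    using B_bdd[OF mem, of g] by simp
  note upper = supn_upper[OF this] and nonneg = supn_nonneg[OF this]
  have "delta \<one> ?F \<in> acarrier B"
    using mult_mem[OF star_mem[OF mem] mem] by (simp add: delta_star_mult[OF g])
  from B_K[OF this one_closed] have K: "?F \<in> K (topspace X)"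
    by (simp add: ran_theta_one)
  have sq: "cnj z * z = complex_of_real ((cmod z)\<^sup>2)" for z
    by (metis complex_norm_square mult.commute)
  have "p (delta \<one> ?F) \<le> (supn f)\<^sup>2"
  proof (rule cstar_seminorm_delta_nonneg[OF p K])
    fix x
    show "?F x = of_real (Re (?F x))"
      unfolding sq by (simp add: act_fun_def split: option.split)
    show "cmod (?F x) \<le> (supn f)\<^sup>2"
      unfolding sq using upper nonneg
      by (simp add: act_fun_def power_mono norm_power split: option.split)
  qed
  then have "(p (delta g f))\<^sup>2 \<le> (supn f)\<^sup>2"
    using cstar_seminormD(3)[OF p mem] by (simp add: delta_star_mult[OF g])
  then show ?thesis using nonneg by (rule power2_le_imp_le)
qed

lemma cstar_seminorm_le_l1_norm:
  assumes p: "cstar_seminorm B p" and a: "a \<in> acarrier B"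
  shows "p a \<le> l1_norm a"
proof -
  have "p b \<le> (\<Sum>g\<in>F. supn (b g))" if "finite F" "F \<subseteq> carrier G" "b \<in> acarrier B" "supp b \<subseteq> F" for F b
    using that
  proof (induction F arbitrary: b rule: finite_induct)
    case empty
    \<comment> \<open>An element with empty support is zero; homogeneity gives seminorm zero once it
      is written as a multiple of itself by 0.\<close>
    then have "b = ascale B 0 b" by (auto simp: cross_alg_simps fun_eq_iff)
    then show ?case using cstar_seminormD(4)[OF p empty.prems(2), of 0] by simp
  next
    case (insert g F)
    have g: "g \<in> carrier G" using insert.prems by simp
    let ?c = "b(g := (\<lambda>_. 0))"
    have s: "supp ?c \<subseteq> F" using insert.prems(3) by auto
    moreover have "finite (supp ?c)" using s insert.hyps(1) finite_subset by blast
    ultimately have c: "?c \<in> acarrier B"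
      using insert.prems(1,2) K_zero unfolding cross_alg_simps(1) by auto
    have d: "delta g (b g) \<in> acarrier B" by (rule delta_mem[OF g B_K[OF insert.prems(2) g]])
    have "b = aadd B ?c (delta g (b g))"
      by (auto simp: cross_alg_simps fun_eq_iff delta_def)
    then have "p b \<le> p ?c + p (delta g (b g))"
      using cstar_seminormD(5)[OF p c d] by simp
    also have "\<dots> \<le> (\<Sum>h\<in>F. supn (?c h)) + supn (b g)"
      using insert.prems(1)
      by (intro add_mono insert.IH[OF _ c s] cstar_seminorm_delta_le[OF p g B_K[OF insert.prems(2) g]]) simp
    also have "(\<Sum>h\<in>F. supn (?c h)) = (\<Sum>h\<in>F. supn (b h))"
      using insert.hyps(2) by (intro sum.cong) auto
    finally show ?case using insert.hyps by simp
  qed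
  from this[OF B_fin[OF a] B_supp[OF a] a] show ?thesis by (simp add: l1_norm_def)
qed

end

section \<open>Continuous and compactly supported coefficients\<close>

context partial_act
begin

sublocale C0: function_family G X \<theta> "C0_on X"
proof
  show "\<And>U. (\<lambda>_. 0) \<in> C0_on X U" by (rule C0_on_zero)
qed (auto intro: C0_on_add C0_on_mult_bounded C0_on_mult C0_on_cnj C0_on_mono act_fun_C0 Hausdorff_X)

sublocale Cc: function_family G X \<theta> "Cc_on X"
proof
  show "\<And>U. (\<lambda>_. 0) \<in> Cc_on X U" by (rule Cc_on_zero)
qed (auto intro: Cc_on_add Cc_on_mult_continuous Cc_on_mult Cc_on_cnj Cc_on_mono act_fun_Cc Hausdorff_X
      subsetD[OF Cc_on_subset_C0_on])

lemma Cc_subset_C0: "a \<in> acarrier Cc.B \<Longrightarrow> a \<in> acarrier C0.B"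
  using Cc_on_subset_C0_on[of X] by (auto simp: cross_alg_simps(1))

lemma Cc_dense:
  assumes b: "b \<in> acarrier C0.B" and "\<epsilon> > 0"
  shows "\<exists>a\<in>acarrier Cc.B. pdist C0.B l1_norm b a < \<epsilon>"
proof -
  let ?S = "{g. b g \<noteq> (\<lambda>_. 0)}"
  \<comment> \<open>The allowance is shared among the non-zero coefficients. The additional 1 covers
    an empty support and makes the final inequality strict.\<close>
  define \<delta> where "\<delta> = \<epsilon> / (real (card ?S) + 1)"
  have \<delta>: "\<delta> > 0" using \<open>\<epsilon> > 0\<close> by (simp add: \<delta>_def)
  have "\<exists>f. f \<in> Cc_on X (ran (\<theta> g)) \<and> (\<forall>x. cmod (b g x - f x) \<le> \<delta>)" if g: "g \<in> carrier G" for g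
    using Cc_on_approx[OF Hausdorff_X openin_ran[OF g] C0.B_K[OF b g] \<delta>] by metis
  then obtain f where f: "\<And>g. g \<in> carrier G \<Longrightarrow> f g \<in> Cc_on X (ran (\<theta> g))"
    "\<And>g x. g \<in> carrier G \<Longrightarrow> cmod (b g x - f g x) \<le> \<delta>"
    by metis
  define a where "a g = (if g \<in> ?S then f g else (\<lambda>_. 0))" for g
  have "{g. a g \<noteq> (\<lambda>_. 0)} \<subseteq> ?S" by (auto simp: a_def)
  moreover from this have "finite {g. a g \<noteq> (\<lambda>_. 0)}" using C0.B_fin[OF b] finite_subset by blast
  ultimately have a: "a \<in> acarrier Cc.B"
    using C0.B_supp[OF b] f(1) Cc_on_zero by (auto simp: cross_alg_simps(1) a_def)
  let ?d = "\<lambda>g x. b g x - a g x"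
  have "pdist C0.B l1_norm b a = l1_norm ?d"
    by (simp add: pdist_def cross_alg_simps)
  also have "\<dots> = (\<Sum>g\<in>?S. supn (?d g))"
    by (rule l1_norm_eq[OF C0.B_fin[OF b]]) (auto simp: a_def)
  also have "\<dots> \<le> (\<Sum>g\<in>?S. \<delta>)"
    using f(2) C0.B_supp[OF b] by (intro sum_mono supn_least) (auto simp: a_def)
  also have "\<dots> = \<epsilon> * (real (card ?S) / (real (card ?S) + 1))"
    by (simp add: \<delta>_def)
  also have "\<dots> < \<epsilon> * 1"
    using \<open>\<epsilon> > 0\<close> by (intro mult_strict_left_mono) (auto simp: divide_less_eq_1)
  finally show ?thesis using a by auto
qed

end

section \<open>The convolution algebra of a transformation groupoid\<close>

text \<open>In a Hausdorff space extension by zero embeds each Cc(U) into Cc of the whole space,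
  which is closed under sums; conversely one summand with U the whole space suffices.\<close>

lemma Cc_span_Hausdorff:
  assumes Y: "Hausdorff_space Y"
  shows "Cc_span Y = Cc_on Y (topspace Y)"
proof (intro equalityI subsetI)
  fix f assume "f \<in> Cc_span Y"
  then obtain n F where f: "f = (\<lambda>x. \<Sum>i<(n::nat). F i x)"
    and F: "\<forall>i<n. \<exists>U. openin Y U \<and> Hausdorff_space (subtopology Y U) \<and> F i \<in> Cc_on Y U"
    by (auto simp: Cc_span_def)
  have F': "F i \<in> Cc_on Y (topspace Y)" if "i < n" for i
  proof -
    obtain U where U: "openin Y U" "F i \<in> Cc_on Y U" using F \<open>i < n\<close> by blast
    show ?thesis by (rule Cc_on_mono[OF Y U(1) openin_topspace openin_subset[OF U(1)] U(2)])
  qed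
  have "m \<le> n \<Longrightarrow> (\<lambda>x. \<Sum>i<m. F i x) \<in> Cc_on Y (topspace Y)" for m
  proof (induction m)
    case (Suc m)
    then show ?case using Cc_on_add[OF Y openin_topspace _ F', of "\<lambda>x. \<Sum>i<m. F i x" m] by simp
  qed (simp add: Cc_on_zero)
  then show "f \<in> Cc_on Y (topspace Y)" using f by blast
next
  fix f assume f: "f \<in> Cc_on Y (topspace Y)"
  have "f = (\<lambda>x. \<Sum>i<(1::nat). f x)" by simp
  moreover have "\<exists>U. openin Y U \<and> Hausdorff_space (subtopology Y U) \<and> f \<in> Cc_on Y U"
    using f Y by (intro exI[of _ "topspace Y"]) simp
  ultimately show "f \<in> Cc_span Y"
    unfolding Cc_span_def by (intro CollectI exI[of _ 1] exI[of _ "\<lambda>_. f"]) simp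
qed

text \<open>Convolution sees arrows only, so objects enter just through composability. It is
  required as an equivalence: the factorizations of an arrow must correspond exactly, with none lost
  and none added.\<close>

locale transformation_groupoid_iso = partial_act G X \<theta>
  for G :: "('g, 'm) monoid_scheme" (structure) and X :: "'x topology" and \<theta> +
  fixes P :: "('a, 'y) top_groupoid" and \<Phi> :: "'a \<Rightarrow> 'g \<times> 'x" and \<Psi> :: "'g \<times> 'x \<Rightarrow> 'a"
  assumes homeo: "homeomorphic_maps (arrow_top P) (arrow_top (transformation_groupoid G X \<theta>)) \<Phi> \<Psi>"
    and composable: "\<alpha> \<in> topspace (arrow_top P) \<Longrightarrow> \<beta> \<in> topspace (arrow_top P) \<Longrightarrow>
      gdom P \<alpha> = gran P \<beta> \<longleftrightarrow>
      gdom (transformation_groupoid G X \<theta>) (\<Phi> \<alpha>) = gran (transformation_groupoid G X \<theta>) (\<Phi> \<beta>)"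
    and gmul_closed: "\<alpha> \<in> topspace (arrow_top P) \<Longrightarrow> \<beta> \<in> topspace (arrow_top P) \<Longrightarrow>
      gdom P \<alpha> = gran P \<beta> \<Longrightarrow> gmul P \<alpha> \<beta> \<in> topspace (arrow_top P)"
    and gmul_hom: "\<alpha> \<in> topspace (arrow_top P) \<Longrightarrow> \<beta> \<in> topspace (arrow_top P) \<Longrightarrow>
      gdom P \<alpha> = gran P \<beta> \<Longrightarrow>
      \<Phi> (gmul P \<alpha> \<beta>) = gmul (transformation_groupoid G X \<theta>) (\<Phi> \<alpha>) (\<Phi> \<beta>)"
    and ginv_closed: "\<alpha> \<in> topspace (arrow_top P) \<Longrightarrow> ginv P \<alpha> \<in> topspace (arrow_top P)"
    and ginv_hom: "\<alpha> \<in> topspace (arrow_top P) \<Longrightarrow>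
      \<Phi> (ginv P \<alpha>) = ginv (transformation_groupoid G X \<theta>) (\<Phi> \<alpha>)"
begin

abbreviation "W \<equiv> transformation_groupoid G X \<theta>"
abbreviation "Y \<equiv> arrow_top P"

lemma topspace_W: "(g, y) \<in> topspace (arrow_top W) \<longleftrightarrow> g \<in> carrier G \<and> (\<exists>x. \<theta> g y = Some x)"
  using theta_topspace(1)[of g y] by (auto simp: transformation_groupoid_def)

lemma cont_\<Phi>: "continuous_map Y (arrow_top W) \<Phi>" and cont_\<Psi>: "continuous_map (arrow_top W) Y \<Psi>"
  and \<Psi>\<Phi>: "\<alpha> \<in> topspace Y \<Longrightarrow> \<Psi> (\<Phi> \<alpha>) = \<alpha>"
  and \<Phi>\<Psi>: "p \<in> topspace (arrow_top W) \<Longrightarrow> \<Phi> (\<Psi> p) = p"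
  using homeo by (auto simp: homeomorphic_maps_def)

lemma \<Psi>_mem: "g \<in> carrier G \<Longrightarrow> \<theta> g y = Some x \<Longrightarrow> \<Psi> (g, y) \<in> topspace Y"
  and \<Phi>_\<Psi>: "g \<in> carrier G \<Longrightarrow> \<theta> g y = Some x \<Longrightarrow> \<Phi> (\<Psi> (g, y)) = (g, y)"
  using \<Phi>\<Psi>[of "(g, y)"] continuous_map_image_subset_topspace[OF cont_\<Psi>] topspace_W[of g y] by auto

lemma \<Phi>_cases:
  assumes "\<alpha> \<in> topspace Y"
  obtains g y x where "\<Phi> \<alpha> = (g, y)" "g \<in> carrier G" "\<theta> g y = Some x" "\<alpha> = \<Psi> (g, y)"
proof -
  have "\<Phi> \<alpha> \<in> topspace (arrow_top W)"
    using continuous_map_image_subset_topspace[OF cont_\<Phi>] assms by blast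
  then show ?thesis
    using that \<Psi>\<Phi>[OF assms] by (cases "\<Phi> \<alpha>") (auto simp: topspace_W)
qed

lemma Hausdorff_W: "Hausdorff_space (arrow_top W)"
  unfolding transformation_groupoid_def
  by (simp add: Hausdorff_space_subtopology Hausdorff_space_prod_topology Hausdorff_X)

lemma Hausdorff_Y: "Hausdorff_space Y"
  using Hausdorff_W homeo homeomorphic_Hausdorff_space homeomorphic_space_def by blast

text \<open>The coefficient at g is a function on the range of g, whereas arrows are labelled by
  their source. Hence the value at x is that of f at the arrow (g, y) with g y = x.\<close>

definition arrow_coeffs :: "('a \<Rightarrow> complex) \<Rightarrow> 'g \<Rightarrow> 'x \<Rightarrow> complex" where
  "arrow_coeffs f g x = (if g \<in> carrier G then
     (case \<theta> (inv g) x of None \<Rightarrow> 0 | Some y \<Rightarrow> f (\<Psi> (g, y))) else 0)"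

abbreviation "A \<equiv> convolution_algebra P"

lemma A_carrier: "acarrier A = Cc_on Y (topspace Y)"
  by (simp add: convolution_algebra_def Cc_span_Hausdorff[OF Hausdorff_Y])

lemma arrow_coeffs_Some:
  "g \<in> carrier G \<Longrightarrow> \<theta> g y = Some x \<Longrightarrow> arrow_coeffs f g x = f (\<Psi> (g, y))"
  using theta_inv_iff[of g x y] by (simp add: arrow_coeffs_def)

lemma arrow_coeffs_nonzero:
  assumes "arrow_coeffs f g x \<noteq> 0"
  obtains y where "g \<in> carrier G" "\<theta> g y = Some x" "f (\<Psi> (g, y)) \<noteq> 0"
proof -
  from assms have g: "g \<in> carrier G" by (auto simp: arrow_coeffs_def split: if_splits)
  with assms obtain y where "\<theta> (inv g) x = Some y" "f (\<Psi> (g, y)) \<noteq> 0"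
    by (auto simp: arrow_coeffs_def split: option.splits)
  then show ?thesis using that[of y] g by (simp add: theta_inv_iff)
qed

lemma arrow_coeffs_mem:
  assumes "f \<in> acarrier A"
  shows "arrow_coeffs f \<in> acarrier Cc.B"
proof -
  let ?prod = "prod_topology (discrete_topology (carrier G)) X"
  have fc: "continuous_map Y euclidean f"
    using assms Cc_on_iff[OF Hausdorff_Y openin_topspace] unfolding A_carrier by blast
  obtain K where K: "compactin Y K" "K \<subseteq> topspace Y" "\<And>\<alpha>. \<alpha> \<notin> K \<Longrightarrow> f \<alpha> = 0"
    using assms unfolding A_carrier Cc_on_def by blast
  have "compactin (arrow_top W) (\<Phi> ` K)" by (rule image_compactin[OF K(1) cont_\<Phi>])
  then have K': "compactin ?prod (\<Phi> ` K)"
    by (simp add: transformation_groupoid_def compactin_subtopology)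
  have mem: "(g, y) \<in> \<Phi> ` K" if "g \<in> carrier G" "\<theta> g y = Some x" "f (\<Psi> (g, y)) \<noteq> 0" for g y x
  proof -
    have "\<Psi> (g, y) \<in> K" using K(3) that(3) by blast
    then show ?thesis using \<Phi>_\<Psi>[OF that(1,2)] by (metis image_eqI)
  qed
  \<comment> \<open>The group is discrete, so the compact support of f meets only finitely many
    group elements.\<close>
  have "compactin (discrete_topology (carrier G)) (fst ` \<Phi> ` K)"
    by (rule image_compactin[OF K' continuous_map_fst])
  then have fin: "finite (fst ` \<Phi> ` K)" by (simp add: compactin_discrete_topology)
  have sub: "{g. arrow_coeffs f g \<noteq> (\<lambda>_. 0)} \<subseteq> fst ` \<Phi> ` K"
  proof
    fix g assume "g \<in> {g. arrow_coeffs f g \<noteq> (\<lambda>_. 0)}"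
    then obtain x where "arrow_coeffs f g x \<noteq> 0" by auto
    then obtain y where "g \<in> carrier G" "\<theta> g y = Some x" "f (\<Psi> (g, y)) \<noteq> 0"
      by (rule arrow_coeffs_nonzero)
    from mem[OF this] show "g \<in> fst ` \<Phi> ` K" by (metis fst_conv image_eqI)
  qed
  have comp: "arrow_coeffs f g \<in> Cc_on X (ran (\<theta> g))" if g: "g \<in> carrier G" for g
  proof -
    \<comment> \<open>The slice of f over g, labelled by sources. It has compact support in the
      domain of g, and the action of g moves it to the range, where it becomes the
      coefficient.\<close>
    define F where "F y = (if y \<in> dom (\<theta> g) then f (\<Psi> (g, y)) else 0)" for y
    have "continuous_map (subtopology X (dom (\<theta> g))) ?prod (\<lambda>y. (g, y))"
      by (intro continuous_map_pairedI) (auto simp: g)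
    then have "continuous_map (subtopology X (dom (\<theta> g))) (arrow_top W) (\<lambda>y. (g, y))"
      using g by (auto simp: transformation_groupoid_def continuous_map_in_subtopology)
    from continuous_map_compose[OF continuous_map_compose[OF this cont_\<Psi>] fc]
    have "continuous_map (subtopology X (dom (\<theta> g))) euclidean F"
      by (rule continuous_map_eq) (auto simp: F_def)
    moreover have "compactin X (snd ` (\<Phi> ` K \<inter> {g} \<times> topspace X))"
    proof (rule image_compactin[OF compact_Int_closedin[OF K'] continuous_map_snd])
      show "closedin ?prod ({g} \<times> topspace X)"
        using g by (simp add: closedin_prod_Times_iff)
    qed
    moreover have "snd ` (\<Phi> ` K \<inter> {g} \<times> topspace X) \<subseteq> dom (\<theta> g)"
    proof
      fix y assume "y \<in> snd ` (\<Phi> ` K \<inter> {g} \<times> topspace X)"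
      then obtain p where p: "y = snd p" "p \<in> \<Phi> ` K \<inter> {g} \<times> topspace X"
        by (rule imageE)
      from IntD1[OF p(2)] obtain \<alpha> where \<alpha>: "p = \<Phi> \<alpha>" "\<alpha> \<in> K" by (rule imageE)
      then have "\<alpha> \<in> topspace Y" "\<Phi> \<alpha> = (g, y)" using K(2) p by (auto simp: prod_eq_iff)
      then show "y \<in> dom (\<theta> g)" by (elim \<Phi>_cases) auto
    qed
    moreover have "F y = 0" if y: "y \<notin> snd ` (\<Phi> ` K \<inter> {g} \<times> topspace X)" for y
    proof (rule ccontr)
      assume "F y \<noteq> 0"
      then obtain x where x: "\<theta> g y = Some x" "f (\<Psi> (g, y)) \<noteq> 0"
        by (auto simp: F_def split: if_splits)
      then have "(g, y) \<in> \<Phi> ` K \<inter> {g} \<times> topspace X"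
        using mem[OF g x] theta_topspace[OF g x(1)] by simp
      then show False using y by (metis image_eqI snd_conv)
    qed
    ultimately have "F \<in> Cc_on X (dom (\<theta> g))" unfolding Cc_on_def by blast
    from Cc.K_act[OF g openin_dom[OF g] subset_refl this]
    have "act_fun G \<theta> g F \<in> Cc_on X (ran (\<theta> g))" by (simp add: translate_dom)
    moreover have "act_fun G \<theta> g F = arrow_coeffs f g"
    proof
      fix x
      show "act_fun G \<theta> g F x = arrow_coeffs f g x"
      proof (cases "\<theta> (inv g) x")
        case (Some y)
        then have "\<theta> g y = Some x" using g by (simp add: theta_inv_iff)
        then show ?thesis using Some g by (auto simp: act_fun_Some arrow_coeffs_def F_def)
      qed (use g in \<open>simp add: act_fun_None arrow_coeffs_def\<close>)
    qed
    ultimately show ?thesis by simp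
  qed
  have "{g. arrow_coeffs f g \<noteq> (\<lambda>_. 0)} \<subseteq> carrier G"
    by (auto simp: arrow_coeffs_def fun_eq_iff)
  then show ?thesis
    using comp finite_subset[OF sub fin] by (simp add: cross_alg_simps(1))
qed

lemma arrow_coeffs_inject:
  assumes f: "\<And>\<alpha>. \<alpha> \<notin> topspace Y \<Longrightarrow> f \<alpha> = 0" and f': "\<And>\<alpha>. \<alpha> \<notin> topspace Y \<Longrightarrow> f' \<alpha> = 0"
    and eq: "arrow_coeffs f = arrow_coeffs f'"
  shows "f = f'"
proof
  fix \<alpha>
  show "f \<alpha> = f' \<alpha>"
  proof (cases "\<alpha> \<in> topspace Y")
    case True
    then obtain g y x where \<alpha>: "g \<in> carrier G" "\<theta> g y = Some x" "\<alpha> = \<Psi> (g, y)"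
      by (rule \<Phi>_cases)
    have "arrow_coeffs f g x = arrow_coeffs f' g x" using eq by simp
    then show ?thesis using \<alpha> by (simp add: arrow_coeffs_Some)
  qed (simp add: f f')
qed

lemma A_outside: "f \<in> acarrier A \<Longrightarrow> \<alpha> \<notin> topspace Y \<Longrightarrow> f \<alpha> = 0"
  unfolding A_carrier Cc_on_def by blast

lemma arrow_coeffs_surj:
  assumes b: "b \<in> acarrier Cc.B"
  obtains f where "f \<in> acarrier A" "arrow_coeffs f = b"
proof
  let ?prod = "prod_topology (discrete_topology (carrier G)) X"
  \<comment> \<open>The inverse formula: the arrow (g, y) receives the value of the coefficient at
    its range g y. Continuity is checked slice by slice, each slice over a group element being
    open.\<close>
  define F where "F p = (case p of (g, y) \<Rightarrow> b g (the (\<theta> g y)))" for p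
  define f where "f \<alpha> = (if \<alpha> \<in> topspace Y then F (\<Phi> \<alpha>) else 0)" for \<alpha>
  have "continuous_map (arrow_top W) euclidean F"
    unfolding continuous_map
  proof (intro conjI allI impI)
    fix V :: "complex set" assume V: "openin euclidean V"
    let ?V = "\<lambda>g. {y \<in> topspace (subtopology X (dom (\<theta> g))). b g (the (\<theta> g y)) \<in> V}"
    have op: "openin ?prod ({g} \<times> ?V g)" if g: "g \<in> carrier G" for g
    proof -
      have "continuous_map (subtopology X (dom (\<theta> g))) X (\<lambda>y. the (\<theta> g y))"
        using continuous_map_theta[OF g] by (simp add: continuous_map_in_subtopology)
      moreover have "continuous_map X euclidean (b g)"
        using Cc.B_K[OF b g] Cc_on_iff[OF Hausdorff_X openin_ran[OF g]] by blast
      ultimately have "continuous_map (subtopology X (dom (\<theta> g))) euclidean (b g \<circ> (\<lambda>y. the (\<theta> g y)))"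
        by (rule continuous_map_compose)
      from openin_continuous_map_preimage[OF this V]
      have "openin X (?V g)"
        using openin_trans_full[OF _ openin_dom[OF g]] by (simp add: o_def)
      then show ?thesis using g by (simp add: openin_prod_Times_iff)
    qed
    have "openin (arrow_top W) ((\<Union>g\<in>carrier G. {g} \<times> ?V g) \<inter> {(g, x). g \<in> carrier G \<and> x \<in> dom (\<theta> g)})"
      unfolding transformation_groupoid_def top_groupoid.simps
      by (intro openin_subtopology_Int openin_Union) (elim imageE, simp only: op)
    moreover have "(\<Union>g\<in>carrier G. {g} \<times> ?V g) \<inter> {(g, x). g \<in> carrier G \<and> x \<in> dom (\<theta> g)} =
        {p \<in> topspace (arrow_top W). F p \<in> V}"
      using theta_topspace(1) by (auto simp: topspace_W F_def)
    ultimately show "openin (arrow_top W) {p \<in> topspace (arrow_top W). F p \<in> V}" by simp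
  qed simp
  from continuous_map_compose[OF cont_\<Phi> this]
  have fc: "continuous_map Y euclidean f"
    by (rule continuous_map_eq) (simp add: f_def)
  let ?S = "{g. b g \<noteq> (\<lambda>_. 0)}"
  have "\<exists>K. compactin X K \<and> K \<subseteq> ran (\<theta> g) \<and> (\<forall>x. x \<notin> K \<longrightarrow> b g x = 0)" if "g \<in> carrier G" for g
    using Cc.B_K[OF b that] unfolding Cc_on_def by blast
  then obtain K where K: "\<And>g. g \<in> carrier G \<Longrightarrow> compactin X (K g)"
    "\<And>g. g \<in> carrier G \<Longrightarrow> K g \<subseteq> ran (\<theta> g)" "\<And>g x. g \<in> carrier G \<Longrightarrow> x \<notin> K g \<Longrightarrow> b g x = 0"
    by metis
  \<comment> \<open>The supports are translated back to the sources. As only finitely many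
    coefficients are non-zero, their union is compact.\<close>
  define L where "L = (\<Union>g\<in>?S. {g} \<times> translate (inv g) (K g))"
  have "compactin ?prod L"
    unfolding L_def
  proof (rule compactin_Union)
    show "finite ((\<lambda>g. {g} \<times> translate (inv g) (K g)) ` ?S)" using Cc.B_fin[OF b] by simp
    fix T assume "T \<in> (\<lambda>g. {g} \<times> translate (inv g) (K g)) ` ?S"
    then obtain g where T: "T = {g} \<times> translate (inv g) (K g)" "g \<in> carrier G"
      using Cc.B_supp[OF b] by auto
    then have "compactin X (translate (inv g) (K g))"
      using K by (intro compactin_translate) (simp_all add: dom_theta_inv)
    then show "compactin ?prod T" using T by (simp add: compactin_Times finite_imp_compactin_eq)
  qed
  moreover have "L \<subseteq> {(g, x). g \<in> carrier G \<and> x \<in> dom (\<theta> g)}"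
  proof
    fix p assume "p \<in> L"
    then obtain g y where p: "p = (g, y)" "g \<in> ?S" "y \<in> translate (inv g) (K g)"
      unfolding L_def by blast
    from p(3) obtain x where "\<theta> (inv g) x = Some y" unfolding translate_def by blast
    moreover have "g \<in> carrier G" using p(2) Cc.B_supp[OF b] by blast
    ultimately show "p \<in> {(g, x). g \<in> carrier G \<and> x \<in> dom (\<theta> g)}"
      using p(1) by (auto simp: theta_inv_iff)
  qed
  ultimately have "compactin (arrow_top W) L"
    by (simp add: transformation_groupoid_def compactin_subtopology)
  then have "compactin Y (\<Psi> ` L)" using cont_\<Psi> by (rule image_compactin)
  moreover have "f \<alpha> = 0" if "\<alpha> \<notin> \<Psi> ` L" for \<alpha>
  proof (rule ccontr)
    assume "f \<alpha> \<noteq> 0"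
    then have "\<alpha> \<in> topspace Y" "F (\<Phi> \<alpha>) \<noteq> 0" by (auto simp: f_def split: if_splits)
    then obtain g y x where \<alpha>: "\<Phi> \<alpha> = (g, y)" "g \<in> carrier G" "\<theta> g y = Some x" "\<alpha> = \<Psi> (g, y)"
      by (elim \<Phi>_cases)
    then have "b g x \<noteq> 0" using \<open>F (\<Phi> \<alpha>) \<noteq> 0\<close> by (simp add: F_def)
    then have "g \<in> ?S" "x \<in> K g" using K(3)[OF \<alpha>(2)] by auto
    then have "(g, y) \<in> L" using \<alpha> by (auto simp: L_def translate_def theta_inv_iff)
    then show False using that \<alpha>(4) by blast
  qed
  ultimately show "f \<in> acarrier A"
    unfolding A_carrier Cc_on_iff[OF Hausdorff_Y openin_topspace]
    using fc compactin_subset_topspace by blast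
  show "arrow_coeffs f = b"
  proof (intro ext)
    fix g x
    show "arrow_coeffs f g x = b g x"
    proof (cases "g \<in> carrier G")
      case g: True
      show ?thesis
      proof (cases "\<theta> (inv g) x")
        case None
        then show ?thesis using g Cc.B_outside[OF b g None] by (simp add: arrow_coeffs_def)
      next
        case (Some y)
        then have y: "\<theta> g y = Some x" using g by (simp add: theta_inv_iff)
        then show ?thesis
          using g \<Psi>_mem[OF g y] \<Phi>_\<Psi>[OF g y] by (simp add: arrow_coeffs_Some f_def F_def)
      qed
    next
      case False
      then have "b g = (\<lambda>_. 0)" using Cc.B_supp[OF b] by blast
      then show ?thesis using False by (simp add: arrow_coeffs_def)
    qed
  qed
qed

lemma arrow_coeffs_add: "arrow_coeffs (aadd A f f') = aadd Cc.B (arrow_coeffs f) (arrow_coeffs f')"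
  by (intro ext) (simp add: arrow_coeffs_def convolution_algebra_def cross_alg_simps split: option.split)

lemma arrow_coeffs_scale: "arrow_coeffs (ascale A c f) = ascale Cc.B c (arrow_coeffs f)"
  by (intro ext) (simp add: arrow_coeffs_def convolution_algebra_def cross_alg_simps split: option.split)

lemma ginv_\<Psi>:
  assumes "g \<in> carrier G" "\<theta> g y = Some x"
  shows "ginv P (\<Psi> (g, y)) = \<Psi> (inv g, x)"
proof -
  have "\<Phi> (ginv P (\<Psi> (g, y))) = (inv g, x)"
    using assms by (simp add: ginv_hom[OF \<Psi>_mem] \<Phi>_\<Psi> transformation_groupoid_def)
  then show ?thesis using \<Psi>\<Phi>[OF ginv_closed[OF \<Psi>_mem[OF assms]]] by simp
qed

lemma arrow_coeffs_star: "arrow_coeffs (astar A f) = astar Cc.B (arrow_coeffs f)"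
proof (intro ext)
  fix k x
  show "arrow_coeffs (astar A f) k x = astar Cc.B (arrow_coeffs f) k x"
  proof (cases "k \<in> carrier G")
    case k: True
    show ?thesis
    proof (cases "\<theta> (inv k) x")
      case (Some y)
      then have y: "\<theta> k y = Some x" using k by (simp add: theta_inv_iff)
      have "arrow_coeffs (astar A f) k x = cnj (f (\<Psi> (inv k, x)))"
        using k y \<Psi>_mem[OF k y] by (simp add: arrow_coeffs_Some convolution_algebra_def ginv_\<Psi>)
      then show ?thesis
        using k Some y by (simp add: Cc.star_eq arrow_coeffs_Some)
    qed (use k in \<open>simp add: arrow_coeffs_def Cc.star_eq\<close>)
  qed (simp add: arrow_coeffs_def Cc.star_eq)
qed

lemma composable_\<Psi>:
  assumes g: "g \<in> carrier G" "\<theta> g z = Some x" and h: "h \<in> carrier G" "\<theta> h y = Some w"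
  shows "gdom P (\<Psi> (g, z)) = gran P (\<Psi> (h, y)) \<longleftrightarrow> z = w"
  using composable[OF \<Psi>_mem[OF g] \<Psi>_mem[OF h]] \<Phi>_\<Psi>[OF g] \<Phi>_\<Psi>[OF h] h
  by (simp add: transformation_groupoid_def)

lemma gmul_\<Psi>:
  assumes g: "g \<in> carrier G" "\<theta> g z = Some x" and h: "h \<in> carrier G" "\<theta> h y = Some z"
  shows "gmul P (\<Psi> (g, z)) (\<Psi> (h, y)) = \<Psi> (g \<otimes> h, y)"
proof -
  have c: "gdom P (\<Psi> (g, z)) = gran P (\<Psi> (h, y))" using composable_\<Psi>[OF g h] by simp
  have "\<Phi> (gmul P (\<Psi> (g, z)) (\<Psi> (h, y))) = (g \<otimes> h, y)"
    unfolding gmul_hom[OF \<Psi>_mem[OF g] \<Psi>_mem[OF h] c] \<Phi>_\<Psi>[OF g] \<Phi>_\<Psi>[OF h]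
    by (simp add: transformation_groupoid_def)
  then show ?thesis using \<Psi>\<Phi>[OF gmul_closed[OF \<Psi>_mem[OF g] \<Psi>_mem[OF h] c]] by simp
qed

lemma \<Psi>_inject:
  "g \<in> carrier G \<Longrightarrow> \<theta> g y = Some x \<Longrightarrow> g' \<in> carrier G \<Longrightarrow> \<theta> g' y' = Some x' \<Longrightarrow>
    \<Psi> (g, y) = \<Psi> (g', y') \<longleftrightarrow> g = g' \<and> y = y'"
  by (metis \<Phi>_\<Psi> prod.inject)

text \<open>A factorization of the arrow (k, y) consists of (g, z) and (h, y) with g h = k and z = h
  y: the second factor starts at y, so the group elements determine both arrows. Thus the
  convolution sum is indexed by pairs of group elements.\<close>

lemma arrow_coeffs_mult:
  assumes f: "f \<in> acarrier A" and f': "f' \<in> acarrier A"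
  shows "arrow_coeffs (amult A f f') = amult Cc.B (arrow_coeffs f) (arrow_coeffs f')"
proof (intro ext)
  fix k x
  let ?F = "{g. arrow_coeffs f g \<noteq> (\<lambda>_. 0)}" and ?F' = "{g. arrow_coeffs f' g \<noteq> (\<lambda>_. 0)}"
  let ?t = "\<lambda>(g, h). if g \<otimes> h = k then Cc.mterm (arrow_coeffs f) (arrow_coeffs f') g h x else 0"
  note m = arrow_coeffs_mem[OF f] arrow_coeffs_mem[OF f']
  have R: "amult Cc.B (arrow_coeffs f) (arrow_coeffs f') k x = sum ?t (?F \<times> ?F')"
    by (rule Cc.mult_eq[OF Cc.B_fin[OF m(1)] Cc.B_supp[OF m(1)] subset_refl Cc.B_fin[OF m(2)] subset_refl])
  have fin: "finite (?F \<times> ?F')" using Cc.B_fin m by blast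
  have t_nonzero: "\<exists>z y. g \<otimes> h = k \<and> g \<in> carrier G \<and> h \<in> carrier G \<and> \<theta> g z = Some x \<and>
      \<theta> h y = Some z \<and> f (\<Psi> (g, z)) \<noteq> 0 \<and> f' (\<Psi> (h, y)) \<noteq> 0 \<and> \<theta> k y = Some x"
    if nz: "?t (g, h) \<noteq> 0" for g h
  proof -
    have gh: "g \<otimes> h = k" "Cc.mterm (arrow_coeffs f) (arrow_coeffs f') g h x \<noteq> 0"
      using nz by (auto split: if_splits)
    then obtain z where z: "\<theta> (inv g) x = Some z" "arrow_coeffs f g x \<noteq> 0" "arrow_coeffs f' h z \<noteq> 0"
      by (auto simp: Cc.mterm_def split: option.splits)
    from z(2) have g: "g \<in> carrier G" by (auto simp: arrow_coeffs_def split: if_splits)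
    from z(1) g have gz: "\<theta> g z = Some x" by (simp add: theta_inv_iff)
    from z(3) obtain y where y: "h \<in> carrier G" "\<theta> h y = Some z" "f' (\<Psi> (h, y)) \<noteq> 0"
      by (rule arrow_coeffs_nonzero)
    have "f (\<Psi> (g, z)) \<noteq> 0" using z(2) g gz by (simp add: arrow_coeffs_Some)
    moreover have "\<theta> k y = Some x" using theta_mult[OF g y(1,2) gz] gh(1) by simp
    ultimately show ?thesis using gh(1) g gz y by blast
  qed
  show "arrow_coeffs (amult A f f') k x = amult Cc.B (arrow_coeffs f) (arrow_coeffs f') k x"
  proof (cases "\<exists>y. k \<in> carrier G \<and> \<theta> k y = Some x")
    case True
    then obtain y where k: "k \<in> carrier G" and y: "\<theta> k y = Some x" by blast
    let ?S = "{(\<alpha>, \<beta>). \<alpha> \<in> topspace Y \<and> \<beta> \<in> topspace Y \<and> gdom P \<alpha> = gran P \<beta> \<and>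
      gmul P \<alpha> \<beta> = \<Psi> (k, y) \<and> f \<alpha> \<noteq> 0 \<and> f' \<beta> \<noteq> 0}"
    have S: "\<exists>g h z. \<alpha> = \<Psi> (g, z) \<and> \<beta> = \<Psi> (h, y) \<and> g \<in> carrier G \<and> h \<in> carrier G \<and>
        \<theta> g z = Some x \<and> \<theta> h y = Some z \<and> g \<otimes> h = k \<and> f \<alpha> \<noteq> 0 \<and> f' \<beta> \<noteq> 0"
      if "(\<alpha>, \<beta>) \<in> ?S" for \<alpha> \<beta>
    proof -
      have *: "\<alpha> \<in> topspace Y" "\<beta> \<in> topspace Y" "gdom P \<alpha> = gran P \<beta>" "gmul P \<alpha> \<beta> = \<Psi> (k, y)"
        "f \<alpha> \<noteq> 0" "f' \<beta> \<noteq> 0" using that by auto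
      obtain g z x' where g: "g \<in> carrier G" "\<theta> g z = Some x'" and \<alpha>: "\<alpha> = \<Psi> (g, z)"
        using \<Phi>_cases[OF *(1)] by metis
      obtain h y' w where h: "h \<in> carrier G" "\<theta> h y' = Some w" and \<beta>: "\<beta> = \<Psi> (h, y')"
        using \<Phi>_cases[OF *(2)] by metis
      have w: "w = z" using *(3) composable_\<Psi>[OF g h] \<alpha> \<beta> by simp
      then have h': "\<theta> h y' = Some z" using h by simp
      have th: "\<theta> (g \<otimes> h) y' = Some x'" by (rule theta_mult[OF g(1) h(1) h' g(2)])
      have "\<Psi> (g \<otimes> h, y') = \<Psi> (k, y)"
        using *(4) gmul_\<Psi>[OF g h(1) h'] \<alpha> \<beta> by simp
      then have "g \<otimes> h = k" "y' = y"
        using \<Psi>_inject[OF _ th k y] g h by auto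
      moreover from this have "x' = x" using th y by simp
      ultimately show ?thesis using g h' h(1) \<alpha> \<beta> *(5,6) by blast
    qed
    have "arrow_coeffs (amult A f f') k x = (\<Sum>(\<alpha>, \<beta>)\<in>?S. f \<alpha> * f' \<beta>)"
      using k y by (simp add: arrow_coeffs_Some convolution_algebra_def)
    \<comment> \<open>The product of supports also contains pairs with g h different from k or with
      h undefined at y. Their terms vanish, and the reindexing discards exactly the vanishing
      terms.\<close>
    also have "\<dots> = sum ?t (?F \<times> ?F')"
    proof (rule sum.reindex_bij_witness_not_neutral[where S' = "{}"
          and T' = "{p \<in> ?F \<times> ?F'. ?t p = 0}" and j = "\<lambda>(\<alpha>, \<beta>). (fst (\<Phi> \<alpha>), fst (\<Phi> \<beta>))"
          and i = "\<lambda>(g, h). (\<Psi> (g, the (\<theta> h y)), \<Psi> (h, y))"])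
      fix p assume "p \<in> ?S - {}"
      then obtain \<alpha> \<beta> where p: "p = (\<alpha>, \<beta>)" "(\<alpha>, \<beta>) \<in> ?S" by auto
      from S[OF p(2)] obtain g h z where gh: "\<alpha> = \<Psi> (g, z)" "\<beta> = \<Psi> (h, y)" "g \<in> carrier G"
        "h \<in> carrier G" "\<theta> g z = Some x" "\<theta> h y = Some z" "g \<otimes> h = k" "f \<alpha> \<noteq> 0" "f' \<beta> \<noteq> 0" by blast
      have \<Phi>: "\<Phi> \<alpha> = (g, z)" "\<Phi> \<beta> = (h, y)" using gh by (simp_all add: \<Phi>_\<Psi>)
      show "(case (case p of (\<alpha>, \<beta>) \<Rightarrow> (fst (\<Phi> \<alpha>), fst (\<Phi> \<beta>))) of
          (g, h) \<Rightarrow> (\<Psi> (g, the (\<theta> h y)), \<Psi> (h, y))) = p"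
        using p(1) \<Phi> gh by simp
      have cf: "arrow_coeffs f g x = f \<alpha>" "arrow_coeffs f' h z = f' \<beta>"
        using gh by (simp_all add: arrow_coeffs_Some)
      then have FF: "(g, h) \<in> ?F \<times> ?F'" using gh(8,9) by auto
      have "\<theta> (inv g) x = Some z" using gh by (simp add: theta_inv_iff)
      then have t: "?t (g, h) = f \<alpha> * f' \<beta>" using gh(7) cf by (simp add: Cc.mterm_def)
      then show "(case p of (\<alpha>, \<beta>) \<Rightarrow> (fst (\<Phi> \<alpha>), fst (\<Phi> \<beta>))) \<in>
          ?F \<times> ?F' - {p \<in> ?F \<times> ?F'. ?t p = 0}"
        using p(1) \<Phi> FF gh(8,9) by simp
    next
      fix p assume "p \<in> ?S"
      then obtain \<alpha> \<beta> where p: "p = (\<alpha>, \<beta>)" "(\<alpha>, \<beta>) \<in> ?S" by auto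
      from S[OF p(2)] obtain g h z where gh: "\<alpha> = \<Psi> (g, z)" "\<beta> = \<Psi> (h, y)" "g \<in> carrier G"
        "h \<in> carrier G" "\<theta> g z = Some x" "\<theta> h y = Some z" "g \<otimes> h = k" by blast
      have \<Phi>: "\<Phi> \<alpha> = (g, z)" "\<Phi> \<beta> = (h, y)" using gh by (simp_all add: \<Phi>_\<Psi>)
      have cf: "arrow_coeffs f g x = f \<alpha>" "arrow_coeffs f' h z = f' \<beta>"
        using gh by (simp_all add: arrow_coeffs_Some)
      have "\<theta> (inv g) x = Some z" using gh by (simp add: theta_inv_iff)
      then have "?t (g, h) = f \<alpha> * f' \<beta>" using gh(7) cf by (simp add: Cc.mterm_def)
      then show "?t (case p of (\<alpha>, \<beta>) \<Rightarrow> (fst (\<Phi> \<alpha>), fst (\<Phi> \<beta>))) = (case p of (\<alpha>, \<beta>) \<Rightarrow> f \<alpha> * f' \<beta>)"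
        using p(1) \<Phi> by simp
    next
      fix p assume "p \<in> ?F \<times> ?F' - {p \<in> ?F \<times> ?F'. ?t p = 0}"
      then obtain g h where p: "p = (g, h)" "?t (g, h) \<noteq> 0" by (cases p) blast
      from t_nonzero[OF p(2)] obtain z y' where gh: "g \<otimes> h = k" "g \<in> carrier G" "h \<in> carrier G"
        "\<theta> g z = Some x" "\<theta> h y' = Some z" "f (\<Psi> (g, z)) \<noteq> 0" "f' (\<Psi> (h, y')) \<noteq> 0" "\<theta> k y' = Some x"
        by blast
      \<comment> \<open>Both points are sent to x by k, and the action of k is injective.\<close>
      have "y' = y" using gh(8) y k theta_inv_iff[of k x] by (metis option.inject)
      then have hy: "\<theta> h y = Some z" using gh by simp
      show "(case (case p of (g, h) \<Rightarrow> (\<Psi> (g, the (\<theta> h y)), \<Psi> (h, y))) of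
          (\<alpha>, \<beta>) \<Rightarrow> (fst (\<Phi> \<alpha>), fst (\<Phi> \<beta>))) = p"
        using p(1) hy gh by (simp add: \<Phi>_\<Psi>)
      show "(case p of (g, h) \<Rightarrow> (\<Psi> (g, the (\<theta> h y)), \<Psi> (h, y))) \<in> ?S - {}"
        using p(1) hy gh \<open>y' = y\<close> \<Psi>_mem composable_\<Psi>[OF gh(2,4,3) hy] gmul_\<Psi>[OF gh(2,4,3) hy] by auto
    qed (use fin in auto)
    finally show ?thesis using R by simp
  next
    case False
    \<comment> \<open>No arrow (k, y) has range x. The coefficient then takes its default value 0,
      and a non-zero term on the other side would produce such an arrow by
      \<open>t_nonzero\<close>.\<close>
    then have "arrow_coeffs (amult A f f') k x = 0"
      using arrow_coeffs_nonzero[of "amult A f f'" k x] by blast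
    moreover have "?t p = 0" for p
    proof (rule ccontr)
      assume nz: "?t p \<noteq> 0"
      obtain g h where p: "p = (g, h)" by (cases p)
      then have "?t (g, h) \<noteq> 0" using nz by simp
      from t_nonzero[OF this] show False using False by auto
    qed
    ultimately show ?thesis using R by simp
  qed
qed

section \<open>Transfer between convolution and crossed product\<close>

lemma star_alg_hom_arrow_coeffs: "star_alg_hom A Cc.B arrow_coeffs"
  by standard (simp_all add: arrow_coeffs_mem arrow_coeffs_add arrow_coeffs_scale arrow_coeffs_mult arrow_coeffs_star)

lemma inj_on_arrow_coeffs: "inj_on arrow_coeffs (acarrier A)"
  by (rule inj_onI, rule arrow_coeffs_inject) (auto intro: A_outside)

text \<open>Coefficients in the compactly supported algebra come from some function in
  \<open>A\<close>, and functions vanishing off the arrows are determined by their coefficients. So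
  continuity and compact support of a convolution product are read off from the crossed
  product.\<close>

lemma A_memI:
  assumes "\<And>\<alpha>. \<alpha> \<notin> topspace Y \<Longrightarrow> f \<alpha> = 0" "arrow_coeffs f \<in> acarrier Cc.B"
  shows "f \<in> acarrier A"
proof -
  obtain f' where f': "f' \<in> acarrier A" "arrow_coeffs f' = arrow_coeffs f"
    using arrow_coeffs_surj[OF assms(2)] by metis
  then have "f' = f"
    by (intro arrow_coeffs_inject) (auto intro: A_outside assms(1))
  then show ?thesis using f'(1) by simp
qed

lemma star_alg_A: "star_alg A"
proof (rule star_alg_transfer[OF Cc.star_alg_B star_alg_hom_arrow_coeffs inj_on_arrow_coeffs])
  fix f f' c assume f: "f \<in> acarrier A"
  note ops = convolution_algebra_def star_algebra.simps
  show "ascale A c f \<in> acarrier A"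
  proof (rule A_memI)
    show "ascale A c f \<alpha> = 0" if "\<alpha> \<notin> topspace Y" for \<alpha>
      using A_outside[OF f that] by (simp only: ops mult_zero_right)
    show "arrow_coeffs (ascale A c f) \<in> acarrier Cc.B"
      unfolding arrow_coeffs_scale by (rule Cc.scale_mem[OF arrow_coeffs_mem[OF f]])
  qed
  show "astar A f \<in> acarrier A"
  proof (rule A_memI)
    show "astar A f \<alpha> = 0" if "\<alpha> \<notin> topspace Y" for \<alpha>
      using that by (simp only: ops if_False)
    show "arrow_coeffs (astar A f) \<in> acarrier Cc.B"
      unfolding arrow_coeffs_star by (rule Cc.star_mem[OF arrow_coeffs_mem[OF f]])
  qed
  assume f': "f' \<in> acarrier A"
  show "aadd A f f' \<in> acarrier A"
  proof (rule A_memI)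
    show "aadd A f f' \<alpha> = 0" if "\<alpha> \<notin> topspace Y" for \<alpha>
      using A_outside[OF f that] A_outside[OF f' that] by (simp only: ops add_0)
    show "arrow_coeffs (aadd A f f') \<in> acarrier Cc.B"
      unfolding arrow_coeffs_add
      by (rule Cc.add_mem[OF arrow_coeffs_mem[OF f] arrow_coeffs_mem[OF f']])
  qed
  show "amult A f f' \<in> acarrier A"
  proof (rule A_memI)
    fix \<gamma> assume \<gamma>: "\<gamma> \<notin> topspace Y"
    have "{(\<alpha>, \<beta>). \<alpha> \<in> topspace Y \<and> \<beta> \<in> topspace Y \<and> gdom P \<alpha> = gran P \<beta> \<and>
        gmul P \<alpha> \<beta> = \<gamma> \<and> f \<alpha> \<noteq> 0 \<and> f' \<beta> \<noteq> 0} = {}"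
      using gmul_closed \<gamma> by blast
    then have "(\<Sum>(\<alpha>, \<beta>)\<in>{(\<alpha>, \<beta>). \<alpha> \<in> topspace Y \<and> \<beta> \<in> topspace Y \<and> gdom P \<alpha> = gran P \<beta> \<and>
        gmul P \<alpha> \<beta> = \<gamma> \<and> f \<alpha> \<noteq> 0 \<and> f' \<beta> \<noteq> 0}. f \<alpha> * f' \<beta>) = 0"
      by (simp only: sum.empty)
    then show "amult A f f' \<gamma> = 0"
      by (simp only: ops)
  next
    show "arrow_coeffs (amult A f f') \<in> acarrier Cc.B"
      unfolding arrow_coeffs_mult[OF f f']
      by (rule Cc.mult_mem[OF arrow_coeffs_mem[OF f] arrow_coeffs_mem[OF f']])
  qed
qed

text \<open>Coefficients give an isomorphism onto the compactly supported algebra. Transporting p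
  along its inverse yields a C*-seminorm there, to which the l1-bound applies.\<close>

lemma cstar_seminorm_A_bound:
  assumes p: "cstar_seminorm A p" and f: "f \<in> acarrier A"
  shows "p f \<le> l1_norm (arrow_coeffs f)"
proof -
  define k where "k = inv_into (acarrier A) arrow_coeffs"
  have img: "arrow_coeffs ` acarrier A = acarrier Cc.B"
    using arrow_coeffs_mem arrow_coeffs_surj by (metis (no_types, lifting) image_iff subsetI subset_antisym)
  have k: "k b \<in> acarrier A" "arrow_coeffs (k b) = b" if "b \<in> acarrier Cc.B" for b
    using that inv_into_into[of b arrow_coeffs "acarrier A"] f_inv_into_f[of b arrow_coeffs "acarrier A"] img
    by (simp_all add: k_def)
  have k_arrow_coeffs: "k (arrow_coeffs f) = f" if "f \<in> acarrier A" for f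
    using inv_into_f_f[OF inj_on_arrow_coeffs that] by (simp add: k_def)
  interpret A: star_alg A by (rule star_alg_A)
  interpret star_alg_hom A Cc.B arrow_coeffs by (rule star_alg_hom_arrow_coeffs)
  have "star_alg_hom Cc.B A k"
  proof
    fix a b c assume a: "a \<in> acarrier Cc.B"
    show "k a \<in> acarrier A" using a by (rule k)
    show "k (ascale Cc.B c a) = ascale A c (k a)"
      using k_arrow_coeffs[of "ascale A c (k a)"] k[OF a] by (simp add: hom_scale)
    show "k (astar Cc.B a) = astar A (k a)"
      using k_arrow_coeffs[of "astar A (k a)"] k[OF a] by (simp add: hom_star)
    assume b: "b \<in> acarrier Cc.B"
    show "k (aadd Cc.B a b) = aadd A (k a) (k b)"
      using k_arrow_coeffs[of "aadd A (k a) (k b)"] k[OF a] k[OF b] by (simp add: hom_add)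
    show "k (amult Cc.B a b) = amult A (k a) (k b)"
      using k_arrow_coeffs[of "amult A (k a) (k b)"] k[OF a] k[OF b] by (simp add: hom_mult)
  qed
  then have "cstar_seminorm Cc.B (\<lambda>b. p (k b))"
    using p by (rule cstar_seminorm_restrict[OF Cc.star_alg_B])
  from Cc.cstar_seminorm_le_l1_norm[OF this arrow_coeffs_mem[OF f]]
  show ?thesis by (simp add: k_arrow_coeffs f)
qed

theorem cstar_iso_groupoid_crossed_product:
  "cstar_iso (groupoid_cstar P) (partial_crossed_product G X \<theta>)"
  unfolding groupoid_cstar_def partial_crossed_product_def cross_alg_C0[symmetric]
proof (rule cstar_iso_enveloping[OF star_alg_A C0.seminormed_B])
  \<comment> \<open>The algebras with coefficients in Cc and in C0 share their operations and differ
    in the carrier, so enlarging the target keeps the homomorphism.\<close>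
  show "star_alg_hom A C0.B arrow_coeffs"
    using star_alg_hom_arrow_coeffs Cc_subset_C0 by (simp add: star_alg_hom_def cross_alg_simps(2-))
  show "\<exists>f\<in>acarrier A. pdist C0.B l1_norm b (arrow_coeffs f) < \<epsilon>"
    if b: "b \<in> acarrier C0.B" and \<epsilon>: "\<epsilon> > 0" for b \<epsilon>
  proof -
    obtain a where a: "a \<in> acarrier Cc.B" "pdist C0.B l1_norm b a < \<epsilon>"
      using Cc_dense[OF b \<epsilon>] by blast
    obtain f where "f \<in> acarrier A" "arrow_coeffs f = a" using arrow_coeffs_surj[OF a(1)] by metis
    then show ?thesis using a(2) by blast
  qed
qed (fact cstar_seminorm_A_bound C0.cstar_seminorm_le_l1_norm)+

end

theorem theorem5p3:
  fixes H :: "('h, 'm) monoid_scheme"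
    and \<phi> :: "'s::inverse_semigroup_zero \<Rightarrow> 'h"
  assumes "countable (UNIV :: 's set)"
    and "group H"
    and "partial_hom H \<phi>"
    and "idempotent_pure H \<phi>"
  shows "let G = (universal_group :: ('s \<times> bool) list set monoid);
             X = (tight_top :: ('s \<Rightarrow> bool) topology);
             T = (tight_groupoid :: (('s \<times> ('s \<Rightarrow> bool)) set, 's \<Rightarrow> bool) top_groupoid)
         in (\<exists>\<theta>. partial_action G X \<theta> \<and>
               top_groupoid_iso T (transformation_groupoid G X \<theta>) \<and>
               cstar_iso (groupoid_cstar T) (partial_crossed_product G X \<theta>)) \<and>
            Hausdorff_space (arrow_top T)"
proof -
  \<comment> \<open>The group \<open>H\<close> and the map \<phi> are used up here; they only serve
    to make the canonical map idempotent pure.\<close>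
  interpret S: pure_semigroup "TYPE('s)"
    by standard (rule univ_gen_idempotent_pure[OF assms(2-4)])
  interpret T: transformation_groupoid_iso universal_group tight_top tight_action
      "tight_groupoid :: (('s \<times> ('s \<Rightarrow> bool)) set, 's \<Rightarrow> bool) top_groupoid"
      S.germ_to_pair S.pair_to_germ
  proof (intro transformation_groupoid_iso.intro partial_act.intro
      transformation_groupoid_iso_axioms.intro)
    show "homeomorphic_maps (arrow_top tight_groupoid) (arrow_top S.tight_transformation)
        S.germ_to_pair S.pair_to_germ"
      by (rule S.homeomorphic_maps_germs)
  qed (simp_all add: S.partial_action_tight S.germ_to_pair_hom S.gmul_tight_groupoid_closed)
  show ?thesis
    unfolding Let_def
    using S.partial_action_tight S.top_groupoid_iso_tight T.cstar_iso_groupoid_crossed_product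
      S.Hausdorff_tight_groupoid by blast
qed

end
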